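(* Let $\widetilde{\mathcal T}$ be a tagged triangulation of $S_\odot$ whose arcs, transported to plain arcs via the bijection $D^1_{ij}\leftrightarrow D_{ij}$, $D^1_{i0}\leftrightarrow D_{i0}$, $D^{-1}_{i0}\leftrightarrow D_{ii}$, form a slice, and let $\mathbf x$ be the corresponding cluster of the cluster algebra $\mathcal A$ of type $D_N$ with trivial coefficients. Then $F(\widetilde{\mathcal T})=F_c(\widetilde{\mathcal T})$, i.e. for every plain arc $D$ of $S_\odot$ the number assigned to $D$ by $F(\widetilde{\mathcal T})$ equals the integer $u_D$ obtained from the cluster variable of $D$ by specialising all elements of $\mathbf x$ to $1$.
   Context: $S_\odot$ is a closed disc with $N\ge 3$ marked boundary points $1,\dots,N$ (clockwise, indices mod $N$) and a puncture $0$. For boundary vertices $k,l$, $B_{kl}$ is the clockwise boundary path from $k$ to $l$ ($B_{kk}$ the whole boundary) and $V_{kl}=\{k,k+1,\dots,l\}$ its marked points. Plain arcs (up to isotopy, simple, interiors avoiding boundary and marked points): $D_{ij}$ for boundary $i,j$ with $j\ne i+1$ (possibly $j=i$), the arc from $i$ to $j$ bounding together with $B_{ij}$ a disc not containing the puncture ($D_{ii}$ is the loop at $i$ around the puncture), and central arcs $D_{i0}$. A triangulation $\mathcal T$ is a maximal set of pairwise non-crossing plain arcs; it has $N$ triangles (possibly one self-folded triangle with sides $D_{i0},D_{ii}$, occurring exactly when $D_{i0}$ is the only central arc); $d_0$ is the number of triangles incident with $0$. A (piece of a) triangle is incident with a marked point if that point is a corner of it lying on its closure. A matching between a set $I$ of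 marked points and a set $R$ of regions is an injective map $I\to R$ sending each point to an incident region; $\mathcal M(I,R)$ is the set of these. For $i\ne j$, $j\ne i+1$: $S_{ij}$ is the unpunctured disc bounded by $D_{ij}$ and $B_{ij}$, and $\mathcal T|_{S_{ij}}$ is the set of connected components of intersections of triangles of $\mathcal T$ with $S_{ij}$ (a triangle crossed by $D_{ij}$ may give two pieces). $P(i)$: if $\mathcal T$ has $\ge2$ central arcs, with $k$ the first boundary vertex anticlockwise from $i$ (starting at $i$) with $D_{k0}\in\mathcal T$ and $j$ the first boundary vertex strictly clockwise from $i$ with $D_{j0}\in\mathcal T$, $P(i)$ is the disc bounded by $B_{kj},D_{j0},D_{k0}$ with marked points $V_{kj}\cup\{0\}$; if $\mathcal T$ has exactly one central arc $D_{k0}$, $P(i)$ is $S_\odot$ cut open along $D_{k0}$, with marked points clockwise $k',k+1,\dots,k-1,k,0$; in both cases triangulated by the triangles of $\mathcal T$. Matching numbers of $\mathcal T$: $m_{i,i+1}=1$; $m_{ij}=|\mathcal M(V_{i+1,j-1},\mathcal T|_{S_{ij}})|$ ($i\ne j$, $j\neq i+1$); $m_{ii}=|\mathcal M((\{1,\dots,N\}\setminus\{i\})\cup\{0\},\text{triangles of }\mathcal T)|$; $m_{i0}=|\mathcal M(V(P(i))\setminus\{i,0\},\text{triangles of }P(i))|$. $F(\mathcal T)$ denotes the assignment $D_{ij}\mapsto m_{ij}$, $D_{i0}\mapsto m_{i0}$. Tagged arcs: $D^1_{ij}$ ($j\ne i,i+1$), $D^1_{i0}$, $D^{-1}_{i0}$,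 in bijection with plain arcs as in the claim. Tagged triangulations come from triangulations $\mathcal T$: if $d_0=1$ (so $D_{i0},D_{ii}\in\mathcal T$), replace $D_{ii}$ by $D^{-1}_{i0}$, all others tagged $1$; if $d_0\ge2$, tag non-central arcs $1$ and either all central arcs $1$ or all central arcs $-1$. $F(\widetilde{\mathcal T})$: if $\widetilde{\mathcal T}$ has at most one arc tagged $-1$, it is $F(\mathcal T)$ for the triangulation $\mathcal T$ corresponding under the bijection; if it has at least two arcs tagged $-1$, let $\mathcal T'$ consist of the $D_{i0}$ with $D^{-1}_{i0}\in\widetilde{\mathcal T}$ and the $D_{ij}$ with $D^1_{ij}\in\widetilde{\mathcal T}$, and $F(\widetilde{\mathcal T})$ assigns $m_{ij}(\mathcal T')$ to $D_{ij}$ for $i\ne j$, $m_{i0}(\mathcal T')$ to $D_{ii}$ and $m_{ii}(\mathcal T')$ to $D_{i0}$ (the values on $D_{ii}$ and $D_{i0}$ interchanged). Cluster side: by Fomin–Shapiro–Thurston and Schiffler, cluster variables of $\mathcal A$ correspond bijectively to tagged arcs and clusters to tagged triangulations (standard bijection); via the bijection with plain arcs, each plain arc $D$ has a cluster variable $x_D$, a Laurent polynomial in the elements of $\mathbf x$; $u_D$ is its value at all elements of $\mathbf x$ equal to $1$, and $F_c(\widetilde{\mathcal T})$ is the assignment $D\mapsto u_D$. Slice: a set $\{E_1,\dots,E_N\}$ of plain arcs with $E_1=D_{a,a+2}$ for some $a$; for $2\le k\le N-2$, if $E_{k-1}=D_{p,q}$ then $E_k\in\{D_{p,q+1},D_{p-1,q}\}$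 (so $E_{N-2}=D_{i,i-1}$); and $\{E_{N-1},E_N\}$ is one of $\{D_{i0},D_{ii}\}$, $\{D_{i-1,0},D_{i-1,i-1}\}$, $\{D_{i0},D_{i-1,0}\}$, $\{D_{ii},D_{i-1,i-1}\}$. (This is the paper's notion of slice positions in the frieze array, expressed via arcs; equivalently, the quiver of the seed is an orientation of the Dynkin diagram $D_N$.)
   Formalization: A matching also records which corner of the region lies at the point, so for m_ii with a loop D_kk in T the triangle outside the loop counts for k once per corner; with plain injective maps the claim fails (N=3, T={D_30,D_33,D_32}: m_22=1 but u=2). *)

theory Defs
  imports
    Complex_Main
    "HOL-Library.FuncSet"
    "HOL-Library.Poly_Mapping"
    "HOL-Computational_Algebra.Fraction_Field"
begin

text \<open>
  Conventions. The boundary marked points of the punctured disc are the residues mod \<open>N\<close>, represented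
  by \<open>1, \<dots>, N\<close>, and are numbered clockwise. Arcs, triangles and pieces of triangles are described in
  the universal cover of the punctured disc. There the boundary marked points lift to all integers
  (clockwise = increasing), the puncture lifts to a single point at infinity, the deck
  transformations are the translations by multiples of \<open>N\<close>, and every arc is drawn as a geodesic
  between its end points, so that curves are in minimal position.
\<close>

subsection \<open>Plain arcs and triangulations\<close>

definition nrm :: "nat \<Rightarrow> int \<Rightarrow> int" where
  "nrm N i = (i - 1) mod int N + 1"

text \<open>The number of boundary segments of the clockwise boundary path from \<open>i\<close> to \<open>j\<close>;
  it is \<open>N\<close> for \<open>j = i\<close>. The path lifts to the interval from \<open>i\<close> to \<open>i + blen N i j\<close>.\<close>

definition blen :: "nat \<Rightarrow> int \<Rightarrow> int \<Rightarrow> int" where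
  "blen N i j = (j - i - 1) mod int N + 1"

text \<open>\<open>Periph i j\<close> is the arc \<open>D\<^sub>i\<^sub>j\<close> (a loop around the puncture if \<open>i = j\<close>),
  \<open>Central i\<close> is the arc from \<open>i\<close> to the puncture.\<close>

datatype arc = Periph int int | Central int

definition plain_arcs :: "nat \<Rightarrow> arc set" where
  "plain_arcs N =
     {Periph i j | i j. i \<in> {1..int N} \<and> j \<in> {1..int N} \<and> j \<noteq> nrm N (i + 1)} \<union>
     {Central i | i. i \<in> {1..int N}}"

text \<open>The lifts of \<open>Periph i j\<close> are the geodesics from \<open>i + t * N\<close> to \<open>i + blen N i j + t * N\<close>, those of
  \<open>Central i\<close> are the geodesics from \<open>i + t * N\<close> to infinity. Two arcs cross iff some lift of one
  and some lift of the other have strictly interlacing end points.\<close>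

fun crosses :: "nat \<Rightarrow> arc \<Rightarrow> arc \<Rightarrow> bool" where
  "crosses N (Periph i j) (Periph k l) \<longleftrightarrow>
     (\<exists>t::int. let a = i; b = i + blen N i j; c = k + t * int N; d = c + blen N k l
        in (a < c \<and> c < b \<and> b < d) \<or> (c < a \<and> a < d \<and> d < b))"
| "crosses N (Periph i j) (Central k) \<longleftrightarrow>
     (\<exists>t::int. i < k + t * int N \<and> k + t * int N < i + blen N i j)"
| "crosses N (Central k) (Periph i j) \<longleftrightarrow>
     (\<exists>t::int. i < k + t * int N \<and> k + t * int N < i + blen N i j)"
| "crosses N (Central k) (Central l) \<longleftrightarrow> False"

definition noncrossing :: "nat \<Rightarrow> arc set \<Rightarrow> bool" where
  "noncrossing N T \<longleftrightarrow> T \<subseteq> plain_arcs N \<and> (\<forall>D\<in>T. \<forall>E\<in>T. \<not> crosses N D E)"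

definition triangulation :: "nat \<Rightarrow> arc set \<Rightarrow> bool" where
  "triangulation N T \<longleftrightarrow> noncrossing N T \<and> (\<forall>T'. noncrossing N T' \<longrightarrow> T \<subseteq> T' \<longrightarrow> T' = T)"

subsection \<open>Triangles\<close>

datatype vertex = Bd int | Puncture

text \<open>Triangles of the universal cover: \<open>Tri a b c\<close> has corners \<open>a < b < c\<close>, \<open>CTri a b\<close> has corners
  \<open>a < b\<close> and the puncture. In both cases the corners are listed clockwise.\<close>

datatype ltri = Tri int int int | CTri int int

fun corners :: "ltri \<Rightarrow> vertex set" where
  "corners (Tri a b c) = {Bd a, Bd b, Bd c}"
| "corners (CTri a b) = {Bd a, Bd b, Puncture}"

fun first_corner :: "ltri \<Rightarrow> int" where
  "first_corner (Tri a b c) = a"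
| "first_corner (CTri a b) = a"

fun proj :: "nat \<Rightarrow> vertex \<Rightarrow> vertex" where
  "proj N (Bd a) = Bd (nrm N a)"
| "proj N Puncture = Puncture"

definition lifted_side :: "nat \<Rightarrow> arc set \<Rightarrow> int \<Rightarrow> int \<Rightarrow> bool" where
  "lifted_side N T a b \<longleftrightarrow>
     b = a + 1 \<or> (a + 2 \<le> b \<and> b \<le> a + int N \<and> Periph (nrm N a) (nrm N b) \<in> T)"

definition lifted_spoke :: "nat \<Rightarrow> arc set \<Rightarrow> int \<Rightarrow> bool" where
  "lifted_spoke N T a \<longleftrightarrow> Central (nrm N a) \<in> T"

text \<open>The lifts of the triangles of \<open>T\<close>. A self-folded triangle with sides \<open>Central i\<close> and
  \<open>Periph i i\<close> lifts to \<open>CTri i (i + N)\<close>.\<close>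

definition lifted_triangles :: "nat \<Rightarrow> arc set \<Rightarrow> ltri set" where
  "lifted_triangles N T =
     {Tri a b c | a b c. a < b \<and> b < c \<and>
        lifted_side N T a b \<and> lifted_side N T b c \<and> lifted_side N T a c} \<union>
     {CTri a b | a b. a < b \<and>
        lifted_side N T a b \<and> lifted_spoke N T a \<and> lifted_spoke N T b}"

text \<open>Each triangle of \<open>T\<close> in the punctured disc is represented by its unique lift whose first
  corner lies in \<open>1, \<dots>, N\<close>.\<close>

definition triangles :: "nat \<Rightarrow> arc set \<Rightarrow> ltri set" where
  "triangles N T = {\<Delta> \<in> lifted_triangles N T. first_corner \<Delta> \<in> {1..int N}}"

definition d0 :: "nat \<Rightarrow> arc set \<Rightarrow> nat" where
  "d0 N T = card {\<Delta> \<in> triangles N T. Puncture \<in> corners \<Delta>}"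

subsection \<open>Matching numbers\<close>

text \<open>
  A matching sends each point \<open>v\<close> of \<open>I\<close> to a region in \<open>R\<close> together with a corner of that region
  lying over \<open>v\<close> (with respect to \<open>\<pi>\<close>), distinct points having distinct regions. If no region of \<open>R\<close>
  has two corners over the same point of \<open>I\<close>, this is the same as an injective map from \<open>I\<close> to
  \<open>R\<close> sending each point to an incident region. The corner matters only for \<open>m_loop\<close>, and only
  when \<open>T\<close> contains a loop \<open>Periph k k\<close>: the triangle outside the loop then has two corners at \<open>k\<close>,
  and using it for \<open>k\<close> at one or at the other are two different matchings.
\<close>

definition matchings ::
    "(vertex \<Rightarrow> vertex) \<Rightarrow> vertex set \<Rightarrow> ltri set \<Rightarrow> (vertex \<Rightarrow> ltri \<times> vertex) set" where
  "matchings \<pi> I R =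
     {f \<in> I \<rightarrow>\<^sub>E (SIGMA \<Delta>:R. corners \<Delta>).
        inj_on (\<lambda>v. fst (f v)) I \<and> (\<forall>v\<in>I. \<pi> (snd (f v)) = v)}"

text \<open>For \<open>i \<noteq> j\<close> the disc \<open>S\<^sub>i\<^sub>j\<close> lifts homeomorphically to the polygon with vertices \<open>i, \<dots>, j'\<close>, where
  \<open>j' = i + blen N i j\<close>. The connected components of the intersections of triangles of \<open>T\<close> with \<open>S\<^sub>i\<^sub>j\<close>
  correspond to the lifted triangles meeting the interior of this polygon (two lifts of one triangle
  give two pieces). Since the geodesic from \<open>i\<close> to \<open>j'\<close> bounds the polygon inside the half plane,
  these are the lifted triangles with a corner strictly between \<open>i\<close> and \<open>j'\<close>.\<close>

definition pieces :: "nat \<Rightarrow> arc set \<Rightarrow> int \<Rightarrow> int \<Rightarrow> ltri set" where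
  "pieces N T i j =
     {\<Delta> \<in> lifted_triangles N T. \<exists>v. Bd v \<in> corners \<Delta> \<and> i < v \<and> v < i + blen N i j}"

definition m_arc :: "nat \<Rightarrow> arc set \<Rightarrow> int \<Rightarrow> int \<Rightarrow> nat" where
  "m_arc N T i j = card (matchings id (Bd ` {i <..< i + blen N i j}) (pieces N T i j))"

definition m_loop :: "nat \<Rightarrow> arc set \<Rightarrow> int \<Rightarrow> nat" where
  "m_loop N T i =
     card (matchings (proj N) (Bd ` ({1..int N} - {i}) \<union> {Puncture}) (triangles N T))"

text \<open>The disc \<open>P(i)\<close> lifts to the polygon with vertices \<open>k, \<dots>, j\<close> and the puncture, where
  \<open>(k, j) = P_ends N T i\<close>. If \<open>T\<close> has only one central arc, at \<open>k\<close>, the copy \<open>k'\<close> is the left end and the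
  copy called \<open>k\<close> is the right end \<open>k + N\<close> of the strip; hence for \<open>i = k\<close> the vertex \<open>i\<close> is the
  right end.\<close>

definition P_ends :: "nat \<Rightarrow> arc set \<Rightarrow> int \<Rightarrow> int \<times> int" where
  "P_ends N T i =
     (if card {k. Central k \<in> T} \<ge> 2
      then (Max {k \<in> {i - int N..i}. lifted_spoke N T k},
            Min {j \<in> {i + 1..i + int N}. lifted_spoke N T j})
      else (let k = Max {k \<in> {i - int N..i - 1}. lifted_spoke N T k} in (k, k + int N)))"

definition P_vertices :: "nat \<Rightarrow> arc set \<Rightarrow> int \<Rightarrow> vertex set" where
  "P_vertices N T i = Bd ` {fst (P_ends N T i)..snd (P_ends N T i)} \<union> {Puncture}"

definition P_triangles :: "nat \<Rightarrow> arc set \<Rightarrow> int \<Rightarrow> ltri set" where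
  "P_triangles N T i = {\<Delta> \<in> lifted_triangles N T. corners \<Delta> \<subseteq> P_vertices N T i}"

definition m_central :: "nat \<Rightarrow> arc set \<Rightarrow> int \<Rightarrow> nat" where
  "m_central N T i =
     card (matchings id (P_vertices N T i - {Bd i, Puncture}) (P_triangles N T i))"

fun F_plain :: "nat \<Rightarrow> arc set \<Rightarrow> arc \<Rightarrow> nat" where
  "F_plain N T (Periph i j) = (if i = j then m_loop N T i else m_arc N T i j)"
| "F_plain N T (Central i) = m_central N T i"

subsection \<open>Tagged arcs\<close>

text \<open>\<open>TPeriph i j\<close> and \<open>TPlain i\<close> carry the tag \<open>1\<close>, \<open>TNotched i\<close> is the central arc at \<open>i\<close> with tag \<open>-1\<close>.\<close>

datatype tarc = TPeriph int int | TPlain int | TNotched int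

fun tag :: "arc \<Rightarrow> tarc" where
  "tag (Periph i j) = (if i = j then TNotched i else TPeriph i j)"
| "tag (Central i) = TPlain i"

fun plain_of :: "tarc \<Rightarrow> arc" where
  "plain_of (TPeriph i j) = Periph i j"
| "plain_of (TPlain i) = Central i"
| "plain_of (TNotched i) = Periph i i"

fun notch :: "arc \<Rightarrow> tarc" where
  "notch (Periph i j) = TPeriph i j"
| "notch (Central i) = TNotched i"

fun forget_tag :: "tarc \<Rightarrow> arc" where
  "forget_tag (TPeriph i j) = Periph i j"
| "forget_tag (TPlain i) = Central i"
| "forget_tag (TNotched i) = Central i"

text \<open>A triangulation with \<open>d0 \<ge> 2\<close> contains no loop, so that \<open>tag\<close> then tags all its arcs with \<open>1\<close>.\<close>

definition tagged_triangulation :: "nat \<Rightarrow> tarc set \<Rightarrow> bool" where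
  "tagged_triangulation N TT \<longleftrightarrow>
     (\<exists>T. triangulation N T \<and>
        (d0 N T = 1 \<and> TT = tag ` T \<or>
         d0 N T \<ge> 2 \<and> (TT = tag ` T \<or> TT = notch ` T)))"

definition many_notched :: "tarc set \<Rightarrow> bool" where
  "many_notched TT \<longleftrightarrow> card {i. TNotched i \<in> TT} \<ge> 2"

definition F_tagged :: "nat \<Rightarrow> tarc set \<Rightarrow> arc \<Rightarrow> nat" where
  "F_tagged N TT D =
     (if \<not> many_notched TT then F_plain N (plain_of ` TT) D
      else let T' = forget_tag ` TT in
        (case D of
           Periph i j \<Rightarrow> if i = j then m_central N T' i else m_arc N T' i j
         | Central i \<Rightarrow> m_loop N T' i))"

subsection \<open>Slices\<close>

definition slice :: "nat \<Rightarrow> arc set \<Rightarrow> bool" where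
  "slice N S \<longleftrightarrow>
     (\<exists>E :: nat \<Rightarrow> arc.
        S = E ` {1..N} \<and>
        (\<exists>a\<in>{1..int N}. E 1 = Periph a (nrm N (a + 2))) \<and>
        (\<forall>k\<in>{2..N - 2}. \<exists>p q. E (k - 1) = Periph p q \<and>
           E k \<in> {Periph p (nrm N (q + 1)), Periph (nrm N (p - 1)) q}) \<and>
        (\<exists>i h. E (N - 2) = Periph i h \<and> h = nrm N (i - 1) \<and>
           {E (N - 1), E N} \<in> {{Central i, Periph i i}, {Central h, Periph h h},
                               {Central i, Central h}, {Periph i i, Periph h h}}))"

subsection \<open>The signed adjacency matrix of a tagged triangulation\<close>

text \<open>Fomin, Shapiro and Thurston: the entry at \<open>(D, E)\<close> is the sum over all triangles which are not
  self-folded of \<open>1\<close> (resp. \<open>-1\<close>) if \<open>E\<close> follows \<open>D\<close> clockwise (resp. anticlockwise) among the sides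
  of the triangle, where the inner side of a self-folded triangle is first replaced by the
  enclosing loop.\<close>

fun cw_sides :: "nat \<Rightarrow> ltri \<Rightarrow> (arc \<times> arc) set" where
  "cw_sides N (Tri a b c) =
     (let s = Periph (nrm N a) (nrm N b); t = Periph (nrm N b) (nrm N c);
          u = Periph (nrm N a) (nrm N c)
      in {(s, t), (t, u), (u, s)})"
| "cw_sides N (CTri a b) =
     (let s = Periph (nrm N a) (nrm N b); t = Central (nrm N b); u = Central (nrm N a)
      in {(s, t), (t, u), (u, s)})"

definition self_folded :: "nat \<Rightarrow> ltri \<Rightarrow> bool" where
  "self_folded N \<Delta> \<longleftrightarrow> (\<exists>a. \<Delta> = CTri a (a + int N))"

fun unfold_arc :: "arc set \<Rightarrow> arc \<Rightarrow> arc" where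
  "unfold_arc T (Central i) = (if Periph i i \<in> T then Periph i i else Central i)"
| "unfold_arc T (Periph i j) = Periph i j"

definition signed_adj :: "nat \<Rightarrow> arc set \<Rightarrow> arc \<Rightarrow> arc \<Rightarrow> int" where
  "signed_adj N T D E =
     (\<Sum>\<Delta> \<in> {\<Delta> \<in> triangles N T. \<not> self_folded N \<Delta>}.
        of_bool ((unfold_arc T D, unfold_arc T E) \<in> cw_sides N \<Delta>)
      - of_bool ((unfold_arc T E, unfold_arc T D) \<in> cw_sides N \<Delta>))"

text \<open>The signed adjacency matrix of a tagged triangulation is that of the underlying triangulation:
  if all central arcs have tag \<open>-1\<close> the tags are forgotten, and if both tags occur the arc with
  tag \<open>-1\<close> becomes the loop.\<close>

definition signed_adj_tagged :: "nat \<Rightarrow> tarc set \<Rightarrow> tarc \<Rightarrow> tarc \<Rightarrow> int" where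
  "signed_adj_tagged N TT \<gamma> \<delta> =
     (let g = (if many_notched TT then forget_tag else plain_of)
      in signed_adj N (g ` TT) (g \<gamma>) (g \<delta>))"

subsection \<open>Seeds and cluster variables\<close>

text \<open>The rational functions over the rationals in indeterminates indexed by natural numbers.\<close>

type_synonym ratpoly = "(nat \<Rightarrow>\<^sub>0 nat) \<Rightarrow>\<^sub>0 rat"

type_synonym ratfun = "ratpoly fract"

definition indet :: "nat \<Rightarrow> ratfun" where
  "indet i = Fraction_Field.Fract (Poly_Mapping.single (Poly_Mapping.single i 1) 1) 1"

definition poly_at_ones :: "ratpoly \<Rightarrow> rat" where
  "poly_at_ones p = (\<Sum>m \<in> Poly_Mapping.keys p. Poly_Mapping.lookup p m)"

text \<open>A Laurent polynomial is a fraction whose denominator \<open>q\<close> is a monomial; then \<open>q\<close> has the value \<open>1\<close>.\<close>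

definition value_at_ones :: "ratfun \<Rightarrow> rat \<Rightarrow> bool" where
  "value_at_ones z u \<longleftrightarrow>
     (\<exists>p q. z = Fraction_Field.Fract p q \<and> poly_at_ones q \<noteq> 0 \<and>
        u = poly_at_ones p / poly_at_ones q)"

definition mutate_matrix :: "nat \<Rightarrow> (nat \<Rightarrow> nat \<Rightarrow> int) \<Rightarrow> nat \<Rightarrow> nat \<Rightarrow> int" where
  "mutate_matrix k B i j =
     (if i = k \<or> j = k then - B i j
      else B i j + sgn (B i k) * max 0 (B i k * B k j))"

text \<open>The truncation in \<open>nat\<close> gives the positive parts of \<open>B i k\<close> and \<open>- B i k\<close>.\<close>

definition mutate_cluster ::
    "nat \<Rightarrow> nat \<Rightarrow> (nat \<Rightarrow> nat \<Rightarrow> int) \<Rightarrow> (nat \<Rightarrow> ratfun) \<Rightarrow> nat \<Rightarrow> ratfun" where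
  "mutate_cluster n k B x =
     x(k := ((\<Prod>i<n. x i ^ nat (B i k)) + (\<Prod>i<n. x i ^ nat (- B i k))) / x k)"

text \<open>
  The seeds of the coefficient-free cluster algebra with initial seed given by \<open>TT\<close>, together with
  the tagged triangulations corresponding to them: the initial cluster consists of indeterminates
  labelled by the arcs of \<open>TT\<close>, the initial exchange matrix is the signed adjacency matrix of \<open>TT\<close>, and
  the mutation of a seed in direction \<open>k\<close> corresponds to the flip of the arc \<open>l k\<close>, that is to its
  replacement by the other tagged arc completing the remaining ones to a tagged triangulation.
  The cluster algebra is of type \<open>D\<^sub>N\<close>.
\<close>

inductive tagged_seed ::
    "nat \<Rightarrow> tarc set \<Rightarrow> (nat \<Rightarrow> tarc) \<Rightarrow> (nat \<Rightarrow> nat \<Rightarrow> int) \<Rightarrow> (nat \<Rightarrow> ratfun) \<Rightarrow> bool"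
  for N :: nat and TT :: "tarc set" where
  initial: "bij_betw l {..<N} TT \<Longrightarrow>
     tagged_seed N TT l (\<lambda>i j. signed_adj_tagged N TT (l i) (l j)) indet"
| flip: "tagged_seed N TT l B x \<Longrightarrow> k < N \<Longrightarrow> \<gamma> \<noteq> l k \<Longrightarrow>
     tagged_triangulation N ((l(k := \<gamma>)) ` {..<N}) \<Longrightarrow>
     tagged_seed N TT (l(k := \<gamma>)) (mutate_matrix k B) (mutate_cluster N k B x)"

definition cluster_variable :: "nat \<Rightarrow> tarc set \<Rightarrow> tarc \<Rightarrow> ratfun \<Rightarrow> bool" where
  "cluster_variable N TT \<gamma> z \<longleftrightarrow> (\<exists>l B x k. tagged_seed N TT l B x \<and> k < N \<and> l k = \<gamma> \<and> z = x k)"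

text \<open>For a fixed numbering of the arcs of \<open>TT\<close>, the cluster variable of an arc does not depend on the
  sequence of flips; renumbering permutes the indeterminates, which does not change the value
  at ones.\<close>

definition F_cluster :: "nat \<Rightarrow> tarc set \<Rightarrow> arc \<Rightarrow> rat" where
  "F_cluster N TT D = (THE u. \<exists>z. cluster_variable N TT (tag D) z \<and> value_at_ones z u)"

end

theory Submission
  imports Defs
begin

text \<open>
  The lambda lengths of the punctured disc are explicit: a positive \<open>N\<close>-periodic sequence \<open>c\<close> (the plain
  central arcs) determines \<open>t\<close> by \<open>t (x + 1) - t x = 1 / (c x * c (x + 1))\<close>, the arc from \<open>a\<close> to \<open>b\<close> in the
  universal cover has length \<open>c a * c b * (t b - t a)\<close>, and notching a central arc multiplies its length
  by \<open>S = t (x + N) - t x\<close>. These numbers satisfy all exchange relations, and flips of tagged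
  triangulations induce matrix mutations of the signed adjacency matrices; so, if the lambda lengths
  of the arcs of \<open>TT\<close> are \<open>1\<close>, they are the values at ones of all cluster variables. Every arc occurs,
  because flipping the longest arc to a central arc connects every triangulation to the one
  consisting of all central arcs.

  The lifted triangles of a slice are the translates of a polygon that grows from a boundary
  segment by one outer triangle at a time, and of one or two triangles at the puncture. Splitting
  matchings according to the use of the outer triangle, one finds that the matching numbers of a
  slice satisfy the same recursion as the lambda lengths.
\<close>

subsection \<open>Lifts of arcs\<close>

text \<open>Cluster variables are never computed, nor shown to be Laurent polynomials:
  \<open>F_cluster\<close> asks for a value only, and an invariant of seeds shows that every
  fraction arising for an arc has the same value at ones. The obstacle on the cluster side is the
  tags. Changing all tags at the puncture is an involution. On lambda lengths it replaces
  \<open>c\<close>, \<open>t\<close>, \<open>S\<close> by \<open>S * c\<close>,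
  \<open>t / S\<^sup>2\<close>, \<open>1 / S\<close>, and it fixes the tagged set of a triangulation
  with a loop. So each tagged flip is a flip of plain triangulations up to this involution,
  triangulations with a loop join the two taggings, and a slice with two notched arcs reduces to one
  with two plain arcs. On the matching side the point is the number \<open>S\<close>. A triangle at
  the puncture with all sides of length 1 raises \<open>t\<close> by 1, so \<open>S\<close> is the
  number of such triangles of the slice: 1 if there is a loop and 2 otherwise. Matchings that
  include the puncture produce exactly this factor. With a loop it is essential that a matching
  records the corner it uses, since the two ends of the polygon are glued to one point.\<close>

lemma nrm_range: "N > 0 \<Longrightarrow> 1 \<le> nrm N a \<and> nrm N a \<le> int N"
  by (simp add: nrm_def) (smt (verit) of_nat_0_less_iff pos_mod_bound)

lemma nrm_id: "1 \<le> a \<Longrightarrow> a \<le> int N \<Longrightarrow> nrm N a = a"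
  by (simp add: nrm_def)

lemma nrm_shift [simp]: "nrm N (a + t * int N) = nrm N a"
  by (simp add: nrm_def) (smt (verit) mod_mult_self1)

lemma nrm_eq_iff: "nrm N a = nrm N b \<longleftrightarrow> (\<exists>t. b = a + t * int N)"
proof -
  have "nrm N a = nrm N b \<longleftrightarrow> (b - 1) mod int N = (a - 1) mod int N" by (auto simp: nrm_def)
  also have "\<dots> \<longleftrightarrow> int N dvd b - a" by (simp add: mod_eq_dvd_iff)
  also have "\<dots> \<longleftrightarrow> (\<exists>t. b = a + t * int N)" by (auto simp: dvd_def algebra_simps)
  finally show ?thesis .
qed

lemma nrm_obtain:
  obtains t where "nrm N a = a + t * int N"
proof -
  have "nrm N a = a + (- ((a - 1) div int N)) * int N"
    unfolding nrm_def by (simp add: minus_div_mult_eq_mod[symmetric])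
  then show thesis by (rule that)
qed

lemma nrm_nrm [simp]: "nrm N (nrm N a) = nrm N a"
  by (metis nrm_obtain nrm_shift)

lemma blen_range: "N > 0 \<Longrightarrow> 1 \<le> blen N i j \<and> blen N i j \<le> int N"
  by (simp add: blen_def) (smt (verit) of_nat_0_less_iff pos_mod_bound)

lemma blen_shift: "blen N (a + s * int N) (b + t * int N) = blen N a b"
proof -
  have "b + t * int N - (a + s * int N) - 1 = (b - a - 1) + (t - s) * int N" by algebra
  then show ?thesis unfolding blen_def by (simp only: mod_mult_self1)
qed

lemma blen_nrm [simp]: "blen N (nrm N a) (nrm N b) = blen N a b"
  by (metis nrm_obtain blen_shift)

lemma blen_lift: "a < b \<Longrightarrow> b \<le> a + int N \<Longrightarrow> blen N a b = b - a"
  by (simp add: blen_def)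

lemma nrm_blen [simp]: "nrm N (i + blen N i j) = nrm N j"
proof -
  have "j = (i + blen N i j) + ((j - i - 1) div int N) * int N"
    unfolding blen_def by (simp add: minus_div_mult_eq_mod[symmetric])
  then show ?thesis by (metis nrm_shift)
qed

text \<open>From here on an arc is named by the ends of one of its lifts. The loop at
  \<open>a\<close> becomes \<open>parc N a (a + int N)\<close>, and boundary segments appear as
  \<open>parc N a (a + 1)\<close> although they are not plain arcs.\<close>

abbreviation parc :: "nat \<Rightarrow> int \<Rightarrow> int \<Rightarrow> arc" where
  "parc N a b \<equiv> Periph (nrm N a) (nrm N b)"

abbreviation spoke :: "nat \<Rightarrow> int \<Rightarrow> arc" where
  "spoke N a \<equiv> Central (nrm N a)"

text \<open>The residues of the ends determine \<open>b - a\<close> through \<open>blen\<close> as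
  long as it lies between 1 and \<open>N\<close>; so a lift in this range is unique up to a deck
  transformation.\<close>

lemma parc_eqE:
  assumes "parc N a b = parc N c d" "a < b" "b \<le> a + int N" "c < d" "d \<le> c + int N"
  obtains t where "c = a + t * int N" "d = b + t * int N"
proof -
  have "blen N a b = blen N c d" using assms(1) by (metis blen_nrm arc.inject(1))
  then have "d - c = b - a" using assms blen_lift by simp
  moreover obtain t where "c = a + t * int N" using assms(1) by (auto simp: nrm_eq_iff)
  ultimately show thesis using that[of t] by simp
qed

text \<open>Brings the condition on plain arcs that excludes boundary segments into lifted
  coordinates.\<close>

lemma nrm_suc_iff:
  assumes "N \<ge> 3" "a < b" "b \<le> a + int N"
  shows "nrm N b = nrm N (nrm N a + 1) \<longleftrightarrow> b = a + 1"
proof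
  obtain t where t: "nrm N a = a + t * int N" using nrm_obtain .
  assume "nrm N b = nrm N (nrm N a + 1)"
  then have "nrm N b = nrm N (a + 1)" unfolding t by (metis add.commute add.left_commute nrm_shift)
  then obtain s where s: "a + 1 = b + s * int N" by (auto simp: nrm_eq_iff)
  have "- int N < s * int N" "s * int N \<le> 0" using s assms by auto
  then have "s = 0"
    using assms(1) by (smt (verit) mult_le_cancel_right1 mult_minus_left mult_nonneg_nonneg mult_right_mono of_nat_0_le_iff zero_le_mult_iff)
  then show "b = a + 1" using s by simp
next
  obtain t where t: "nrm N a = a + t * int N" using nrm_obtain .
  assume "b = a + 1"
  then show "nrm N b = nrm N (nrm N a + 1)" unfolding t by (metis add.commute add.left_commute nrm_shift)
qed

lemma parc_plain:
  assumes "N \<ge> 3" "a + 2 \<le> b" "b \<le> a + int N"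
  shows "parc N a b \<in> plain_arcs N"
  using assms nrm_range[of N] nrm_suc_iff[of N a b] unfolding plain_arcs_def by auto

lemma spoke_plain: "N \<ge> 3 \<Longrightarrow> spoke N a \<in> plain_arcs N"
  using nrm_range[of N] unfolding plain_arcs_def by auto

lemma plain_arc_cases:
  assumes "N \<ge> 3" "D \<in> plain_arcs N"
  obtains a b where "D = parc N a b" "1 \<le> a" "a \<le> int N" "a + 2 \<le> b" "b \<le> a + int N"
  | a where "D = spoke N a" "1 \<le> a" "a \<le> int N"
proof -
  from assms(2) consider i j where "D = Periph i j" "1 \<le> i" "i \<le> int N" "1 \<le> j" "j \<le> int N" "j \<noteq> nrm N (i + 1)"
    | i where "D = Central i" "1 \<le> i" "i \<le> int N" unfolding plain_arcs_def by auto
  then show thesis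
  proof cases
    case 1
    have D: "D = parc N i (i + blen N i j)" using 1 by (simp add: nrm_id)
    have "blen N i j \<noteq> 1"
    proof
      assume "blen N i j = 1"
      then have "nrm N (i + 1) = j" using nrm_blen[of N i j] 1 by (simp add: nrm_id)
      then show False using 1 by simp
    qed
    then show thesis using that(1)[OF D] 1 blen_range[of N i j] assms(1) by force
  next
    case 2
    then show thesis using that(2)[of i] by (simp add: nrm_id)
  qed
qed

section \<open>Crossings in lifted coordinates\<close>

lemma crosses_parc:
  assumes "a < b" "b \<le> a + int N" "c < d" "d \<le> c + int N"
  shows "crosses N (parc N a b) (parc N c d) \<longleftrightarrow>
    (\<exists>t::int. let c' = c + t * int N; d' = d + t * int N
       in (a < c' \<and> c' < b \<and> b < d') \<or> (c' < a \<and> a < d' \<and> d' < b))"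
proof -
  obtain u where u: "nrm N a = a + u * int N" using nrm_obtain .
  obtain v where v: "nrm N c = c + v * int N" using nrm_obtain .
  have bl: "blen N (nrm N a) (nrm N b) = b - a" "blen N (nrm N c) (nrm N d) = d - c"
    using assms blen_lift by auto
  have "crosses N (parc N a b) (parc N c d) \<longleftrightarrow> (\<exists>t::int. let c' = c + (t + v - u) * int N; d' = d + (t + v - u) * int N
       in (a < c' \<and> c' < b \<and> b < d') \<or> (c' < a \<and> a < d' \<and> d' < b))"
    unfolding crosses.simps bl unfolding u v by (simp add: Let_def algebra_simps)
  \<comment> \<open>The translations made when normalising the two starting points are absorbed into
    \<open>t\<close>.\<close>
  also have "\<dots> \<longleftrightarrow> (\<exists>t::int. let c' = c + t * int N; d' = d + t * int N
       in (a < c' \<and> c' < b \<and> b < d') \<or> (c' < a \<and> a < d' \<and> d' < b))" (is "(\<exists>t. ?P (t + v - u)) \<longleftrightarrow> _")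
  proof
    assume "\<exists>t. ?P t"
    then obtain t where "?P t" by blast
    then have "?P ((t - v + u) + v - u)" by simp
    then show "\<exists>t. ?P (t + v - u)" by blast
  qed blast
  finally show ?thesis .
qed

lemma crosses_spoke_aux:
  assumes "a < b" "b \<le> a + int N"
  shows "(\<exists>t::int. nrm N a < nrm N x + t * int N \<and> nrm N x + t * int N < nrm N a + blen N (nrm N a) (nrm N b))
     \<longleftrightarrow> (\<exists>t::int. a < x + t * int N \<and> x + t * int N < b)"
proof -
  obtain u where u: "nrm N a = a + u * int N" using nrm_obtain .
  obtain v where v: "nrm N x = x + v * int N" using nrm_obtain .
  have bl: "blen N (nrm N a) (nrm N b) = b - a" using assms blen_lift by auto
  have "(\<exists>t::int. nrm N a < nrm N x + t * int N \<and> nrm N x + t * int N < nrm N a + blen N (nrm N a) (nrm N b))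
     \<longleftrightarrow> (\<exists>t::int. a < x + (t + v - u) * int N \<and> x + (t + v - u) * int N < b)" (is "_ \<longleftrightarrow> (\<exists>t. ?P (t + v - u))")
    unfolding bl unfolding u v by (simp add: algebra_simps)
  also have "\<dots> \<longleftrightarrow> (\<exists>t. ?P t)"
  proof
    assume "\<exists>t. ?P t"
    then obtain t where "?P t" by blast
    then have "?P ((t - v + u) + v - u)" by simp
    then show "\<exists>t. ?P (t + v - u)" by blast
  qed blast
  finally show ?thesis .
qed

lemma crosses_spoke:
  assumes "a < b" "b \<le> a + int N"
  shows "crosses N (parc N a b) (spoke N x) \<longleftrightarrow> (\<exists>t::int. a < x + t * int N \<and> x + t * int N < b)"
    and "crosses N (spoke N x) (parc N a b) \<longleftrightarrow> (\<exists>t::int. a < x + t * int N \<and> x + t * int N < b)"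
  using crosses_spoke_aux[OF assms] by simp_all

text \<open>The definition translates only the second arc, so exchanging the roles replaces
  \<open>t\<close> by \<open>-t\<close>.\<close>

lemma crosses_sym:
  assumes "N \<ge> 3" "D \<in> plain_arcs N" "E \<in> plain_arcs N" "crosses N D E"
  shows "crosses N E D"
proof (rule plain_arc_cases[OF assms(1,2)])
  fix a b assume D: "D = parc N a b" "a + 2 \<le> b" "b \<le> a + int N"
  show ?thesis
  proof (rule plain_arc_cases[OF assms(1,3)])
    fix c d assume E: "E = parc N c d" "c + 2 \<le> d" "d \<le> c + int N"
    from assms(4) obtain t where "let c' = c + t * int N; d' = d + t * int N
       in (a < c' \<and> c' < b \<and> b < d') \<or> (c' < a \<and> a < d' \<and> d' < b)"
      using D E by (auto simp: crosses_parc simp del: crosses.simps)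
    then have "let a' = a + (-t) * int N; b' = b + (-t) * int N
       in (c < a' \<and> a' < d \<and> d < b') \<or> (a' < c \<and> c < b' \<and> b' < d)"
      by (auto simp: Let_def)
    then show ?thesis using D E by (simp add: crosses_parc del: crosses.simps) (rule exI[of _ "-t"], simp)
  qed (use assms D in \<open>auto simp: crosses_spoke simp del: crosses.simps\<close>)
next
  fix x assume D: "D = spoke N x"
  show ?thesis
    by (rule plain_arc_cases[OF assms(1,3)]) (use assms D in \<open>auto simp: crosses_spoke simp del: crosses.simps(1-3)\<close>)
qed

text \<open>Products \<open>t * int N\<close> are opaque to linear arithmetic. Each case supplies
  the linear bound that decides whether a translate can still meet a window of width
  \<open>N\<close>.\<close>

lemma shift_cases:
  obtains "t = 0" "t * int N = 0" | "t \<ge> 1" "t * int N \<ge> int N" | "t \<le> -1" "t * int N \<le> - int N"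
proof -
  consider "t = 0" | "t \<ge> 1" | "t \<le> -1" by linarith
  then show thesis
  proof cases
    case 2
    then show ?thesis using that(2) mult_right_mono[of 1 t "int N"] by simp
  next
    case 3
    then show ?thesis using that(3) mult_right_mono[of t "-1" "int N"] by simp
  qed (use that(1) in simp)
qed

lemma crosses_irrefl:
  assumes "N \<ge> 3" "D \<in> plain_arcs N"
  shows "\<not> crosses N D D"
proof (rule plain_arc_cases[OF assms(1,2)])
  fix a b assume D: "D = parc N a b" "a + 2 \<le> b" "b \<le> a + int N"
  show ?thesis
  proof
    assume "crosses N D D"
    then obtain t where t: "let c' = a + t * int N; d' = b + t * int N
       in (a < c' \<and> c' < b \<and> b < d') \<or> (c' < a \<and> a < d' \<and> d' < b)"
      using D by (auto simp: crosses_parc simp del: crosses.simps)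
    show False using t D unfolding Let_def by (cases rule: shift_cases[of t N]) linarith+
  qed
qed simp

text \<open>An arc crossing nothing in \<open>T\<close> can be added to \<open>T\<close>, because
  crossing is symmetric and no arc crosses itself. So maximality among sets reduces to maximality
  against single arcs.\<close>

lemma triangulation_alt:
  assumes "N \<ge> 3"
  shows "triangulation N T \<longleftrightarrow> T \<subseteq> plain_arcs N \<and> (\<forall>D\<in>T. \<forall>E\<in>T. \<not> crosses N D E) \<and>
    (\<forall>D\<in>plain_arcs N. (\<forall>E\<in>T. \<not> crosses N D E) \<longrightarrow> D \<in> T)" (is "?L \<longleftrightarrow> ?R")
proof
  assume L: ?L
  then have T: "T \<subseteq> plain_arcs N" "\<forall>D\<in>T. \<forall>E\<in>T. \<not> crosses N D E"
    by (auto simp: triangulation_def noncrossing_def)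
  have "D \<in> T" if D: "D \<in> plain_arcs N" "\<forall>E\<in>T. \<not> crosses N D E" for D
  proof -
    have "noncrossing N (insert D T)" unfolding noncrossing_def
      using T D crosses_irrefl[OF assms] crosses_sym[OF assms] by blast
    then have "insert D T = T" using L unfolding triangulation_def by blast
    then show ?thesis by blast
  qed
  then show ?R using T by blast
next
  assume R: ?R
  then show ?L unfolding triangulation_def noncrossing_def by blast
qed

section \<open>Triangulations described by their lifts\<close>

definition plift :: "nat \<Rightarrow> arc set \<Rightarrow> int \<Rightarrow> int \<Rightarrow> bool" where
  "plift N T a b \<longleftrightarrow> a + 2 \<le> b \<and> b \<le> a + int N \<and> parc N a b \<in> T"

lemma lifted_side_plift: "lifted_side N T a b \<longleftrightarrow> b = a + 1 \<or> plift N T a b"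
  by (simp add: lifted_side_def plift_def)

lemma plift_shift [simp]: "plift N T (a + t * int N) (b + t * int N) \<longleftrightarrow> plift N T a b"
  by (simp add: plift_def)

lemma lifted_spoke_shift [simp]: "lifted_spoke N T (a + t * int N) \<longleftrightarrow> lifted_spoke N T a"
  by (simp add: lifted_spoke_def)

text \<open>The set of lifts is invariant under deck transformations, so quantifying over all lifts
  absorbs the translation in \<open>crosses\<close>. For two arcs of \<open>T\<close> one
  interlacing pattern suffices, since they may be exchanged; a candidate \<open>(a, b)\<close> for
  maximality needs both.\<close>

lemma triangulation_iff:
  assumes "N \<ge> 3"
  shows "triangulation N T \<longleftrightarrow> T \<subseteq> plain_arcs N \<and>
    (\<forall>a b c d. plift N T a b \<longrightarrow> plift N T c d \<longrightarrow> \<not> (a < c \<and> c < b \<and> b < d)) \<and>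
    (\<forall>a b x. plift N T a b \<longrightarrow> lifted_spoke N T x \<longrightarrow> \<not> (a < x \<and> x < b)) \<and>
    (\<forall>a b. a + 2 \<le> b \<longrightarrow> b \<le> a + int N \<longrightarrow>
       (\<forall>c d. plift N T c d \<longrightarrow> \<not> (a < c \<and> c < b \<and> b < d) \<and> \<not> (c < a \<and> a < d \<and> d < b)) \<longrightarrow>
       (\<forall>x. lifted_spoke N T x \<longrightarrow> \<not> (a < x \<and> x < b)) \<longrightarrow> plift N T a b) \<and>
    (\<forall>x. (\<forall>a b. plift N T a b \<longrightarrow> \<not> (a < x \<and> x < b)) \<longrightarrow> lifted_spoke N T x)"
    (is "_ \<longleftrightarrow> ?T \<and> ?pp \<and> ?ps \<and> ?mp \<and> ?ms")
proof -
  have A: "(\<forall>D\<in>T. \<forall>E\<in>T. \<not> crosses N D E) \<longleftrightarrow> ?pp \<and> ?ps" if T: ?T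
  proof
    assume nc: "\<forall>D\<in>T. \<forall>E\<in>T. \<not> crosses N D E"
    have ?pp
    proof (intro allI impI)
      fix a b c d assume "plift N T a b" "plift N T c d"
      then have "\<not> crosses N (parc N a b) (parc N c d)" "a < b" "b \<le> a + int N" "c < d" "d \<le> c + int N"
        using nc by (auto simp: plift_def simp del: crosses.simps)
      then show "\<not> (a < c \<and> c < b \<and> b < d)"
        using crosses_parc[of a b N c d] by (metis (lifting) add.right_neutral mult_zero_left)
    qed
    moreover have ?ps
    proof (intro allI impI)
      fix a b x assume "plift N T a b" "lifted_spoke N T x"
      then have "\<not> crosses N (parc N a b) (spoke N x)" "a < b" "b \<le> a + int N"
        using nc by (auto simp: plift_def lifted_spoke_def simp del: crosses.simps)
      then show "\<not> (a < x \<and> x < b)"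
        using crosses_spoke(1)[of a b N x] by (metis (lifting) add.right_neutral mult_zero_left)
    qed
    ultimately show "?pp \<and> ?ps" ..
  next
    assume R: "?pp \<and> ?ps"
    show "\<forall>D\<in>T. \<forall>E\<in>T. \<not> crosses N D E"
    proof (intro ballI)
      fix D E assume DE: "D \<in> T" "E \<in> T"
      then have P: "D \<in> plain_arcs N" "E \<in> plain_arcs N" using T by auto
      have ps: "\<not> crosses N (parc N a b) (spoke N x)" "\<not> crosses N (spoke N x) (parc N a b)"
        if "parc N a b \<in> T" "spoke N x \<in> T" "a + 2 \<le> b" "b \<le> a + int N" for a b x
      proof -
        have "plift N T a b" "\<And>t. lifted_spoke N T (x + t * int N)"
          using that by (auto simp: plift_def lifted_spoke_def)
        then have "\<And>t. \<not> (a < x + t * int N \<and> x + t * int N < b)" using R by blast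
        then show "\<not> crosses N (parc N a b) (spoke N x)" "\<not> crosses N (spoke N x) (parc N a b)"
          using crosses_spoke[of a b N x] that by auto
      qed
      show "\<not> crosses N D E"
      proof (rule plain_arc_cases[OF assms P(1)])
        fix a b assume D: "D = parc N a b" "a + 2 \<le> b" "b \<le> a + int N"
        show ?thesis
        proof (rule plain_arc_cases[OF assms P(2)])
          fix c d assume E: "E = parc N c d" "c + 2 \<le> d" "d \<le> c + int N"
          have "plift N T a b" "\<And>t. plift N T (c + t * int N) (d + t * int N)"
            using D E DE by (auto simp: plift_def)
          then have "\<And>t. \<not> (a < c + t * int N \<and> c + t * int N < b \<and> b < d + t * int N)"
             "\<And>t. \<not> (c + t * int N < a \<and> a < d + t * int N \<and> d + t * int N < b)" using R by blast+
          then show ?thesis using crosses_parc[of a b N c d] D E by (auto simp: Let_def)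
        qed (use ps D DE in auto)
      next
        fix x assume D: "D = spoke N x"
        show ?thesis
          by (rule plain_arc_cases[OF assms P(2)]) (use ps D DE in auto)
      qed
    qed
  qed
  have B: "(\<forall>D\<in>plain_arcs N. (\<forall>E\<in>T. \<not> crosses N D E) \<longrightarrow> D \<in> T) \<longleftrightarrow> ?mp \<and> ?ms" if T: ?T
  proof
    assume M: "\<forall>D\<in>plain_arcs N. (\<forall>E\<in>T. \<not> crosses N D E) \<longrightarrow> D \<in> T"
    have ?mp
    proof (intro allI impI)
      fix a b assume ab: "a + 2 \<le> b" "b \<le> a + int N"
        and 1: "\<forall>c d. plift N T c d \<longrightarrow> \<not> (a < c \<and> c < b \<and> b < d) \<and> \<not> (c < a \<and> a < d \<and> d < b)"
        and 2: "\<forall>x. lifted_spoke N T x \<longrightarrow> \<not> (a < x \<and> x < b)"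
      have "\<not> crosses N (parc N a b) E" if E: "E \<in> T" for E
      proof (rule plain_arc_cases[OF assms, of E])
        show "E \<in> plain_arcs N" using E T by auto
      next
        fix c d assume E': "E = parc N c d" "c + 2 \<le> d" "d \<le> c + int N"
        then have "\<And>t. plift N T (c + t * int N) (d + t * int N)" using E by (simp add: plift_def)
        then show ?thesis using E' ab 1 crosses_parc[of a b N c d] by (auto simp: Let_def simp del: plift_shift)
      next
        fix x assume E': "E = spoke N x"
        then have "\<And>t. lifted_spoke N T (x + t * int N)" using E by (simp add: lifted_spoke_def)
        then show ?thesis using E' ab 2 crosses_spoke(1)[of a b N x] by (auto simp del: lifted_spoke_shift)
      qed
      then show "plift N T a b" using M parc_plain[OF assms ab] ab by (simp add: plift_def)
    qed
    moreover have ?ms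
    proof (intro allI impI)
      fix x assume 1: "\<forall>a b. plift N T a b \<longrightarrow> \<not> (a < x \<and> x < b)"
      have "\<not> crosses N (spoke N x) E" if E: "E \<in> T" for E
      proof (rule plain_arc_cases[OF assms, of E])
        show "E \<in> plain_arcs N" using E T by auto
      next
        fix c d assume E': "E = parc N c d" "c + 2 \<le> d" "d \<le> c + int N"
        have "\<not> (c < x + t * int N \<and> x + t * int N < d)" for t
        proof -
          have "plift N T (c + (-t) * int N) (d + (-t) * int N)" using E E' by (simp add: plift_def del: mult_minus_left)
          then show ?thesis using 1 by force
        qed
        then show ?thesis using E' crosses_spoke(2)[of c d N x] by auto
      qed simp
      then show "lifted_spoke N T x" using M spoke_plain[OF assms] by (auto simp add: lifted_spoke_def)
    qed
    ultimately show "?mp \<and> ?ms" ..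
  next
    assume R: "?mp \<and> ?ms"
    show "\<forall>D\<in>plain_arcs N. (\<forall>E\<in>T. \<not> crosses N D E) \<longrightarrow> D \<in> T"
    proof (intro ballI impI)
      fix D assume D: "D \<in> plain_arcs N" "\<forall>E\<in>T. \<not> crosses N D E"
      show "D \<in> T"
      proof (rule plain_arc_cases[OF assms D(1)])
        fix a b assume ab: "D = parc N a b" "a + 2 \<le> b" "b \<le> a + int N"
        have "plift N T c d \<longrightarrow> \<not> (a < c \<and> c < b \<and> b < d) \<and> \<not> (c < a \<and> a < d \<and> d < b)" for c d
        proof
          assume "plift N T c d"
          then have "parc N c d \<in> T" "c < d" "d \<le> c + int N" by (auto simp: plift_def)
          then have "\<not> crosses N (parc N a b) (parc N c d)" using D ab by auto
          then show "\<not> (a < c \<and> c < b \<and> b < d) \<and> \<not> (c < a \<and> a < d \<and> d < b)"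
            using crosses_parc[of a b N c d] ab \<open>c < d\<close> \<open>d \<le> c + int N\<close>
            by (simp add: Let_def del: crosses.simps) (metis add.right_neutral mult_zero_left)
        qed
        moreover have "lifted_spoke N T x \<longrightarrow> \<not> (a < x \<and> x < b)" for x
        proof
          assume "lifted_spoke N T x"
          then have "\<not> crosses N (parc N a b) (spoke N x)" using D ab by (auto simp: lifted_spoke_def)
          then show "\<not> (a < x \<and> x < b)"
            using crosses_spoke(1)[of a b N x] ab
            by (simp del: crosses.simps) (metis add.right_neutral mult_zero_left)
        qed
        ultimately have "plift N T a b" using R ab by blast
        then show ?thesis using ab by (simp add: plift_def)
      next
        fix x assume x: "D = spoke N x"
        have "plift N T a b \<longrightarrow> \<not> (a < x \<and> x < b)" for a b
        proof
          assume "plift N T a b"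
          then have p: "parc N a b \<in> T" "a < b" "b \<le> a + int N" by (auto simp: plift_def)
          then have "\<not> crosses N (spoke N x) (parc N a b)" using D x by auto
          then show "\<not> (a < x \<and> x < b)"
            using crosses_spoke(2)[of a b N x] p
            by (simp del: crosses.simps) (metis add.right_neutral mult_zero_left)
        qed
        then have "lifted_spoke N T x" using R by blast
        then show ?thesis using x by (simp add: lifted_spoke_def)
      qed
    qed
  qed
  show ?thesis
  proof (cases ?T)
    case True
    show ?thesis unfolding triangulation_alt[OF assms] A[OF True] B[OF True] by (simp only: conj_assoc)
  next
    case False
    then show ?thesis unfolding triangulation_alt[OF assms] by (simp only: simp_thms)
  qed
qed

subsection \<open>Combinatorics of triangulations\<close>

locale triang =
  fixes N :: nat and T :: "arc set"
  assumes N3: "N \<ge> 3" and tri: "triangulation N T"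
begin

abbreviation "L \<equiv> plift N T"
abbreviation "C \<equiv> lifted_spoke N T"
abbreviation "side \<equiv> lifted_side N T"

lemmas tri_lift = iffD1[OF triangulation_iff[OF N3] tri]

lemma T_plain: "T \<subseteq> plain_arcs N"
  by (rule tri_lift[THEN conjunct1])

lemma L_len: "L a b \<Longrightarrow> a + 2 \<le> b \<and> b \<le> a + int N"
  by (simp add: plift_def)

lemma L_nc: "L a b \<Longrightarrow> L c d \<Longrightarrow> a < c \<Longrightarrow> c < b \<Longrightarrow> d \<le> b"
  using tri_lift[THEN conjunct2, THEN conjunct1, rule_format, of a b c d] by linarith

lemma L_C: "L a b \<Longrightarrow> C x \<Longrightarrow> a < x \<Longrightarrow> x < b \<Longrightarrow> False"
  using tri_lift[THEN conjunct2, THEN conjunct2, THEN conjunct1, rule_format, of a b x] by blast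

lemma L_I:
  assumes "a + 2 \<le> b" "b \<le> a + int N"
    "\<And>c d. L c d \<Longrightarrow> a < c \<Longrightarrow> c < b \<Longrightarrow> b < d \<Longrightarrow> False"
    "\<And>c d. L c d \<Longrightarrow> c < a \<Longrightarrow> a < d \<Longrightarrow> d < b \<Longrightarrow> False"
    "\<And>x. C x \<Longrightarrow> a < x \<Longrightarrow> x < b \<Longrightarrow> False"
  shows "L a b"
  by (rule tri_lift[THEN conjunct2, THEN conjunct2, THEN conjunct2, THEN conjunct1, rule_format])
     (use assms in blast)+

lemma C_I: "(\<And>a b. L a b \<Longrightarrow> a < x \<Longrightarrow> x < b \<Longrightarrow> False) \<Longrightarrow> C x"
  by (rule tri_lift[THEN conjunct2, THEN conjunct2, THEN conjunct2, THEN conjunct2, rule_format]) blast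

lemma side_I:
  assumes "a < b" "b \<le> a + int N"
    "\<And>c d. L c d \<Longrightarrow> a < c \<Longrightarrow> c < b \<Longrightarrow> b < d \<Longrightarrow> False"
    "\<And>c d. L c d \<Longrightarrow> c < a \<Longrightarrow> a < d \<Longrightarrow> d < b \<Longrightarrow> False"
    "\<And>x. C x \<Longrightarrow> a < x \<Longrightarrow> x < b \<Longrightarrow> False"
  shows "side a b"
proof (cases "b = a + 1")
  case False
  then have "L a b" using assms by (intro L_I) auto
  then show ?thesis by (simp add: lifted_side_plift)
qed (simp add: lifted_side_plift)

lemma side_len: "side a b \<Longrightarrow> a < b \<and> b \<le> a + int N"
  using L_len[of a b] N3 by (auto simp: lifted_side_plift)

lemma side_nc: "side a b \<Longrightarrow> side c d \<Longrightarrow> a < c \<Longrightarrow> c < b \<Longrightarrow> d \<le> b"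
  using L_nc by (auto simp: lifted_side_plift)

lemma side_C: "side a b \<Longrightarrow> C x \<Longrightarrow> a < x \<Longrightarrow> x < b \<Longrightarrow> False"
  using L_C by (auto simp: lifted_side_plift)

lemma side_L: "side a b \<Longrightarrow> a + 1 < b \<Longrightarrow> L a b"
  by (simp add: lifted_side_plift)

lemma L_side: "L a b \<Longrightarrow> side a b"
  by (simp add: lifted_side_plift)

text \<open>The apex is the farthest \<open>b\<close> below \<open>(a, c)\<close> for which
  \<open>(a, b)\<close> is a side. Whatever blocks \<open>(b, c)\<close> crosses
  \<open>(a, c)\<close> or \<open>(a, b)\<close>, or is a diagonal from \<open>a\<close> that
  reaches beyond \<open>b\<close>.\<close>

lemma inner_triangle:
  assumes "L a c"
  obtains b where "a < b" "b < c" "side a b" "side b c"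
proof -
  let ?S = "{b. a < b \<and> b < c \<and> side a b}"
  have fin: "finite ?S" by (rule finite_subset[of _ "{a..c}"]) auto
  have "a + 1 \<in> ?S" using L_len[OF assms] by (auto simp: lifted_side_plift)
  then have ne: "?S \<noteq> {}" by blast
  define b where "b = Max ?S"
  have b: "a < b" "b < c" "side a b" using Max_in[OF fin ne] by (auto simp: b_def)
  have mx: "y \<le> b" if "a < y" "y < c" "side a y" for y using that fin by (auto simp: b_def)
  have "side b c"
  proof (rule side_I)
    show "c \<le> b + int N" using L_len[OF assms] b by simp
  next
    fix x y assume "L x y" "b < x" "x < c" "c < y"
    then show False using L_nc[OF assms, of x y] b by simp
  next
    fix x y assume xy: "L x y" "x < b" "b < y" "y < c"
    have "x \<ge> a" using L_nc[OF xy(1) assms] xy b by force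
    moreover have "\<not> a < x" using side_nc[OF b(3) L_side[OF xy(1)]] xy b by force
    ultimately have "side a y" using xy L_side by (metis order_le_less)
    then show False using mx[of y] xy b by simp
  next
    fix x assume "C x" "b < x" "x < c"
    then show False using L_C[OF assms] b by force
  qed (use b in simp)
  then show thesis using that b by blast
qed

text \<open>To avoid crossing the loop, a diagonal over \<open>a\<close> would have to reach
  \<open>a + int N\<close>, and would be longer than \<open>N\<close>.\<close>

lemma loop_C: assumes "L a (a + int N)" shows "C a"
proof (rule C_I)
  fix x y assume "L x y" "x < a" "a < y"
  then show False using L_nc[of x y, OF _ assms] L_len[of x y] by force
qed

text \<open>Every residue class except that of \<open>a\<close> has a representative strictly
  between the ends of the loop, where no central arc can end.\<close>

lemma loop_C_only:
  assumes "L a (a + int N)" "C x" shows "nrm N x = nrm N a"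
proof -
  define y where "y = a + (x - a) mod int N"
  have y: "y = x + (- ((x - a) div int N)) * int N" unfolding y_def by (simp add: minus_div_mult_eq_mod[symmetric])
  have "C y" unfolding y using assms(2) by (simp only: lifted_spoke_shift)
  have "a \<le> y" "y < a + int N" using N3 by (auto simp: y_def)
  then have "y = a" using L_C[OF assms(1) \<open>C y\<close>] by force
  then show ?thesis using y nrm_shift by metis
qed

text \<open>A diagonal passing over one end of \<open>(a, c)\<close> without crossing it covers all
  of it. So both ends of an outermost diagonal see the puncture.\<close>

lemma no_arc_above_C:
  assumes "L a c" "\<And>x y. L x y \<Longrightarrow> x \<le> a \<Longrightarrow> c \<le> y \<Longrightarrow> x = a \<and> y = c"
  shows "C a \<and> C c"
proof
  show "C a"
  proof (rule C_I)
    fix x y assume xy: "L x y" "x < a" "a < y"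
    then have "c \<le> y" using L_nc[OF xy(1) assms(1)] by blast
    then show False using assms(2)[OF xy(1)] xy by simp
  qed
  show "C c"
  proof (rule C_I)
    fix x y assume xy: "L x y" "x < c" "c < y"
    then have "x \<le> a" using L_nc[OF assms(1) xy(1)] by force
    then show False using assms(2)[OF xy(1)] xy by simp
  qed
qed

lemma ex_longest:
  assumes "L u v"
  obtains a c where "L a c" "\<And>x y. L x y \<Longrightarrow> y - x \<le> c - a"
proof -
  let ?P = "\<lambda>n. \<exists>a c. L a c \<and> n = nat (c - a)"
  have "?P (nat (v - u))" using assms by blast
  moreover have "\<And>n. ?P n \<Longrightarrow> n \<le> N" using L_len by fastforce
  ultimately have "?P (Greatest ?P)" "\<And>n. ?P n \<Longrightarrow> n \<le> Greatest ?P"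
    using GreatestI_nat[of ?P _ N] Greatest_le_nat[of ?P _ N] by blast+
  then obtain a c where ac: "L a c" "Greatest ?P = nat (c - a)" by blast
  have "y - x \<le> c - a" if "L x y" for x y
  proof -
    have "nat (y - x) \<le> nat (c - a)" using \<open>\<And>n. ?P n \<Longrightarrow> n \<le> Greatest ?P\<close> that ac by metis
    then show ?thesis using L_len[OF ac(1)] by arith
  qed
  then show thesis using that ac(1) by blast
qed

lemma ex_C: "\<exists>x. C x"
proof (cases "\<exists>u v. L u v")
  case True
  then obtain u v where "L u v" by blast
  then obtain a c where ac: "L a c" "\<And>x y. L x y \<Longrightarrow> y - x \<le> c - a" using ex_longest by blast
  then have "C a \<and> C c" by (intro no_arc_above_C) force+
  then show ?thesis by blast
next
  case False
  then show ?thesis using C_I by blast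
qed

text \<open>The first central arc to the right of \<open>a\<close> bounds, with the one at
  \<open>a\<close>, a triangle at the puncture: a diagonal blocking its third side would pass over
  one of the two ends.\<close>

lemma next_C:
  assumes "C a"
  obtains b where "a < b" "b \<le> a + int N" "C b" "side a b"
proof -
  let ?S = "{b. a < b \<and> b \<le> a + int N \<and> C b}"
  have fin: "finite ?S" by (rule finite_subset[of _ "{a..a + int N}"]) auto
  have "C (a + 1 * int N)" using assms by (simp only: lifted_spoke_shift)
  then have "a + int N \<in> ?S" using N3 by simp
  then have ne: "?S \<noteq> {}" by blast
  define b where "b = Min ?S"
  have b: "a < b" "b \<le> a + int N" "C b" using Min_in[OF fin ne] by (auto simp: b_def)
  have mn: "b \<le> y" if "a < y" "y \<le> a + int N" "C y" for y using that fin by (auto simp: b_def)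
  have "side a b"
  proof (rule side_I)
    fix x assume "C x" "a < x" "x < b"
    then show False using mn[of x] b by simp
  qed (use b L_C assms in blast)+
  then show thesis using that b by blast
qed

lemma Central_T: "Central i \<in> T \<Longrightarrow> C i \<and> 1 \<le> i \<and> i \<le> int N \<and> nrm N i = i"
  using T_plain by (auto simp: lifted_spoke_def plain_arcs_def nrm_id)

lemma loop_T: "Periph i i \<in> T \<Longrightarrow> L i (i + int N) \<and> 1 \<le> i \<and> i \<le> int N \<and> nrm N i = i"
proof -
  assume i: "Periph i i \<in> T"
  then have r: "1 \<le> i" "i \<le> int N" using T_plain by (auto simp: plain_arcs_def)
  have "nrm N (i + int N) = i" using nrm_shift[of N i 1] r by (simp add: nrm_id)
  then show ?thesis using r i N3 by (simp add: plift_def nrm_id)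
qed

lemma L_loop_T: "L a (a + int N) \<Longrightarrow> Periph (nrm N a) (nrm N a) \<in> T"
  using nrm_shift[of N a 1] by (simp add: plift_def)

text \<open>The triangle at the puncture that starts at \<open>a\<close> must end at another lift of
  the only central arc, hence at \<open>a + int N\<close>.\<close>

lemma single_spoke_loop:
  assumes "C a" "\<And>x. C x \<Longrightarrow> nrm N x = nrm N a" shows "L a (a + int N)"
proof -
  obtain b where b: "a < b" "b \<le> a + int N" "C b" "side a b" using next_C[OF assms(1)] .
  then obtain t where "b = a + t * int N" using assms(2)[OF b(3)] nrm_eq_iff by metis
  then have "b = a + int N" using b by (cases rule: shift_cases[of t N]) linarith+
  then show ?thesis using b side_L N3 by simp
qed

end

section \<open>Triangles at the puncture and the two taggings\<close>

lemma finite_triangles: "finite (triangles N T)"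
proof -
  let ?X = "{1..2 * int N + 2}"
  have "triangles N T \<subseteq> (\<lambda>(a,b,c). Tri a b c) ` (?X \<times> ?X \<times> ?X) \<union> (\<lambda>(a,b). CTri a b) ` (?X \<times> ?X)"
    unfolding triangles_def lifted_triangles_def lifted_side_def
    by (auto simp: image_iff)
  then show ?thesis by (rule finite_subset) auto
qed

context triang begin

lemma d0_loop: assumes "Periph i i \<in> T" shows "d0 N T = 1"
proof -
  have L: "L i (i + int N)" "1 \<le> i" "i \<le> int N" "nrm N i = i" using loop_T[OF assms] by auto
  have "{\<Delta> \<in> triangles N T. Puncture \<in> corners \<Delta>} = {CTri i (i + int N)}"
  proof
    show "{CTri i (i + int N)} \<subseteq> {\<Delta> \<in> triangles N T. Puncture \<in> corners \<Delta>}"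
      using L loop_C[OF L(1)] L_side[OF L(1)] lifted_spoke_shift[of N T i 1] N3
      by (auto simp: triangles_def lifted_triangles_def)
  next
    show "{\<Delta> \<in> triangles N T. Puncture \<in> corners \<Delta>} \<subseteq> {CTri i (i + int N)}"
    proof
      fix \<Delta> assume "\<Delta> \<in> {\<Delta> \<in> triangles N T. Puncture \<in> corners \<Delta>}"
      then obtain a b where ab: "\<Delta> = CTri a b" "a < b" "side a b" "C a" "C b" "1 \<le> a" "a \<le> int N"
        by (auto simp: triangles_def lifted_triangles_def)
      have "nrm N a = i" "nrm N b = nrm N a" using loop_C_only[OF L(1)] ab L by auto
      then have "a = i" using ab by (simp add: nrm_id)
      moreover obtain t where "b = a + t * int N" using \<open>nrm N b = nrm N a\<close> nrm_eq_iff by metis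
      then have "b = a + int N" using ab(2) side_len[OF ab(3)] by (cases rule: shift_cases[of t N]) linarith+
      ultimately show "\<Delta> \<in> {CTri i (i + int N)}" using ab by simp
    qed
  qed
  then show ?thesis by (simp add: d0_def)
qed

lemma two_spokes:
  assumes "\<And>i. Periph i i \<notin> T"
  obtains i j where "i \<noteq> j" "Central i \<in> T" "Central j \<in> T"
proof -
  obtain a where a: "C a" using ex_C by blast
  have "\<exists>x. C x \<and> nrm N x \<noteq> nrm N a"
  proof (rule ccontr)
    assume "\<not> ?thesis"
    then have "L a (a + int N)" using single_spoke_loop[OF a] by blast
    then show False using L_loop_T assms by blast
  qed
  then show thesis using a that by (auto simp: lifted_spoke_def)
qed

lemma d0_no_loop: assumes "\<And>i. Periph i i \<notin> T" shows "d0 N T \<ge> 2"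
proof -
  obtain i j where ij: "i \<noteq> j" "Central i \<in> T" "Central j \<in> T" using two_spokes[OF assms] .
  have ex: "\<exists>b. CTri y b \<in> {\<Delta> \<in> triangles N T. Puncture \<in> corners \<Delta>}" if y: "Central y \<in> T" for y
  proof -
    have Cy: "C y" "1 \<le> y" "y \<le> int N" using Central_T[OF y] by auto
    obtain b where "y < b" "C b" "side y b" using next_C[OF Cy(1)] .
    then show ?thesis using Cy by (intro exI[of _ b]) (auto simp: triangles_def lifted_triangles_def)
  qed
  obtain b b' where "{CTri i b, CTri j b'} \<subseteq> {\<Delta> \<in> triangles N T. Puncture \<in> corners \<Delta>}"
    using ex[OF ij(2)] ex[OF ij(3)] by blast
  then have "card {CTri i b, CTri j b'} \<le> d0 N T" unfolding d0_def
    using finite_triangles[of N T] by (intro card_mono) auto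
  then show ?thesis using ij(1) by auto
qed

end

text \<open>An involution of tagged arcs in place of \<open>notch\<close>, so that the two taggings
  of a triangulation play symmetric roles.\<close>

fun swap_tag :: "tarc \<Rightarrow> tarc" where
  "swap_tag (TPeriph i j) = TPeriph i j"
| "swap_tag (TPlain i) = TNotched i"
| "swap_tag (TNotched i) = TPlain i"

lemma swap_swap [simp]: "swap_tag (swap_tag \<gamma>) = \<gamma>" by (cases \<gamma>) auto

lemma swap_image_swap [simp]: "swap_tag ` swap_tag ` X = X" by (simp add: image_image)

lemma plain_of_tag [simp]: "plain_of (tag D) = D" by (cases D) auto

lemma inj_tag: "inj tag" by (metis injI plain_of_tag)

lemma notch_no_loop:
  assumes "\<And>i. Periph i i \<notin> T" shows "notch ` T = swap_tag ` tag ` T"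
proof -
  have "notch D = swap_tag (tag D)" if "D \<in> T" for D using assms that by (cases D) auto
  then show ?thesis by (simp add: image_image)
qed

text \<open>The loop at \<open>i\<close> stands for the notched arc at \<open>i\<close>, and the
  triangulation also contains the plain one. There are no other central arcs, so these two are
  merely interchanged.\<close>

lemma (in triang) swap_loop:
  assumes "Periph i i \<in> T" shows "swap_tag ` tag ` T = tag ` T"
proof -
  have L: "L i (i + int N)" "nrm N i = i" using loop_T[OF assms] by auto
  have Ci: "Central i \<in> T" using loop_C[OF L(1)] L by (simp add: lifted_spoke_def)
  have C1: "j = i" if "Central j \<in> T" for j
    using loop_C_only[OF L(1), of j] Central_T[OF that] L by simp
  have L1: "j = i" if "Periph j j \<in> T" for j
    using loop_T[OF that] loop_C[of j] loop_C_only[OF L(1), of j] L by simp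
  have sub: "swap_tag (tag D) \<in> tag ` T" if D: "D \<in> T" for D
  proof (cases D)
    case (Central j)
    then have "swap_tag (tag D) = tag (Periph i i)" using C1 D by simp
    then show ?thesis using assms by blast
  next
    case (Periph j k)
    show ?thesis
    proof (cases "j = k")
      case True
      then have "swap_tag (tag D) = tag (Central i)" using L1 D Periph by simp
      then show ?thesis using Ci by blast
    next
      case False
      then have "swap_tag (tag D) = tag D" using Periph by simp
      then show ?thesis using D by simp
    qed
  qed
  then have "swap_tag ` tag ` T \<subseteq> tag ` T" by blast
  moreover have "swap_tag ` swap_tag ` tag ` T \<subseteq> swap_tag ` tag ` T" using calculation by (rule image_mono)
  ultimately show ?thesis by simp
qed

text \<open>With a loop both alternatives give the same tagged set; without one,
  \<open>notch\<close> agrees with \<open>tag\<close> followed by \<open>swap_tag\<close>. The case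
  distinction on \<open>d0\<close> thereby disappears.\<close>

lemma tagged_triangulation_iff:
  assumes "N \<ge> 3"
  shows "tagged_triangulation N TT \<longleftrightarrow>
    (\<exists>T. triangulation N T \<and> (TT = tag ` T \<or> TT = swap_tag ` tag ` T))"
proof -
  have "(d0 N T = 1 \<and> TT = tag ` T \<or> d0 N T \<ge> 2 \<and> (TT = tag ` T \<or> TT = notch ` T))
     \<longleftrightarrow> (TT = tag ` T \<or> TT = swap_tag ` tag ` T)" if "triangulation N T" for T
  proof -
    interpret triang N T using assms that by unfold_locales
    show ?thesis
    proof (cases "\<exists>i. Periph i i \<in> T")
      case True
      then obtain i where i: "Periph i i \<in> T" by blast
      show ?thesis by (simp add: d0_loop[OF i] swap_loop[OF i])
    next
      case False
      then have "d0 N T \<ge> 2" "notch ` T = swap_tag ` tag ` T"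
        using d0_no_loop notch_no_loop[of T] by blast+
      moreover from this have "d0 N T \<noteq> 1" by simp
      ultimately show ?thesis by simp
    qed
  qed
  then show ?thesis unfolding tagged_triangulation_def by blast
qed

subsection \<open>Flips\<close>

locale flip = t1: triang N T1 + t2: triang N T2
  for N :: nat and T1 T2 :: "arc set" +
  fixes e e' :: arc
  assumes e1: "e \<in> T1" and e2: "e' \<in> T2" and ne: "e \<noteq> e'" and rest: "T1 - {e} = T2 - {e'}"
begin

abbreviation "T0 \<equiv> T1 - {e}"

lemma e_notin: "e \<notin> T2" and e'_notin: "e' \<notin> T1"
  using e1 e2 ne rest by blast+

lemma flip_sym: "flip N T2 T1 e' e"
  using e1 e2 ne rest by unfold_locales auto

text \<open>As \<open>e\<close> is missing from the maximal \<open>T2\<close>, it crosses an arc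
  there, and \<open>e'\<close> is the only arc of \<open>T2\<close> not shared with
  \<open>T1\<close>.\<close>

lemma crosses_flip: "crosses N e e'"
proof -
  note A1 = iffD1[OF triangulation_alt[OF t1.N3] t1.tri] and A2 = iffD1[OF triangulation_alt[OF t1.N3] t2.tri]
  have "e \<in> plain_arcs N" using e1 t1.T_plain by blast
  then obtain E where "E \<in> T2" "crosses N e E" using A2 e_notin by blast
  moreover from this have "E \<notin> T1" using A1 e1 by blast
  ultimately show ?thesis using rest e1 by blast
qed

end

text \<open>In \<open>quad_flip\<close> and \<open>spoke_flip\<close> the set \<open>T\<close> is the part common to both triangulations.\<close>

definition quad_flip :: "nat \<Rightarrow> arc set \<Rightarrow> arc \<Rightarrow> arc \<Rightarrow> int \<Rightarrow> int \<Rightarrow> int \<Rightarrow> int \<Rightarrow> bool" where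
  "quad_flip N T e e' a b c d \<longleftrightarrow> a < b \<and> b < c \<and> c < d \<and> d \<le> a + int N \<and>
     e = parc N a c \<and> e' = parc N b d \<and>
     lifted_side N T a b \<and> lifted_side N T b c \<and> lifted_side N T c d \<and> lifted_side N T a d"

definition spoke_flip :: "nat \<Rightarrow> arc set \<Rightarrow> arc \<Rightarrow> arc \<Rightarrow> int \<Rightarrow> int \<Rightarrow> int \<Rightarrow> bool" where
  "spoke_flip N T e e' a b c \<longleftrightarrow> a < b \<and> b < c \<and> c \<le> a + int N \<and>
     e = parc N a c \<and> e' = spoke N b \<and>
     lifted_side N T a b \<and> lifted_side N T b c \<and> lifted_spoke N T a \<and> lifted_spoke N T c"

context flip begin

lemma side0_1:
  assumes "lifted_side N T1 x y" "e = parc N a c" "a < c" "c \<le> a + int N" "y - x \<noteq> c - a"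
  shows "lifted_side N T0 x y"
proof (cases "y = x + 1")
  case False
  then have L: "plift N T1 x y" using assms by (simp add: lifted_side_plift)
  have "parc N x y \<noteq> e"
  proof
    assume "parc N x y = e"
    then have "parc N x y = parc N a c" using assms by simp
    then show False using parc_eqE[of N x y a c] assms L[unfolded plift_def] by (smt (verit))
  qed
  then show ?thesis using L by (simp add: lifted_side_plift plift_def)
qed (simp add: lifted_side_plift)

lemma L1_cases:
  assumes "plift N T1 x y" "e = parc N a c" "a < c" "c \<le> a + int N"
  obtains "plift N T2 x y" | t where "x = a + t * int N" "y = c + t * int N"
proof (cases "parc N x y = e")
  case True
  then have "parc N a c = parc N x y" using assms by simp
  then show thesis using parc_eqE[of N a c x y] assms(1)[unfolded plift_def] assms that(2) by (smt (verit))
next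
  case False
  then show thesis using assms(1) that(1) rest unfolding plift_def by blast
qed

text \<open>A diagonal blocking a side of the quadrilateral would cross \<open>(a, c)\<close> or
  \<open>(b, d)\<close>. Both are forbidden: a diagonal of \<open>T1\<close> is a translate of
  \<open>e\<close> or belongs to \<open>T2\<close>, and the translates of \<open>e\<close> are
  excluded by their length or position.\<close>

lemma quad_flip_lift:
  assumes e: "e = parc N a c" and e': "e' = parc N b d" and ord: "a < b" "b < c" "c < d"
    and len: "c < a + int N" "d \<le> b + int N"
  shows "quad_flip N T0 e e' a b c d"
proof -
  interpret f2: flip N T2 T1 e' e by (rule flip_sym)
  have ac: "a < c" "c \<le> a + int N" and bd: "b < d" "d \<le> b + int N" using ord len by auto
  have Lac: "plift N T1 a c" using e1 e ord len by (simp add: plift_def)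
  have Lbd: "plift N T2 b d" using e2 e' ord len by (simp add: plift_def)
  have C12: "lifted_spoke N T1 x \<longleftrightarrow> lifted_spoke N T2 x" for x
    using rest e e' unfolding lifted_spoke_def by blast
  note L1 = L1_cases[OF _ e ac] and L2 = f2.L1_cases[OF _ e' bd]
  have len1: "y - x = c - a \<or> plift N T2 x y" if "plift N T1 x y" for x y
    using L1[OF that] by (smt (verit))
  have len2: "y - x = d - b \<or> plift N T1 x y" if "plift N T2 x y" for x y
    using L2[OF that] by (smt (verit))
  have bc: "lifted_side N T1 b c"
  proof (rule t1.side_I)
    fix x y assume "plift N T1 x y" "b < x" "x < c" "c < y"
    then show False using t1.L_nc[OF Lac] ord by force
  next
    fix x y assume xy: "plift N T1 x y" "x < b" "b < y" "y < c"
    have "x \<ge> a" using t1.L_nc[OF xy(1) Lac] xy ord by force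
    then show False using len1[OF xy(1)] t2.L_nc[OF _ Lbd, of x y] xy ord by force
  next
    fix x assume "lifted_spoke N T1 x" "b < x" "x < c"
    then show False using t1.L_C[OF Lac] ord by force
  qed (use ord len in auto)
  have ab: "lifted_side N T1 a b"
  proof (rule t1.side_I)
    fix x y assume xy: "plift N T1 x y" "a < x" "x < b" "b < y"
    have "y \<le> c" using t1.L_nc[OF Lac xy(1)] xy ord by force
    then show False using len1[OF xy(1)] t2.L_nc[OF _ Lbd, of x y] xy ord by force
  next
    fix x y assume xy: "plift N T1 x y" "x < a" "a < y" "y < b"
    then show False using t1.L_nc[OF xy(1) Lac] ord by force
  next
    fix x assume "lifted_spoke N T1 x" "a < x" "x < b"
    then show False using t1.L_C[OF Lac] ord by force
  qed (use ord len in auto)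
  have cd: "lifted_side N T2 c d"
  proof (rule t2.side_I)
    fix x y assume "plift N T2 x y" "c < x" "x < d" "d < y"
    then show False using t2.L_nc[OF Lbd] ord by force
  next
    fix x y assume xy: "plift N T2 x y" "x < c" "c < y" "y < d"
    have "x \<ge> b" using t2.L_nc[OF xy(1) Lbd] xy ord by force
    then show False using len2[OF xy(1)] t1.L_nc[OF Lac, of x y] xy ord by force
  next
    fix x assume "lifted_spoke N T2 x" "c < x" "x < d"
    then show False using t2.L_C[OF Lbd] ord by force
  qed (use ord len in auto)
  \<comment> \<open>The four vertices fit into one turn around the puncture. Otherwise
    \<open>a + int N\<close> lies below \<open>(b, d)\<close>, nothing in \<open>T2\<close>
    obstructs the arc from \<open>b\<close> to \<open>a + int N\<close>, and this arc, which is then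
    common to both triangulations, crosses \<open>(a, c)\<close>.\<close>
  have dN: "d \<le> a + int N"
  proof (rule ccontr)
    assume dN: "\<not> d \<le> a + int N"
    have Lac': "plift N T1 (a + 1 * int N) (c + 1 * int N)" using Lac by (simp only: plift_shift)
    have "plift N T2 b (a + int N)"
    proof (rule t2.L_I)
      fix x y assume xy: "plift N T2 x y" "b < x" "x < a + int N" "a + int N < y"
      have "y \<le> d" using t2.L_nc[OF Lbd xy(1)] xy dN by force
      then show False using len2[OF xy(1)] t1.L_nc[OF _ Lac', of x y] xy ord len by force
    next
      fix x y assume xy: "plift N T2 x y" "x < b" "b < y" "y < a + int N"
      then show False using t2.L_nc[OF xy(1) Lbd] dN by force
    next
      fix x assume "lifted_spoke N T2 x" "b < x" "x < a + int N"
      then show False using t2.L_C[OF Lbd] dN by force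
    qed (use ord len in auto)
    then show False using len2[of b "a + int N"] t1.L_nc[OF Lac, of b "a + int N"] ord len dN by force
  qed
  have ad: "lifted_side N T1 a d"
  proof (rule t1.side_I)
    fix x y assume xy: "plift N T1 x y" "a < x" "x < d" "d < y"
    have "x \<ge> c" using t1.L_nc[OF Lac xy(1)] xy ord by force
    show False
    proof (rule L1[OF xy(1)])
      assume "plift N T2 x y"
      then show False using t2.L_nc[OF Lbd, of x y] xy \<open>x \<ge> c\<close> ord by force
    next
      fix t assume "x = a + t * int N" "y = c + t * int N"
      then show False using xy ord dN by (cases rule: shift_cases[of t N]) linarith+
    qed
  next
    fix x y assume xy: "plift N T1 x y" "x < a" "a < y" "y < d"
    have "y \<ge> c" using t1.L_nc[OF xy(1) Lac] xy ord by force
    show False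
    proof (rule L1[OF xy(1)])
      assume "plift N T2 x y"
      then show False using t2.L_nc[OF _ Lbd, of x y] xy \<open>y \<ge> c\<close> ord by force
    next
      fix t assume "x = a + t * int N" "y = c + t * int N"
      then show False using xy ord len by (cases rule: shift_cases[of t N]) linarith+
    qed
  next
    fix x assume x: "lifted_spoke N T1 x" "a < x" "x < d"
    then have "x \<ge> c" using t1.L_C[OF Lac, of x] by force
    then show False using t2.L_C[OF Lbd, of x] C12 x ord by force
  qed (use ord dN in auto)
  show ?thesis unfolding quad_flip_def
    using ord dN e e' side0_1[OF ab e ac] side0_1[OF bc e ac] side0_1[OF ad e ac] f2.side0_1[OF cd e' bd] rest
    by auto
qed

text \<open>Since \<open>b\<close> sees the puncture in \<open>T2\<close>, no diagonal of
  \<open>T2\<close> passes over \<open>b\<close>, and \<open>(a, b)\<close> and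
  \<open>(b, c)\<close> are sides. For the same reason \<open>(a, c)\<close> is outermost in
  \<open>T1\<close>, so both its ends carry central arcs.\<close>

lemma spoke_flip_lift:
  assumes e: "e = parc N a c" and e': "e' = spoke N b" and ord: "a < b" "b < c" "c \<le> a + int N"
  shows "spoke_flip N T0 e e' a b c"
proof -
  have ac: "a < c" "c \<le> a + int N" using ord by auto
  have Lac: "plift N T1 a c" using e1 e ord by (simp add: plift_def)
  have Cb: "lifted_spoke N T2 b" using e2 e' by (simp add: lifted_spoke_def)
  have L21: "plift N T1 x y \<and> plift N T0 x y" if "plift N T2 x y" for x y
    using that rest e' unfolding plift_def by blast
  have C2: "lifted_spoke N T1 x \<or> (\<exists>t. x = b + t * int N)" if "lifted_spoke N T2 x" for x
  proof (cases "spoke N x = e'")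
    case True
    then show ?thesis using e' nrm_eq_iff[of N b x] by auto
  next
    case False
    then show ?thesis using that rest unfolding lifted_spoke_def by blast
  qed
  have noC: False if x: "lifted_spoke N T2 x" "a < x" "x < c" "x \<noteq> b" for x
    using C2[OF x(1)]
  proof
    assume "\<exists>t. x = b + t * int N"
    then obtain t where "x = b + t * int N" by blast
    then show False using x ord by (cases rule: shift_cases[of t N]) linarith+
  qed (use t1.L_C[OF Lac] x in blast)
  note L1 = L1_cases[OF _ e ac]
  have len1: "y - x = c - a \<or> plift N T2 x y" if "plift N T1 x y" for x y
    using L1[OF that] by (smt (verit))
  have ab: "lifted_side N T2 a b"
  proof (rule t2.side_I)
    fix x y assume "plift N T2 x y" "a < x" "x < b" "b < y"
    then show False using t2.L_C[OF _ Cb] by blast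
  next
    fix x y assume xy: "plift N T2 x y" "x < a" "a < y" "y < b"
    then show False using t1.L_nc[OF conjunct1[OF L21[OF xy(1)]] Lac] ord by force
  qed (use noC ord in force)+
  have bc: "lifted_side N T2 b c"
  proof (rule t2.side_I)
    fix x y assume xy: "plift N T2 x y" "b < x" "x < c" "c < y"
    then show False using t1.L_nc[OF Lac conjunct1[OF L21[OF xy(1)]]] ord by force
  next
    fix x y assume "plift N T2 x y" "x < b" "b < y" "y < c"
    then show False using t2.L_C[OF _ Cb] by blast
  qed (use noC ord in force)+
  have C: "lifted_spoke N T1 a \<and> lifted_spoke N T1 c"
  proof (rule t1.no_arc_above_C[OF Lac])
    fix x y assume xy: "plift N T1 x y" "x \<le> a" "c \<le> y"
    then show "x = a \<and> y = c" using len1[OF xy(1)] t2.L_C[OF _ Cb, of x y] ord by force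
  qed
  show ?thesis unfolding spoke_flip_def
    using ord e e' ab bc C L21 by (auto simp: lifted_side_plift lifted_spoke_def)
qed

text \<open>Two central arcs never cross, so at least one of the exchanged arcs is peripheral; the
  interlacing pattern of the crossing lifts decides which of them plays the role of the diagonal
  \<open>(a, c)\<close>.\<close>

lemma flip_cases:
  obtains a b c d where "quad_flip N T0 e e' a b c d" "c < a + int N" "d < b + int N"
  | a b c d where "quad_flip N T0 e' e a b c d" "c < a + int N" "d < b + int N"
  | a b c where "spoke_flip N T0 e e' a b c"
  | a b c where "spoke_flip N T0 e' e a b c"
proof -
  interpret f2: flip N T2 T1 e' e by (rule flip_sym)
  note N3 = t1.N3
  have p: "e \<in> plain_arcs N" "e' \<in> plain_arcs N" using e1 e2 t1.T_plain t2.T_plain by auto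
  show thesis
  proof (rule plain_arc_cases[OF N3 p(1)])
    fix a c assume e: "e = parc N a c" "a + 2 \<le> c" "c \<le> a + int N"
    show thesis
    proof (rule plain_arc_cases[OF N3 p(2)])
      fix b0 d0 assume e'0: "e' = parc N b0 d0" "b0 + 2 \<le> d0" "d0 \<le> b0 + int N"
      obtain t where t: "let b = b0 + t * int N; d = d0 + t * int N in (a < b \<and> b < c \<and> c < d) \<or> (b < a \<and> a < d \<and> d < c)"
        using crosses_flip e e'0 crosses_parc[of a c N b0 d0] by auto
      define b where "b = b0 + t * int N"
      define d where "d = d0 + t * int N"
      have e': "e' = parc N b d" "b + 2 \<le> d" "d \<le> b + int N" using e'0 by (auto simp: b_def d_def)
      have o: "(a < b \<and> b < c \<and> c < d) \<or> (b < a \<and> a < d \<and> d < c)" using t by (simp add: b_def d_def Let_def)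
      have Lac: "plift N T1 a c" using e1 e by (simp add: plift_def)
      have Lbd: "plift N T2 b d" using e2 e' by (simp add: plift_def)
      have C12: "lifted_spoke N T1 x \<longleftrightarrow> lifted_spoke N T2 x" for x
        using rest e e' unfolding lifted_spoke_def by blast
      \<comment> \<open>A loop forces a central arc at \<open>a\<close> in both triangulations; one
        of its lifts, at \<open>a\<close> or at \<open>c\<close>, lies below the arc
        \<open>(b, d)\<close>.\<close>
      have c: "c \<noteq> a + int N"
      proof
        assume c: "c = a + int N"
        then have "lifted_spoke N T2 a" using t1.loop_C Lac C12 by simp
        then show False using o c t2.L_C[OF Lbd, of a] t2.L_C[OF Lbd, of c] lifted_spoke_shift[of N T2 a 1] by auto
      qed
      have d: "d \<noteq> b + int N"
      proof
        assume d: "d = b + int N"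
        then have "lifted_spoke N T1 b" using t2.loop_C Lbd C12 by simp
        then show False using o d t1.L_C[OF Lac, of b] t1.L_C[OF Lac, of d] lifted_spoke_shift[of N T1 b 1] by auto
      qed
      from o show thesis
      proof
        assume "a < b \<and> b < c \<and> c < d"
        then show thesis using quad_flip_lift[of a c b d] e e' c d that(1)[of a b c d] by auto
      next
        assume "b < a \<and> a < d \<and> d < c"
        then show thesis using f2.quad_flip_lift[of b d a c] e e' c d that(2)[of b a d c] rest by auto
      qed
    next
      fix b0 assume e'0: "e' = spoke N b0"
      then obtain t where t: "a < b0 + t * int N \<and> b0 + t * int N < c"
        using crosses_flip e crosses_spoke(1)[of a c N b0] by auto
      then show thesis using spoke_flip_lift[of a c "b0 + t * int N"] e'0 e that(3) by auto
    qed
  next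
    fix b0 assume e: "e = spoke N b0"
    show thesis
    proof (rule plain_arc_cases[OF N3 p(2)])
      fix a c assume e': "e' = parc N a c" "a + 2 \<le> c" "c \<le> a + int N"
      obtain t where t: "a < b0 + t * int N \<and> b0 + t * int N < c"
        using crosses_flip e e' crosses_spoke(2)[of a c N b0] by auto
      then show thesis using f2.spoke_flip_lift[of a c "b0 + t * int N"] e e' that(4) rest by auto
    next
      fix b assume "e' = spoke N b"
      then show thesis using crosses_flip e by simp
    qed
  qed
qed

end

subsection \<open>Triangles of a flip\<close>

fun shift_tri :: "int \<Rightarrow> ltri \<Rightarrow> ltri" where
  "shift_tri s (Tri a b c) = Tri (a + s) (b + s) (c + s)"
| "shift_tri s (CTri a b) = CTri (a + s) (b + s)"

definition norm_tri :: "nat \<Rightarrow> ltri \<Rightarrow> ltri" where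
  "norm_tri N \<Delta> = shift_tri (nrm N (first_corner \<Delta>) - first_corner \<Delta>) \<Delta>"

lemma norm_tri_shift: "\<exists>t. norm_tri N \<Delta> = shift_tri (t * int N) \<Delta>"
  unfolding norm_tri_def by (rule nrm_obtain[of N "first_corner \<Delta>"]) (metis add_diff_cancel_left')

lemma shift_shift [simp]: "shift_tri s (shift_tri r \<Delta>) = shift_tri (r + s) \<Delta>"
  by (cases \<Delta>) auto

lemma shift_0 [simp]: "shift_tri 0 \<Delta> = \<Delta>"
  by (cases \<Delta>) auto

lemma first_corner_shift [simp]: "first_corner (shift_tri s \<Delta>) = first_corner \<Delta> + s"
  by (cases \<Delta>) auto

lemma norm_tri_norm [simp]: "norm_tri N (shift_tri (t * int N) \<Delta>) = norm_tri N \<Delta>"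
  by (simp add: norm_tri_def)

lemma norm_tri_id: "1 \<le> first_corner \<Delta> \<Longrightarrow> first_corner \<Delta> \<le> int N \<Longrightarrow> norm_tri N \<Delta> = \<Delta>"
  by (simp add: norm_tri_def nrm_id)

lemma norm_tri_eqE:
  assumes "norm_tri N \<Delta> = norm_tri N \<Delta>'" obtains t where "\<Delta>' = shift_tri (t * int N) \<Delta>"
proof -
  obtain u v where "norm_tri N \<Delta> = shift_tri (u * int N) \<Delta>" "norm_tri N \<Delta>' = shift_tri (v * int N) \<Delta>'"
    using norm_tri_shift by blast
  then have "shift_tri (- (v * int N)) (shift_tri (u * int N) \<Delta>) = shift_tri (- (v * int N)) (shift_tri (v * int N) \<Delta>')"
    using assms by simp
  then have "\<Delta>' = shift_tri ((u - v) * int N) \<Delta>" by (simp add: algebra_simps)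
  then show thesis by (rule that)
qed

lemma lifted_side_shift [simp]:
  "lifted_side N T (a + t * int N) (b + t * int N) \<longleftrightarrow> lifted_side N T a b"
  by (auto simp: lifted_side_plift)

lemma lifted_triangles_shift [simp]:
  "shift_tri (t * int N) \<Delta> \<in> lifted_triangles N T \<longleftrightarrow> \<Delta> \<in> lifted_triangles N T"
  by (cases \<Delta>) (auto simp: lifted_triangles_def)

lemma norm_tri_lifted [simp]: "norm_tri N \<Delta> \<in> lifted_triangles N T \<longleftrightarrow> \<Delta> \<in> lifted_triangles N T"
  using norm_tri_shift[of N \<Delta>] by auto

lemma triangles_norm: assumes "N > 0"
  shows "triangles N T = norm_tri N ` lifted_triangles N T"
proof
  show "triangles N T \<subseteq> norm_tri N ` lifted_triangles N T"
    unfolding triangles_def by (force simp: image_iff norm_tri_id)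
  have "first_corner (norm_tri N \<Delta>) = nrm N (first_corner \<Delta>)" for \<Delta> by (simp add: norm_tri_def)
  then show "norm_tri N ` lifted_triangles N T \<subseteq> triangles N T"
    unfolding triangles_def using nrm_range[OF assms] by auto
qed

lemma cw_sides_shift [simp]: "cw_sides N (shift_tri (t * int N) \<Delta>) = cw_sides N \<Delta>"
  by (cases \<Delta>) (auto simp: Let_def)

lemma cw_sides_norm [simp]: "cw_sides N (norm_tri N \<Delta>) = cw_sides N \<Delta>"
  using norm_tri_shift[of N \<Delta>] by auto

lemma self_folded_shift [simp]: "self_folded N (shift_tri s \<Delta>) \<longleftrightarrow> self_folded N \<Delta>"
proof (cases \<Delta>)
  case (CTri a b)
  then show ?thesis unfolding self_folded_def by auto
qed (simp add: self_folded_def)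

lemma self_folded_norm [simp]: "self_folded N (norm_tri N \<Delta>) \<longleftrightarrow> self_folded N \<Delta>"
  by (simp add: norm_tri_def)

definition tri_weight :: "nat \<Rightarrow> ltri \<Rightarrow> arc \<Rightarrow> arc \<Rightarrow> int" where
  "tri_weight N \<Delta> D E = (if self_folded N \<Delta> then 0
     else of_bool ((D, E) \<in> cw_sides N \<Delta>) - of_bool ((E, D) \<in> cw_sides N \<Delta>))"

text \<open>This is \<open>signed_adj\<close> without the unfolding of arcs, which depends on
  \<open>T\<close>. Two triangulations can then be compared triangle by triangle, and unfolding
  enters only through the labels of rows and columns.\<close>

definition tri_sum :: "nat \<Rightarrow> arc set \<Rightarrow> arc \<Rightarrow> arc \<Rightarrow> int" where
  "tri_sum N T D E = (\<Sum>\<Delta>\<in>triangles N T. tri_weight N \<Delta> D E)"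

lemma signed_adj_tri_sum: "signed_adj N T D E = tri_sum N T (unfold_arc T D) (unfold_arc T E)"
  unfolding signed_adj_def tri_sum_def
  by (rule sum.mono_neutral_cong_left) (auto simp: finite_triangles tri_weight_def)

lemma lifted_triangles_mono: "T \<subseteq> T' \<Longrightarrow> lifted_triangles N T \<subseteq> lifted_triangles N T'"
  unfolding lifted_triangles_def lifted_side_def lifted_spoke_def by blast

text \<open>Isolates the contribution of the two triangles, up to deck transformations, that
  disappear when the flipped arc is removed.\<close>

lemma tri_sum_insert2:
  assumes N: "N > 0" and T: "T0 \<subseteq> T"
    and new: "\<And>\<Delta>. \<Delta> \<in> lifted_triangles N T \<Longrightarrow> \<Delta> \<notin> lifted_triangles N T0 \<Longrightarrow>
       \<exists>t. \<Delta> = shift_tri (t * int N) \<Delta>1 \<or> \<Delta> = shift_tri (t * int N) \<Delta>2"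
    and in1: "\<Delta>1 \<in> lifted_triangles N T" "\<Delta>1 \<notin> lifted_triangles N T0"
    and in2: "\<Delta>2 \<in> lifted_triangles N T" "\<Delta>2 \<notin> lifted_triangles N T0"
    and ne: "\<And>t. \<Delta>2 \<noteq> shift_tri (t * int N) \<Delta>1"
  shows "tri_sum N T D E = tri_sum N T0 D E + tri_weight N \<Delta>1 D E + tri_weight N \<Delta>2 D E"
proof -
  have eq: "triangles N T = insert (norm_tri N \<Delta>1) (insert (norm_tri N \<Delta>2) (triangles N T0))"
  proof
    show "insert (norm_tri N \<Delta>1) (insert (norm_tri N \<Delta>2) (triangles N T0)) \<subseteq> triangles N T"
      unfolding triangles_norm[OF N] using in1 in2 lifted_triangles_mono[OF T] by auto
    show "triangles N T \<subseteq> insert (norm_tri N \<Delta>1) (insert (norm_tri N \<Delta>2) (triangles N T0))"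
    proof
      fix \<Delta>' assume "\<Delta>' \<in> triangles N T"
      then obtain \<Delta> where \<Delta>: "\<Delta> \<in> lifted_triangles N T" "\<Delta>' = norm_tri N \<Delta>"
        unfolding triangles_norm[OF N] by blast
      show "\<Delta>' \<in> insert (norm_tri N \<Delta>1) (insert (norm_tri N \<Delta>2) (triangles N T0))"
      proof (cases "\<Delta> \<in> lifted_triangles N T0")
        case True
        then show ?thesis using \<Delta> unfolding triangles_norm[OF N] by blast
      next
        case False
        then show ?thesis using new[OF \<Delta>(1)] \<Delta>(2) by auto
      qed
    qed
  qed
  have "norm_tri N \<Delta>1 \<noteq> norm_tri N \<Delta>2" using norm_tri_eqE ne by metis
  moreover have "norm_tri N \<Delta>1 \<notin> triangles N T0" "norm_tri N \<Delta>2 \<notin> triangles N T0"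
    using in1 in2 unfolding triangles_def by auto
  ultimately show ?thesis unfolding tri_sum_def eq
    using finite_triangles[of N T0] by (simp add: tri_weight_def)
qed

text \<open>The hypothesis that \<open>D\<close> is a plain arc excludes boundary segments, the only
  sides of triangles that do not belong to \<open>T\<close>.\<close>

lemma cw_sides_in:
  assumes "N \<ge> 3" "\<Delta> \<in> lifted_triangles N T" "(D, E) \<in> cw_sides N \<Delta> \<or> (E, D) \<in> cw_sides N \<Delta>" "D \<in> plain_arcs N"
  shows "D \<in> T"
proof -
  have P: "parc N x y \<in> T" if "lifted_side N T x y" "parc N x y \<in> plain_arcs N" for x y
  proof (cases "y = x + 1")
    case True
    then have "nrm N y = nrm N (nrm N x + 1)" using nrm_suc_iff[OF assms(1), of x y] assms(1) by simp
    then show ?thesis using that(2) by (auto simp: plain_arcs_def)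
  next
    case False
    then show ?thesis using that by (simp add: lifted_side_plift plift_def)
  qed
  show ?thesis
    using assms(2-4) P unfolding lifted_triangles_def
    by (auto simp: Let_def lifted_spoke_def)
qed

lemma tri_sum_0:
  assumes "N \<ge> 3" "D \<in> plain_arcs N" "D \<notin> T"
  shows "tri_sum N T D E = 0 \<and> tri_sum N T E D = 0"
proof -
  have "(D, E) \<notin> cw_sides N \<Delta> \<and> (E, D) \<notin> cw_sides N \<Delta>" if "\<Delta> \<in> triangles N T" for \<Delta>
    using that assms cw_sides_in[OF assms(1), of \<Delta> T D E] unfolding triangles_def by blast
  then show ?thesis unfolding tri_sum_def tri_weight_def by (auto intro!: sum.neutral)
qed

text \<open>A triangle that disappears with the arc has it as a side. Translating this side onto
  \<open>(a, c)\<close> leaves the third vertex as the only unknown.\<close>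

lemma (in triang) new_triangle_periph:
  assumes ac: "a + 2 \<le> c" "c \<le> a + int N"
    and \<Delta>: "\<Delta> \<in> lifted_triangles N T" "\<Delta> \<notin> lifted_triangles N (T - {parc N a c})"
  obtains t \<Delta>' where "\<Delta> = shift_tri (t * int N) \<Delta>'" "\<Delta>' \<in> lifted_triangles N T"
    "(\<exists>y. \<Delta>' = Tri a y c) \<or> (\<exists>y. \<Delta>' = Tri a c y) \<or> (\<exists>y. \<Delta>' = Tri y a c) \<or> \<Delta>' = CTri a c"
proof -
  note K = that
  let ?s0 = "lifted_side N (T - {parc N a c})"
  have s: "?s0 x y \<or> (\<exists>t. x = a + t * int N \<and> y = c + t * int N)" if "side x y" for x y
  proof (cases "?s0 x y")
    case False
    then have "parc N a c = parc N x y" using that by (auto simp: lifted_side_plift plift_def)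
    moreover have "x < y" "y \<le> x + int N" using side_len[OF that] by auto
    ultimately show ?thesis using parc_eqE[of N a c x y] ac by (smt (verit))
  qed simp
  have C0: "lifted_spoke N (T - {parc N a c}) x = C x" for x by (simp add: lifted_spoke_def)
  have D: thesis if "\<Delta> = shift_tri (t * int N) \<Delta>'"
     "(\<exists>y. \<Delta>' = Tri a y c) \<or> (\<exists>y. \<Delta>' = Tri a c y) \<or> (\<exists>y. \<Delta>' = Tri y a c) \<or> \<Delta>' = CTri a c" for t \<Delta>'
    using that K[of t \<Delta>'] \<Delta>(1) by simp
  from \<Delta>(1) consider x y z where "\<Delta> = Tri x y z" "x < y" "y < z" "side x y" "side y z" "side x z"
    | x y where "\<Delta> = CTri x y" "x < y" "side x y" "C x" "C y"
    unfolding lifted_triangles_def by blast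
  then show thesis
  proof cases
    case 1
    then consider "\<not> ?s0 x y" | "\<not> ?s0 y z" | "\<not> ?s0 x z" using \<Delta>(2) unfolding lifted_triangles_def by blast
    then show thesis
    proof cases
      case A: 1
      then obtain t where "x = a + t * int N" "y = c + t * int N" using s 1 by blast
      then show thesis using D[of t "Tri a c (z - t * int N)"] 1 by simp
    next
      case A: 2
      then obtain t where "y = a + t * int N" "z = c + t * int N" using s 1 by blast
      then show thesis using D[of t "Tri (x - t * int N) a c"] 1 by simp
    next
      case A: 3
      then obtain t where "x = a + t * int N" "z = c + t * int N" using s 1 by blast
      then show thesis using D[of t "Tri a (y - t * int N) c"] 1 by simp
    qed
  next
    case 2
    then have "\<not> ?s0 x y" using \<Delta>(2) C0 unfolding lifted_triangles_def by blast
    then obtain t where "x = a + t * int N" "y = c + t * int N" using s 2 by blast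
    then show thesis using D[of t "CTri a c"] 2 by simp
  qed
qed

lemma (in triang) new_triangle_spoke:
  assumes \<Delta>: "\<Delta> \<in> lifted_triangles N T" "\<Delta> \<notin> lifted_triangles N (T - {spoke N b})"
  obtains t \<Delta>' where "\<Delta> = shift_tri (t * int N) \<Delta>'" "\<Delta>' \<in> lifted_triangles N T"
    "(\<exists>y. \<Delta>' = CTri b y) \<or> (\<exists>y. \<Delta>' = CTri y b)"
proof -
  note K = that
  have s0: "lifted_side N (T - {spoke N b}) x y = side x y" for x y by (simp add: lifted_side_def)
  have C0: "lifted_spoke N (T - {spoke N b}) x \<or> (\<exists>t. x = b + t * int N)" if "C x" for x
    using that nrm_eq_iff[of N b x] by (auto simp: lifted_spoke_def)
  have D: thesis if "\<Delta> = shift_tri (t * int N) \<Delta>'"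
     "(\<exists>y. \<Delta>' = CTri b y) \<or> (\<exists>y. \<Delta>' = CTri y b)" for t \<Delta>'
    using that K[of t \<Delta>'] \<Delta>(1) by simp
  from \<Delta> s0 obtain x y where xy: "\<Delta> = CTri x y" "x < y" "side x y" "C x" "C y"
    unfolding lifted_triangles_def by auto
  then have "\<not> lifted_spoke N (T - {spoke N b}) x \<or> \<not> lifted_spoke N (T - {spoke N b}) y"
    using \<Delta>(2) s0 unfolding lifted_triangles_def by auto
  then consider t where "x = b + t * int N" | t where "y = b + t * int N" using C0 xy by blast
  then show thesis
  proof cases
    case 1
    then show thesis using D[of t "CTri b (y - t * int N)"] xy by simp
  next
    case 2
    then show thesis using D[of t "CTri (x - t * int N) b"] xy by simp
  qed
qed

lemma Tri_lifted: "Tri x y z \<in> lifted_triangles N T \<longleftrightarrow> x < y \<and> y < z \<and>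
    lifted_side N T x y \<and> lifted_side N T y z \<and> lifted_side N T x z"
  and CTri_lifted: "CTri x y \<in> lifted_triangles N T \<longleftrightarrow> x < y \<and>
    lifted_side N T x y \<and> lifted_spoke N T x \<and> lifted_spoke N T y"
  by (auto simp: lifted_triangles_def)

text \<open>The contribution of one triangle, depending only on the cyclic order of its sides. This
  freedom is used to list the flipped diagonal last.\<close>

definition cyc_sign :: "arc \<Rightarrow> arc \<Rightarrow> arc \<Rightarrow> arc \<Rightarrow> arc \<Rightarrow> int" where
  "cyc_sign x y z D E = of_bool ((D, E) \<in> {(x, y), (y, z), (z, x)}) - of_bool ((E, D) \<in> {(x, y), (y, z), (z, x)})"

lemma cyc_sign_rotate: "cyc_sign y z x = cyc_sign x y z" unfolding cyc_sign_def by (intro ext) (simp add: insert_commute)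

lemma tri_weight_Tri: "tri_weight N (Tri a b c) = cyc_sign (parc N a b) (parc N b c) (parc N a c)"
proof -
  have "\<not> self_folded N (Tri a b c)" by (simp add: self_folded_def)
  moreover have "cw_sides N (Tri a b c) =
      {(parc N a b, parc N b c), (parc N b c, parc N a c), (parc N a c, parc N a b)}"
    by (simp only: cw_sides.simps Let_def)
  ultimately show ?thesis by (intro ext) (simp only: tri_weight_def cyc_sign_def if_False)
qed

lemma tri_weight_CTri:
  assumes "b \<noteq> a + int N"
  shows "tri_weight N (CTri a b) = cyc_sign (parc N a b) (spoke N b) (spoke N a)"
proof -
  have "\<not> self_folded N (CTri a b)" using assms by (simp add: self_folded_def)
  moreover have "cw_sides N (CTri a b) =
      {(parc N a b, spoke N b), (spoke N b, spoke N a), (spoke N a, parc N a b)}"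
    by (simp only: cw_sides.simps Let_def)
  ultimately show ?thesis by (intro ext) (simp only: tri_weight_def cyc_sign_def if_False)
qed

lemma tri_weight_self_folded: "tri_weight N (CTri a (a + int N)) = (\<lambda>D E. 0)"
  by (intro ext) (simp add: tri_weight_def self_folded_def)

text \<open>Two lifts that start within one window of length \<open>N\<close> cannot be nontrivial
  translates of each other. This is how sides and diagonals of a lifted quadrilateral are seen to be
  distinct arcs.\<close>

lemma parc_eq_window:
  assumes "a \<le> x" "x < a + int N" "a \<le> x'" "x' < a + int N" "x < y" "y \<le> x + int N" "x' < y'" "y' \<le> x' + int N"
  shows "parc N x y = parc N x' y' \<longleftrightarrow> x = x' \<and> y = y'"
proof
  assume "parc N x y = parc N x' y'"
  then obtain t where t: "x' = x + t * int N" "y' = y + t * int N" using parc_eqE assms by metis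
  then show "x = x' \<and> y = y'" using assms by (cases rule: shift_cases[of t N]) linarith+
qed simp

lemma nrm_eq_window:
  assumes "a \<le> x" "x < a + int N" "a \<le> x'" "x' < a + int N"
  shows "nrm N x = nrm N x' \<longleftrightarrow> x = x'"
proof
  assume "nrm N x = nrm N x'"
  then obtain t where t: "x' = x + t * int N" using nrm_eq_iff by metis
  then show "x = x'" using assms by (cases rule: shift_cases[of t N]) linarith+
qed simp

context flip begin

text \<open>The diagonal \<open>e\<close> cuts the quadrilateral into \<open>a b c\<close> and
  \<open>a c d\<close>, and \<open>e'\<close> into \<open>b c d\<close> and \<open>a b d\<close>.
  The cyclic orders are rotated to the form that \<open>quad_mutation\<close> expects, with sides
  \<open>s1, s2, s3, s4\<close> in order and the diagonal last.\<close>

lemma quad_tri_sum: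
  assumes Q: "quad_flip N T0 e e' a b c d"
  shows "tri_sum N T1 D E = tri_sum N T0 D E + cyc_sign (parc N a b) (parc N b c) e D E + cyc_sign (parc N c d) (parc N a d) e D E"
    and "tri_sum N T2 D E = tri_sum N T0 D E + cyc_sign (parc N b c) (parc N c d) e' D E + cyc_sign (parc N a d) (parc N a b) e' D E"
proof -
  have N: "N > 0" using t1.N3 by simp
  have sub: "T0 \<subseteq> T2" using rest by blast
  from Q have o: "a < b" "b < c" "c < d" "d \<le> a + int N" and e: "e = parc N a c" and e': "e' = parc N b d"
    and s0: "lifted_side N T0 a b" "lifted_side N T0 b c" "lifted_side N T0 c d" "lifted_side N T0 a d"
    by (auto simp: quad_flip_def)
  have m1: "lifted_side N T1 x y" and m2: "lifted_side N T2 x y" if "lifted_side N T0 x y" for x y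
    using that rest unfolding lifted_side_def by blast+
  have n1: "\<not> lifted_side N T0 a c" using o e by (auto simp: lifted_side_def)
  have n2: "\<not> lifted_side N T0 b d" using o e' e'_notin by (auto simp: lifted_side_def)
  have ac1: "lifted_side N T1 a c" using o e e1 by (simp add: lifted_side_def)
  have bd2: "lifted_side N T2 b d" using o e' e2 by (simp add: lifted_side_def)
  note s1 = s0[THEN m1] and s2 = s0[THEN m2]
  have "tri_sum N T1 D E = tri_sum N T0 D E + tri_weight N (Tri a b c) D E + tri_weight N (Tri a c d) D E"
  proof (rule tri_sum_insert2[OF N])
    fix \<Delta> assume \<Delta>: "\<Delta> \<in> lifted_triangles N T1" "\<Delta> \<notin> lifted_triangles N T0"
    obtain t \<Delta>' where \<Delta>': "\<Delta> = shift_tri (t * int N) \<Delta>'" "\<Delta>' \<in> lifted_triangles N T1"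
    "(\<exists>y. \<Delta>' = Tri a y c) \<or> (\<exists>y. \<Delta>' = Tri a c y) \<or> (\<exists>y. \<Delta>' = Tri y a c) \<or> \<Delta>' = CTri a c"
      using t1.new_triangle_periph[of a c \<Delta>] \<Delta> o unfolding e by (smt (verit))
    from \<Delta>'(3) have "\<Delta>' = Tri a b c \<or> \<Delta>' = Tri a c d"
    proof (elim disjE exE)
      fix y assume y: "\<Delta>' = Tri a y c"
      then have "a < y" "y < c" "lifted_side N T1 a y" "lifted_side N T1 y c" using \<Delta>'(2) by (auto simp: Tri_lifted)
      then have "y = b" using t1.side_nc[OF s1(1), of y c] t1.side_nc[of a y b c, OF _ s1(2)] o by force
      then show ?thesis using y by simp
    next
      fix y assume y: "\<Delta>' = Tri a c y"
      then have "c < y" "lifted_side N T1 a y" "lifted_side N T1 c y" using \<Delta>'(2) by (auto simp: Tri_lifted)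
      then have "y = d" using t1.side_nc[OF s1(4), of c y] t1.side_nc[of a y c d, OF _ s1(3)] o by force
      then show ?thesis using y by simp
    next
      fix y assume y: "\<Delta>' = Tri y a c"
      then have "y < a" "lifted_side N T1 y c" using \<Delta>'(2) by (auto simp: Tri_lifted)
      then show ?thesis using t1.side_nc[of y c a d, OF _ s1(4)] o by force
    next
      assume y: "\<Delta>' = CTri a c"
      then have "lifted_spoke N T1 c" using \<Delta>'(2) by (auto simp: CTri_lifted)
      then show ?thesis using t1.side_C[OF s1(4), of c] o by force
    qed
    then show "\<exists>t. \<Delta> = shift_tri (t * int N) (Tri a b c) \<or> \<Delta> = shift_tri (t * int N) (Tri a c d)"
      using \<Delta>'(1) by blast
  qed (use o s1 ac1 n1 in \<open>auto simp: Tri_lifted\<close>)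
  then show "tri_sum N T1 D E = tri_sum N T0 D E + cyc_sign (parc N a b) (parc N b c) e D E + cyc_sign (parc N c d) (parc N a d) e D E"
    by (simp add: tri_weight_Tri e cyc_sign_rotate[of "parc N c d" "parc N a d"])
  have "tri_sum N T2 D E = tri_sum N T0 D E + tri_weight N (Tri b c d) D E + tri_weight N (Tri a b d) D E"
  proof (rule tri_sum_insert2[OF N])
    fix \<Delta> assume \<Delta>: "\<Delta> \<in> lifted_triangles N T2" "\<Delta> \<notin> lifted_triangles N T0"
    obtain t \<Delta>' where \<Delta>': "\<Delta> = shift_tri (t * int N) \<Delta>'" "\<Delta>' \<in> lifted_triangles N T2"
    "(\<exists>y. \<Delta>' = Tri b y d) \<or> (\<exists>y. \<Delta>' = Tri b d y) \<or> (\<exists>y. \<Delta>' = Tri y b d) \<or> \<Delta>' = CTri b d"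
      using t2.new_triangle_periph[of b d \<Delta>] \<Delta> o unfolding rest e' by (smt (verit))
    from \<Delta>'(3) have "\<Delta>' = Tri b c d \<or> \<Delta>' = Tri a b d"
    proof (elim disjE exE)
      fix y assume y: "\<Delta>' = Tri b y d"
      then have "b < y" "y < d" "lifted_side N T2 b y" "lifted_side N T2 y d" using \<Delta>'(2) by (auto simp: Tri_lifted)
      then have "y = c" using t2.side_nc[OF s2(2), of y d] t2.side_nc[of b y c d, OF _ s2(3)] o by force
      then show ?thesis using y by simp
    next
      fix y assume y: "\<Delta>' = Tri b d y"
      then have "d < y" "lifted_side N T2 b y" using \<Delta>'(2) by (auto simp: Tri_lifted)
      then show ?thesis using t2.side_nc[OF s2(4), of b y] o by force
    next
      fix y assume y: "\<Delta>' = Tri y b d"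
      then have "y < b" "lifted_side N T2 y d" "lifted_side N T2 y b" using \<Delta>'(2) by (auto simp: Tri_lifted)
      then have "y = a" using t2.side_nc[of y b a d, OF _ s2(4)] t2.side_nc[OF s2(1), of y d] o by force
      then show ?thesis using y by simp
    next
      assume y: "\<Delta>' = CTri b d"
      then have "lifted_spoke N T2 b" using \<Delta>'(2) by (auto simp: CTri_lifted)
      then show ?thesis using t2.side_C[OF s2(4), of b] o by force
    qed
    then show "\<exists>t. \<Delta> = shift_tri (t * int N) (Tri b c d) \<or> \<Delta> = shift_tri (t * int N) (Tri a b d)"
      using \<Delta>'(1) by blast
  qed (use o s2 bd2 n2 sub in \<open>auto simp: Tri_lifted\<close>)
  then show "tri_sum N T2 D E = tri_sum N T0 D E + cyc_sign (parc N b c) (parc N c d) e' D E + cyc_sign (parc N a d) (parc N a b) e' D E"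
    by (simp add: tri_weight_Tri e' cyc_sign_rotate[of "parc N a d" "parc N a b"] cyc_sign_rotate[of "parc N b d" "parc N a d"])
qed

text \<open>The quadrilateral now has the puncture as fourth vertex. If \<open>e\<close> is a loop,
  the triangle inside it is self-folded and contributes nothing.\<close>

lemma spoke_tri_sum:
  assumes Q: "spoke_flip N T0 e e' a b c"
  shows "tri_sum N T1 D E = tri_sum N T0 D E + cyc_sign (parc N a b) (parc N b c) e D E +
      (if c = a + int N then 0 else cyc_sign (spoke N c) (spoke N a) e D E)"
    and "tri_sum N T2 D E = tri_sum N T0 D E + cyc_sign (parc N b c) (spoke N c) e' D E + cyc_sign (spoke N a) (parc N a b) e' D E"
proof -
  have N: "N > 0" using t1.N3 by simp
  have sub: "T0 \<subseteq> T2" using rest by blast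
  from Q have o: "a < b" "b < c" "c \<le> a + int N" and e: "e = parc N a c" and e': "e' = spoke N b"
    and s0: "lifted_side N T0 a b" "lifted_side N T0 b c" and C0: "lifted_spoke N T0 a" "lifted_spoke N T0 c"
    by (auto simp: spoke_flip_def)
  have m1: "lifted_side N T1 x y" and m2: "lifted_side N T2 x y" if "lifted_side N T0 x y" for x y
    using that rest unfolding lifted_side_def by blast+
  have c1: "lifted_spoke N T1 x" and c2: "lifted_spoke N T2 x" if "lifted_spoke N T0 x" for x
    using that rest unfolding lifted_spoke_def by blast+
  have n1: "\<not> lifted_side N T0 a c" using o e by (auto simp: lifted_side_def)
  have n2: "\<not> lifted_spoke N T0 b" using e' e'_notin by (auto simp: lifted_spoke_def)
  have ac1: "lifted_side N T1 a c" using o e e1 by (simp add: lifted_side_def)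
  have b2: "lifted_spoke N T2 b" using e' e2 by (simp add: lifted_spoke_def)
  note s1 = s0[THEN m1] and s2 = s0[THEN m2] and C1 = C0[THEN c1] and C2 = C0[THEN c2]
  have "tri_sum N T1 D E = tri_sum N T0 D E + tri_weight N (Tri a b c) D E + tri_weight N (CTri a c) D E"
  proof (rule tri_sum_insert2[OF N])
    fix \<Delta> assume \<Delta>: "\<Delta> \<in> lifted_triangles N T1" "\<Delta> \<notin> lifted_triangles N T0"
    obtain t \<Delta>' where \<Delta>': "\<Delta> = shift_tri (t * int N) \<Delta>'" "\<Delta>' \<in> lifted_triangles N T1"
    "(\<exists>y. \<Delta>' = Tri a y c) \<or> (\<exists>y. \<Delta>' = Tri a c y) \<or> (\<exists>y. \<Delta>' = Tri y a c) \<or> \<Delta>' = CTri a c"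
      using t1.new_triangle_periph[of a c \<Delta>] \<Delta> o unfolding e by (smt (verit))
    from \<Delta>'(3) have "\<Delta>' = Tri a b c \<or> \<Delta>' = CTri a c"
    proof (elim disjE exE)
      fix y assume y: "\<Delta>' = Tri a y c"
      then have "a < y" "y < c" "lifted_side N T1 a y" "lifted_side N T1 y c" using \<Delta>'(2) by (auto simp: Tri_lifted)
      then have "y = b" using t1.side_nc[OF s1(1), of y c] t1.side_nc[of a y b c, OF _ s1(2)] o by force
      then show ?thesis using y by simp
    next
      fix y assume y: "\<Delta>' = Tri a c y"
      then have "c < y" "lifted_side N T1 a y" using \<Delta>'(2) by (auto simp: Tri_lifted)
      then show ?thesis using t1.side_C[of a y c] C1 o by force
    next
      fix y assume y: "\<Delta>' = Tri y a c"
      then have "y < a" "lifted_side N T1 y c" using \<Delta>'(2) by (auto simp: Tri_lifted)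
      then show ?thesis using t1.side_C[of y c a] C1 o by force
    qed simp
    then show "\<exists>t. \<Delta> = shift_tri (t * int N) (Tri a b c) \<or> \<Delta> = shift_tri (t * int N) (CTri a c)"
      using \<Delta>'(1) by blast
  qed (use o s1 ac1 n1 C1 in \<open>auto simp: Tri_lifted CTri_lifted\<close>)
  then show "tri_sum N T1 D E = tri_sum N T0 D E + cyc_sign (parc N a b) (parc N b c) e D E +
      (if c = a + int N then 0 else cyc_sign (spoke N c) (spoke N a) e D E)"
    by (simp add: tri_weight_Tri tri_weight_CTri tri_weight_self_folded e cyc_sign_rotate[of "spoke N c" "spoke N a"])
  have "tri_sum N T2 D E = tri_sum N T0 D E + tri_weight N (CTri b c) D E + tri_weight N (CTri a b) D E"
  proof (rule tri_sum_insert2[OF N])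
    fix \<Delta> assume \<Delta>: "\<Delta> \<in> lifted_triangles N T2" "\<Delta> \<notin> lifted_triangles N T0"
    obtain t \<Delta>' where \<Delta>': "\<Delta> = shift_tri (t * int N) \<Delta>'" "\<Delta>' \<in> lifted_triangles N T2"
      "(\<exists>y. \<Delta>' = CTri b y) \<or> (\<exists>y. \<Delta>' = CTri y b)"
      using t2.new_triangle_spoke[of \<Delta> b] \<Delta> unfolding rest e' by (smt (verit))
    from \<Delta>'(3) have "\<Delta>' = CTri b c \<or> \<Delta>' = CTri a b"
    proof (elim disjE exE)
      fix y assume y: "\<Delta>' = CTri b y"
      then have "b < y" "lifted_side N T2 b y" "lifted_spoke N T2 y" using \<Delta>'(2) by (auto simp: CTri_lifted)
      then have "y = c" using t2.side_C[of b y c] t2.side_C[OF s2(2), of y] C2 o by force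
      then show ?thesis using y by simp
    next
      fix y assume y: "\<Delta>' = CTri y b"
      then have "y < b" "lifted_side N T2 y b" "lifted_spoke N T2 y" using \<Delta>'(2) by (auto simp: CTri_lifted)
      then have "y = a" using t2.side_C[of y b a] t2.side_C[OF s2(1), of y] C2 o by force
      then show ?thesis using y by simp
    qed
    then show "\<exists>t. \<Delta> = shift_tri (t * int N) (CTri b c) \<or> \<Delta> = shift_tri (t * int N) (CTri a b)"
      using \<Delta>'(1) by blast
  next
    fix t show "CTri a b \<noteq> shift_tri (t * int N) (CTri b c)"
    proof
      assume "CTri a b = shift_tri (t * int N) (CTri b c)"
      then have "a = b + t * int N" by simp
      then show False using o by (cases rule: shift_cases[of t N]) linarith+
    qed
  qed (use o s2 n2 C2 b2 sub in \<open>auto simp: CTri_lifted\<close>)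
  then show "tri_sum N T2 D E = tri_sum N T0 D E + cyc_sign (parc N b c) (spoke N c) e' D E + cyc_sign (spoke N a) (parc N a b) e' D E"
    using o by (simp add: tri_weight_CTri e' cyc_sign_rotate[of "spoke N a" "parc N a b"] cyc_sign_rotate[of "spoke N b" "spoke N a"])
qed

end

subsection \<open>Matrix mutation\<close>

lemma mutate_matrix_involution: "mutate_matrix k (mutate_matrix k B) i j = B i j"
  by (auto simp: mutate_matrix_def)

lemma cyc_sign_entry:
  assumes "distinct [x, y, z]"
  shows "cyc_sign x y z D z = of_bool (D = y) - of_bool (D = x)" "cyc_sign x y z z D = of_bool (D = x) - of_bool (D = y)"
  using assms by (auto simp: cyc_sign_def)

text \<open>Nothing changes outside the quadrilateral, which is the part \<open>W\<close>. Row and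
  column of \<open>k\<close> are supported on the four sides; reversing them and adding the products
  over paths through \<open>e\<close> turns the cyclic orders for one diagonal into those for the
  other. \<open>h1\<close> and \<open>h2\<close> give the unfolded arc at each index, and several
  indices may carry the same one.\<close>

lemma quad_mutation:
  assumes dist: "distinct [s1, s2, s3, s4, e, e']"
    and W: "\<And>D. W e D = 0 \<and> W D e = 0 \<and> W e' D = 0 \<and> W D e' = 0"
    and B1: "\<And>i j. B1 i j = W (h1 i) (h1 j) + cyc_sign s1 s2 e (h1 i) (h1 j) + cyc_sign s3 s4 e (h1 i) (h1 j)"
    and B2: "\<And>i j. B2 i j = W (h2 i) (h2 j) + cyc_sign s2 s3 e' (h2 i) (h2 j) + cyc_sign s4 s1 e' (h2 i) (h2 j)"
    and hk: "h1 k = e" "h2 k = e'"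
    and hi: "i \<noteq> k \<Longrightarrow> h2 i = h1 i \<and> h1 i \<noteq> e \<and> h1 i \<noteq> e'"
    and hj: "j \<noteq> k \<Longrightarrow> h2 j = h1 j \<and> h1 j \<noteq> e \<and> h1 j \<noteq> e'"
  shows "mutate_matrix k B1 i j = B2 i j"
proof -
  have d: "distinct [s1, s2, e]" "distinct [s3, s4, e]" "distinct [s2, s3, e']" "distinct [s4, s1, e']"
    using dist by auto
  have ik: "B1 i k = of_bool (h1 i = s2) - of_bool (h1 i = s1) + of_bool (h1 i = s4) - of_bool (h1 i = s3)" for i
    by (simp add: B1 hk W cyc_sign_entry[OF d(1)] cyc_sign_entry[OF d(2)])
  have kj: "B1 k j = of_bool (h1 j = s1) - of_bool (h1 j = s2) + of_bool (h1 j = s3) - of_bool (h1 j = s4)" for j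
    by (simp add: B1 hk W cyc_sign_entry[OF d(1)] cyc_sign_entry[OF d(2)])
  have ik2: "B2 i k = of_bool (h2 i = s3) - of_bool (h2 i = s2) + of_bool (h2 i = s1) - of_bool (h2 i = s4)" for i
    by (simp add: B2 hk W cyc_sign_entry[OF d(3)] cyc_sign_entry[OF d(4)])
  have kj2: "B2 k j = of_bool (h2 j = s2) - of_bool (h2 j = s3) + of_bool (h2 j = s4) - of_bool (h2 j = s1)" for j
    by (simp add: B2 hk W cyc_sign_entry[OF d(3)] cyc_sign_entry[OF d(4)])
  show ?thesis
  proof (cases "i = k \<or> j = k")
    case True
    then show ?thesis
    proof (cases "j = k")
      case True
      then show ?thesis using hi dist by (cases "i = k") (auto simp: mutate_matrix_def ik ik2 hk)
    next
      case False
      then show ?thesis using True hj by (auto simp: mutate_matrix_def kj kj2)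
    qed
  next
    case False
    then have h: "h2 i = h1 i" "h1 i \<noteq> e" "h1 i \<noteq> e'" "h2 j = h1 j" "h1 j \<noteq> e" "h1 j \<noteq> e'" using hi hj by auto
    define X where "X = h1 i" define Y where "Y = h1 j"
    have "mutate_matrix k B1 i j - W X Y = cyc_sign s1 s2 e X Y + cyc_sign s3 s4 e X Y
       + sgn (B1 i k) * max 0 (B1 i k * B1 k j)"
      using False unfolding mutate_matrix_def X_def Y_def by (simp add: B1)
    also have "\<dots> = cyc_sign s2 s3 e' X Y + cyc_sign s4 s1 e' X Y"
      unfolding ik kj X_def[symmetric] Y_def[symmetric]
      using dist h(2,3,5,6)[folded X_def Y_def]
      by (cases "X = s1"; cases "X = s2"; cases "X = s3"; cases "X = s4";
          cases "Y = s1"; cases "Y = s2"; cases "Y = s3"; cases "Y = s4") (simp_all add: cyc_sign_def)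
    also have "\<dots> = B2 i j - W X Y" using h by (simp add: B2 X_def Y_def)
    finally show ?thesis by simp
  qed
qed

text \<open>Here \<open>e\<close> is a loop, \<open>A\<close> the central arc inside it and
  \<open>e'\<close> the second central arc. Before the flip the index of \<open>A\<close> also
  unfolds to \<open>e\<close>, so it has the same row and column as \<open>k\<close>; mutation
  reverses those of \<open>k\<close> only, and afterwards \<open>A\<close> unfolds to
  itself.\<close>

lemma digon_mutation:
  assumes dist: "distinct [s1, s2, A, e, e']"
    and W: "\<And>D. W e D = 0 \<and> W D e = 0 \<and> W e' D = 0 \<and> W D e' = 0 \<and> W A D = 0 \<and> W D A = 0"
    and B1: "\<And>i j. B1 i j = W (h1 i) (h1 j) + cyc_sign s1 s2 e (h1 i) (h1 j)"
    and B2: "\<And>i j. B2 i j = W (h2 i) (h2 j) + cyc_sign s2 A e' (h2 i) (h2 j) + cyc_sign A s1 e' (h2 i) (h2 j)"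
    and hk: "h1 k = e" "h2 k = e'"
    and hi: "i \<noteq> k \<Longrightarrow> (h2 i = h1 i \<and> h1 i \<noteq> e \<and> h1 i \<noteq> e' \<and> h1 i \<noteq> A) \<or> (h1 i = e \<and> h2 i = A)"
    and hj: "j \<noteq> k \<Longrightarrow> (h2 j = h1 j \<and> h1 j \<noteq> e \<and> h1 j \<noteq> e' \<and> h1 j \<noteq> A) \<or> (h1 j = e \<and> h2 j = A)"
  shows "mutate_matrix k B1 i j = B2 i j"
proof -
  have d: "distinct [s1, s2, e]" "distinct [s2, A, e']" "distinct [A, s1, e']"
    using dist by auto
  have ik: "B1 i k = of_bool (h1 i = s2) - of_bool (h1 i = s1)" for i
    by (simp add: B1 hk W cyc_sign_entry[OF d(1)])
  have kj: "B1 k j = of_bool (h1 j = s1) - of_bool (h1 j = s2)" for j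
    by (simp add: B1 hk W cyc_sign_entry[OF d(1)])
  have ik2: "B2 i k = of_bool (h2 i = s1) - of_bool (h2 i = s2)" for i
    by (simp add: B2 hk W cyc_sign_entry[OF d(2)] cyc_sign_entry[OF d(3)])
  have kj2: "B2 k j = of_bool (h2 j = s2) - of_bool (h2 j = s1)" for j
    by (simp add: B2 hk W cyc_sign_entry[OF d(2)] cyc_sign_entry[OF d(3)])
  show ?thesis
  proof (cases "i = k \<or> j = k")
    case True
    then show ?thesis
    proof (cases "j = k")
      case True
      then show ?thesis using hi dist by (cases "i = k") (auto simp: mutate_matrix_def ik ik2 hk)
    next
      case False
      then show ?thesis using True hj dist by (auto simp: mutate_matrix_def kj kj2)
    qed
  next
    case False
    define X where "X = h1 i" define Y where "Y = h1 j" define X' where "X' = h2 i" define Y' where "Y' = h2 j"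
    have hX: "(X' = X \<and> X \<noteq> e \<and> X \<noteq> e' \<and> X \<noteq> A) \<or> (X = e \<and> X' = A)"
      and hY: "(Y' = Y \<and> Y \<noteq> e \<and> Y \<noteq> e' \<and> Y \<noteq> A) \<or> (Y = e \<and> Y' = A)"
      using hi hj False by (auto simp: X_def Y_def X'_def Y'_def)
    have m: "mutate_matrix k B1 i j = W X Y + cyc_sign s1 s2 e X Y + sgn (of_bool (X = s2) - of_bool (X = s1)) *
         max 0 ((of_bool (X = s2) - of_bool (X = s1)) * (of_bool (Y = s1) - of_bool (Y = s2)))"
      using False unfolding mutate_matrix_def by (simp add: X_def Y_def B1 ik[unfolded B1] kj[unfolded B1])
    have b: "B2 i j = W X' Y' + cyc_sign s2 A e' X' Y' + cyc_sign A s1 e' X' Y'" by (simp add: B2 X'_def Y'_def)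
    from hX hY show ?thesis unfolding m b
    proof (elim disjE)
      assume h: "X' = X \<and> X \<noteq> e \<and> X \<noteq> e' \<and> X \<noteq> A" "Y' = Y \<and> Y \<noteq> e \<and> Y \<noteq> e' \<and> Y \<noteq> A"
      then show "W X Y + cyc_sign s1 s2 e X Y + sgn (of_bool (X = s2) - of_bool (X = s1)) *
         max 0 ((of_bool (X = s2) - of_bool (X = s1)) * (of_bool (Y = s1) - of_bool (Y = s2)))
         = W X' Y' + cyc_sign s2 A e' X' Y' + cyc_sign A s1 e' X' Y'" using dist
        by (cases "X = s1"; cases "X = s2"; cases "Y = s1"; cases "Y = s2") (simp_all add: cyc_sign_def)
    qed (use dist W in \<open>auto simp: cyc_sign_def\<close>)
  qed
qed

subsection \<open>Lambda lengths\<close>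

text \<open>The boundary point \<open>x\<close> of the universal cover is the vector \<open>(c x, c x * t x)\<close> of the plane, and the
  lambda length of an arc is the determinant of its end points. The deck transformation acts by the
  unipotent matrix that adds \<open>S * c x\<close> to the second coordinate; its fixed vector \<open>(0, 1)\<close> is the puncture, so
  that \<open>c x\<close> is the lambda length of the plain central arc at \<open>x\<close>. The lambda length of the loop at \<open>x\<close>
  is the product of those of the plain and the notched central arc, and equals \<open>S * c x * c x\<close>.\<close>

locale lambda_data =
  fixes N :: nat and c t :: "int \<Rightarrow> rat" and S :: rat
  assumes N3: "N \<ge> 3" and c_pos: "c x > 0" and c_per: "c (x + int N) = c x"
    and t_step: "t (x + 1) = t x + 1 / (c x * c (x + 1))" and t_per: "t (x + int N) = t x + S"
begin

definition lam :: "int \<Rightarrow> int \<Rightarrow> rat" where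
  "lam a b = c a * c b * (t b - t a)"

text \<open>\<open>Periph i i\<close> gets the value of the notched arc at \<open>i\<close>, into
  which \<open>tag\<close> turns it. As a side of a triangle, the loop has instead the lambda length
  \<open>lam i (i + int N)\<close>.\<close>

fun arc_val :: "arc \<Rightarrow> rat" where
  "arc_val (Periph i j) = (if i = j then S * c i else lam i (i + blen N i j))"
| "arc_val (Central i) = c i"

lemma c_shift [simp]: "c (x + k * int N) = c x"
proof (induction k rule: int_induct[of _ 0])
  case (step1 i)
  have "x + (i + 1) * int N = (x + i * int N) + int N" by (simp add: algebra_simps)
  then have "c (x + (i + 1) * int N) = c (x + i * int N)" using c_per by metis
  then show ?case using step1 by simp
next
  case (step2 i)
  have "x + i * int N = (x + (i - 1) * int N) + int N" by (simp add: algebra_simps)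
  then show ?case using step2 c_per by metis
qed simp

lemma t_shift: "t (x + k * int N) = t x + of_int k * S"
proof (induction k rule: int_induct[of _ 0])
  case (step1 i)
  have "x + (i + 1) * int N = (x + i * int N) + int N" by (simp add: algebra_simps)
  then have "t (x + (i + 1) * int N) = t (x + i * int N) + S" using t_per by metis
  then show ?case using step1 by (simp add: distrib_right)
next
  case (step2 i)
  have "x + i * int N = (x + (i - 1) * int N) + int N" by (simp add: algebra_simps)
  then have "t (x + i * int N) = t (x + (i - 1) * int N) + S" using t_per by metis
  then show ?case using step2 by (simp add: left_diff_distrib)
qed simp

lemma lam_shift [simp]: "lam (a + k * int N) (b + k * int N) = lam a b"
  by (simp add: lam_def t_shift)

lemma lam_unit [simp]: "lam a (a + 1) = 1"
  using c_pos[of a] c_pos[of "a + 1"] by (simp add: lam_def t_step)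

lemma t_less: "a < b \<Longrightarrow> t a < t b"
proof (induction b rule: int_gr_induct[of a])
  case base
  then show ?case using t_step[of a] c_pos[of a] c_pos[of "a + 1"] by simp
next
  case (step i)
  have "t i < t (i + 1)" using t_step[of i] c_pos[of i] c_pos[of "i + 1"] by simp
  then show ?case using step by simp
qed

lemma S_pos: "S > 0"
  using t_less[of 0 "int N"] t_per[of 0] N3 by simp

lemma lam_pos: "a < b \<Longrightarrow> lam a b > 0"
  using t_less[of a b] c_pos by (simp add: lam_def)

lemma lam_loop: "lam a (a + int N) = c a * (S * c a)"
  using t_per[of a] c_per[of a] by (simp add: lam_def)

text \<open>The Pluecker relation between the 2 by 2 determinants of four vectors.\<close>

lemma ptolemy: "lam a x * lam b y = lam a b * lam x y + lam b x * lam a y"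
  unfolding lam_def by (simp add: algebra_simps)

text \<open>The Pluecker relation again, with the fixed vector of the puncture as fourth
  vector.\<close>

lemma ptolemy_spoke: "lam a x * c b = lam a b * c x + lam b x * c a"
  unfolding lam_def by (simp add: algebra_simps)

lemma c_nrm [simp]: "c (nrm N a) = c a"
  by (metis nrm_obtain c_shift)

lemma arc_val_spoke [simp]: "arc_val (spoke N a) = c a"
  by simp

lemma nrm_neq: "a < b \<Longrightarrow> b < a + int N \<Longrightarrow> nrm N a \<noteq> nrm N b"
  using nrm_eq_window[of a a N b] N3 by auto

lemma arc_val_parc: assumes "a < b" "b < a + int N" shows "arc_val (parc N a b) = lam a b"
proof -
  obtain k where k: "nrm N a = a + k * int N" using nrm_obtain .
  have "nrm N a + blen N (nrm N a) (nrm N b) = b + k * int N"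
    using assms blen_lift[of a b N] blen_nrm[of N a b] k by linarith
  then have "lam (nrm N a) (nrm N a + blen N (nrm N a) (nrm N b)) = lam a b" using lam_shift[of a k b] k by metis
  then show ?thesis using nrm_neq[OF assms] by simp
qed

lemma arc_val_loop: "arc_val (parc N a (a + int N)) = S * c a"
  using nrm_shift[of N a 1] by simp

lemma arc_val_pos: assumes "D \<in> plain_arcs N" shows "arc_val D > 0"
proof (rule plain_arc_cases[OF N3 assms])
  fix a b assume D: "D = parc N a b" "a + 2 \<le> b" "b \<le> a + int N"
  show ?thesis
  proof (cases "b = a + int N")
    case True
    then show ?thesis using D arc_val_loop S_pos c_pos by simp
  next
    case False
    then show ?thesis using D arc_val_parc[of a b] lam_pos[of a b] by simp
  qed
qed (use c_pos in simp)

end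

lemma finite_plain_arcs: "finite (plain_arcs N)"
proof -
  have "plain_arcs N \<subseteq> (\<lambda>(i, j). Periph i j) ` ({1..int N} \<times> {1..int N}) \<union> Central ` {1..int N}"
    by (auto simp: plain_arcs_def)
  then show ?thesis by (rule finite_subset) auto
qed

subsection \<open>Exchange relations\<close>

context lambda_data begin

text \<open>In an exchange relation a side enters through every arc of \<open>T\<close> that unfolds
  to it: none for a boundary segment, whose lambda length is 1, and both the plain and the notched
  arc for a loop, whose product is the lambda length of the loop.\<close>

definition side_val :: "arc set \<Rightarrow> arc \<Rightarrow> rat" where
  "side_val T s = (\<Prod>D\<in>T. if unfold_arc T D = s then arc_val D else 1)"

lemma unfold_arc_in: "D \<in> T \<Longrightarrow> unfold_arc T D \<in> T"
  by (cases D) auto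

lemma side_val_side:
  assumes "triang N T" "lifted_side N T x y"
  shows "side_val T (parc N x y) = lam x y"
proof -
  interpret triang N T by (rule assms(1))
  have fin: "finite T" using T_plain finite_plain_arcs finite_subset by blast
  show ?thesis
  proof (cases "y = x + 1")
    case True
    have "parc N x y \<notin> plain_arcs N"
      using nrm_suc_iff[OF N3, of x y] N3 True by (auto simp: plain_arcs_def)
    then have "unfold_arc T D \<noteq> parc N x y" if "D \<in> T" for D
      using unfold_arc_in[OF that] T_plain by auto
    then show ?thesis unfolding side_val_def using True by (simp cong: prod.cong)
  next
    case F: False
    then have L: "plift N T x y" using assms(2) by (simp add: lifted_side_plift)
    then have pT: "parc N x y \<in> T" and xy: "x + 2 \<le> y" "y \<le> x + int N" by (auto simp: plift_def)
    show ?thesis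
    proof (cases "y = x + int N")
      case False
      then have n: "nrm N x \<noteq> nrm N y" using xy nrm_neq[of x y] by simp
      have "unfold_arc T D = parc N x y \<longleftrightarrow> D = parc N x y" for D
        using n by (cases D) auto
      then have "side_val T (parc N x y) = arc_val (parc N x y)"
        unfolding side_val_def using fin pT by (simp del: arc_val.simps)
      then show ?thesis using arc_val_parc[of x y] xy False by simp
    next
      case True
      let ?p = "Periph (nrm N x) (nrm N x)"
      have p: "parc N x y = ?p" using True nrm_shift[of N x 1] by simp
      have C: "Central (nrm N x) \<in> T" using loop_C[of x] L True by (simp add: lifted_spoke_def)
      have "unfold_arc T D = ?p \<longleftrightarrow> D = ?p \<or> D = Central (nrm N x)" for D
        using pT[unfolded p] by (cases D) auto
      then have "side_val T ?p = (\<Prod>D\<in>T. if D = ?p \<or> D = Central (nrm N x) then arc_val D else 1)"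
        unfolding side_val_def by (simp del: arc_val.simps)
      also have "\<dots> = (\<Prod>D\<in>{?p, Central (nrm N x)}. arc_val D)"
        using fin pT[unfolded p] C by (intro prod.mono_neutral_cong_right) auto
      also have "\<dots> = c x * (S * c x)" by simp
      finally show ?thesis using p True lam_loop by simp
    qed
  qed
qed

lemma side_val_spoke:
  assumes "triang N T" "lifted_spoke N T x" "\<And>i. Periph i i \<notin> T"
  shows "side_val T (spoke N x) = c x"
proof -
  interpret triang N T by (rule assms(1))
  have fin: "finite T" using T_plain finite_plain_arcs finite_subset by blast
  have "unfold_arc T D = D" for D using assms(3) by (cases D) auto
  then have "side_val T (spoke N x) = arc_val (spoke N x)"
    unfolding side_val_def using fin assms(2) by (simp add: lifted_spoke_def del: arc_val.simps)
  then show ?thesis by simp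
qed

lemma side_val_reindex:
  assumes "bij_betw m {..<N} T"
  shows "(\<Prod>i<N. if unfold_arc T (m i) = s then arc_val (m i) else 1) = side_val T s"
  unfolding side_val_def by (rule prod.reindex_bij_betw[OF assms])

text \<open>The two facts by which the values of arcs survive a mutation. They are required for
  every numbering of the arcs, since the numbering in a seed is arbitrary.\<close>

definition good_flip :: "arc set \<Rightarrow> arc set \<Rightarrow> arc \<Rightarrow> arc \<Rightarrow> bool" where
  "good_flip T1 T2 e e' \<longleftrightarrow> (\<forall>m k. bij_betw m {..<N} T1 \<longrightarrow> k < N \<longrightarrow> m k = e \<longrightarrow>
     (\<forall>i<N. \<forall>j<N. mutate_matrix k (\<lambda>i j. signed_adj N T1 (m i) (m j)) i j
         = signed_adj N T2 ((m(k := e')) i) ((m(k := e')) j)) \<and>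
     arc_val e * arc_val e' = (\<Prod>i<N. arc_val (m i) ^ nat (signed_adj N T1 (m i) e)) +
       (\<Prod>i<N. arc_val (m i) ^ nat (- signed_adj N T1 (m i) e)))"

lemma flip_bij:
  assumes "flip N T1 T2 e e'" "bij_betw m {..<N} T1" "k < N" "m k = e"
  shows "bij_betw (m(k := e')) {..<N} T2"
proof -
  interpret flip N T1 T2 e e' by fact
  have inj: "inj_on m {..<N}" and im: "m ` {..<N} = T1" using assms(2) by (auto simp: bij_betw_def)
  have "inj_on (m(k := e')) {..<N}"
    using inj im e'_notin by (intro inj_on_fun_updI) auto
  moreover have "(m(k := e')) ` {..<N} = T2"
  proof -
    have "m ` ({..<N} - {k}) = T1 - {e}"
      using inj im assms(3,4) by (metis Diff_subset image_empty image_insert inj_on_image_set_diff insert_subset lessThan_iff empty_subsetI)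
    moreover have "(m(k := e')) ` {..<N} = insert e' (m ` ({..<N} - {k}))"
      using assms(3) by auto
    ultimately show ?thesis using rest e2 by auto
  qed
  ultimately show ?thesis by (simp add: bij_betw_def)
qed

lemma signed_adj_self: "signed_adj N T D D = 0"
  by (simp add: signed_adj_def)

text \<open>Mutation is an involution and negates column \<open>k\<close>, which only exchanges the
  two products of the exchange relation. So each type of flip has to be treated in one direction
  only.\<close>

lemma good_flip_sym:
  assumes fl: "flip N T1 T2 e e'" and gf: "good_flip T2 T1 e' e"
  shows "good_flip T1 T2 e e'"
  unfolding good_flip_def
proof (intro allI impI)
  fix m k assume m: "bij_betw m {..<N} T1" "k < N" "m k = e"
  define m' where "m' = m(k := e')"
  have m': "bij_betw m' {..<N} T2" "m' k = e'" using flip_bij[OF fl m] by (simp_all add: m'_def)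
  have mm: "m'(k := e) = m" using m(3) by (auto simp: m'_def)
  define B1 where "B1 = (\<lambda>i j. signed_adj N T1 (m i) (m j))"
  define B2 where "B2 = (\<lambda>i j. signed_adj N T2 (m' i) (m' j))"
  have A: "\<forall>i<N. \<forall>j<N. mutate_matrix k B2 i j = B1 i j"
    and P: "arc_val e' * arc_val e = (\<Prod>i<N. arc_val (m' i) ^ nat (B2 i k)) + (\<Prod>i<N. arc_val (m' i) ^ nat (- B2 i k))"
    using gf[unfolded good_flip_def, rule_format, OF m'(1) m(2) m'(2)] m'(2) unfolding B1_def B2_def mm by auto
  have "mutate_matrix k B1 i j = B2 i j" if "i < N" "j < N" for i j
  proof -
    have "mutate_matrix k B1 i j = mutate_matrix k (mutate_matrix k B2) i j"
      using A that m(2) by (simp add: mutate_matrix_def[of k B1] mutate_matrix_def[of k "mutate_matrix k B2"])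
    then show ?thesis by (simp add: mutate_matrix_involution)
  qed
  moreover have ik: "B1 i k = - B2 i k" if "i < N" for i
    using A that m(2) by (metis mutate_matrix_def)
  have kk: "B1 k k = 0" "B2 k k = 0" by (simp_all add: B1_def B2_def signed_adj_self)
  have e1: "(\<Prod>i<N. arc_val (m i) ^ nat (B1 i k)) = (\<Prod>i<N. arc_val (m' i) ^ nat (- B2 i k))"
    by (rule prod.cong) (auto simp: ik kk m'_def)
  have e2: "(\<Prod>i<N. arc_val (m i) ^ nat (- B1 i k)) = (\<Prod>i<N. arc_val (m' i) ^ nat (B2 i k))"
    by (rule prod.cong) (auto simp: ik kk m'_def)
  have "arc_val e * arc_val e' = (\<Prod>i<N. arc_val (m i) ^ nat (B1 i k)) + (\<Prod>i<N. arc_val (m i) ^ nat (- B1 i k))"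
    unfolding e1 e2 using P by (simp add: mult.commute)
  ultimately show "(\<forall>i<N. \<forall>j<N. mutate_matrix k (\<lambda>i j. signed_adj N T1 (m i) (m j)) i j
         = signed_adj N T2 ((m(k := e')) i) ((m(k := e')) j)) \<and>
     arc_val e * arc_val e' = (\<Prod>i<N. arc_val (m i) ^ nat (signed_adj N T1 (m i) e)) +
       (\<Prod>i<N. arc_val (m i) ^ nat (- signed_adj N T1 (m i) e))"
    unfolding B1_def B2_def m'_def[symmetric] using m(3) by simp
qed

text \<open>As the four sides differ, all exponents are 0 or 1 and the products over indices regroup
  by side.\<close>

lemma quad_product:
  assumes m: "bij_betw m {..<N} T" and d: "distinct [s1, s2, s3, s4]"
    and B: "\<And>i. i < N \<Longrightarrow> b i = of_bool (unfold_arc T (m i) = s2) - of_bool (unfold_arc T (m i) = s1)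
       + of_bool (unfold_arc T (m i) = s4) - (of_bool (unfold_arc T (m i) = s3) :: int)"
  shows "(\<Prod>i<N. arc_val (m i) ^ nat (b i)) = side_val T s2 * side_val T s4"
    "(\<Prod>i<N. arc_val (m i) ^ nat (- b i)) = side_val T s1 * side_val T s3"
  unfolding side_val_reindex[OF m, symmetric] prod.distrib[symmetric]
  by (rule prod.cong; use d B in auto)+

lemma digon_product:
  assumes m: "bij_betw m {..<N} T" and d: "s1 \<noteq> s2"
    and B: "\<And>i. i < N \<Longrightarrow> b i = of_bool (unfold_arc T (m i) = s2) - (of_bool (unfold_arc T (m i) = s1) :: int)"
  shows "(\<Prod>i<N. arc_val (m i) ^ nat (b i)) = side_val T s2"
    "(\<Prod>i<N. arc_val (m i) ^ nat (- b i)) = side_val T s1"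
  unfolding side_val_reindex[OF m, symmetric]
  by (rule prod.cong; use d B in auto)+

text \<open>Covers an inner quadrilateral as well as one with a vertex at the puncture. The
  assumptions on \<open>unfold_arc\<close> express that the flip does not change how arcs unfold, as
  is the case when neither diagonal is a loop.\<close>

lemma good_flip_quad_general:
  assumes fl: "flip N T1 T2 e e'" and dist: "distinct [s1, s2, s3, s4, e, e']"
    and T1: "\<And>D E. tri_sum N T1 D E = tri_sum N (T1 - {e}) D E + cyc_sign s1 s2 e D E + cyc_sign s3 s4 e D E"
    and T2: "\<And>D E. tri_sum N T2 D E = tri_sum N (T1 - {e}) D E + cyc_sign s2 s3 e' D E + cyc_sign s4 s1 e' D E"
    and u: "\<And>D. unfold_arc T1 D = unfold_arc T2 D"
    and ue: "\<And>D. unfold_arc T1 D = e \<longleftrightarrow> D = e" "unfold_arc T2 e' = e'"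
    and ex: "arc_val e * arc_val e' = side_val T1 s1 * side_val T1 s3 + side_val T1 s2 * side_val T1 s4"
  shows "good_flip T1 T2 e e'"
  unfolding good_flip_def
proof (intro allI impI conjI)
  interpret flip N T1 T2 e e' by fact
  fix m k assume m: "bij_betw m {..<N} T1" "k < N" "m k = e"
  have p: "e \<in> plain_arcs N" "e' \<in> plain_arcs N" using e1 e2 t1.T_plain t2.T_plain by auto
  have W: "tri_sum N T0 e D = 0 \<and> tri_sum N T0 D e = 0 \<and> tri_sum N T0 e' D = 0 \<and> tri_sum N T0 D e' = 0" for D
    using tri_sum_0[OF N3 p(1), of T0 D] tri_sum_0[OF N3 p(2), of T0 D] e'_notin by auto
  have h: "unfold_arc T2 ((m(k := e')) i) = unfold_arc T1 (m i) \<and> unfold_arc T1 (m i) \<noteq> e \<and> unfold_arc T1 (m i) \<noteq> e'"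
    if "i < N" "i \<noteq> k" for i
  proof -
    have "m i \<in> T1" "m i \<noteq> e" using m that by (auto simp: bij_betw_def inj_on_def)
    then show ?thesis using u ue that unfold_arc_in[of "m i" T1] e'_notin by auto
  qed
  {
    fix i j assume ij: "i < N" "j < N"
    show "mutate_matrix k (\<lambda>i j. signed_adj N T1 (m i) (m j)) i j = signed_adj N T2 ((m(k := e')) i) ((m(k := e')) j)"
      by (rule quad_mutation[OF dist, where W = "tri_sum N T0" and ?h1.0 = "\<lambda>i. unfold_arc T1 (m i)"
           and ?h2.0 = "\<lambda>i. unfold_arc T2 ((m(k := e')) i)"
           and ?B2.0 = "\<lambda>i j. signed_adj N T2 ((m(k := e')) i) ((m(k := e')) j)"])
        (use W h ij m ue in \<open>simp_all add: signed_adj_tri_sum T1 T2\<close>)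
  }
  have d: "distinct [s1, s2, e]" "distinct [s3, s4, e]" "distinct [s1, s2, s3, s4]" using dist by auto
  have b: "signed_adj N T1 (m i) e = of_bool (unfold_arc T1 (m i) = s2) - of_bool (unfold_arc T1 (m i) = s1)
       + of_bool (unfold_arc T1 (m i) = s4) - of_bool (unfold_arc T1 (m i) = s3)" for i
    using ue(1)[of e] by (simp add: signed_adj_tri_sum T1 W cyc_sign_entry[OF d(1)] cyc_sign_entry[OF d(2)])
  show "arc_val e * arc_val e' = (\<Prod>i<N. arc_val (m i) ^ nat (signed_adj N T1 (m i) e)) +
       (\<Prod>i<N. arc_val (m i) ^ nat (- signed_adj N T1 (m i) e))"
    unfolding quad_product[OF m(1) d(3), of "\<lambda>i. signed_adj N T1 (m i) e", OF b] ex by simp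
qed

lemma good_flip_quad:
  assumes fl: "flip N T1 T2 e e'" and Q: "quad_flip N (T1 - {e}) e e' a b x y"
    and len: "x < a + int N" "y < b + int N"
  shows "good_flip T1 T2 e e'"
proof -
  interpret flip N T1 T2 e e' by fact
  from Q have o: "a < b" "b < x" "x < y" "y \<le> a + int N" and e: "e = parc N a x" and e': "e' = parc N b y"
    and s0: "lifted_side N T0 a b" "lifted_side N T0 b x" "lifted_side N T0 x y" "lifted_side N T0 a y"
    by (auto simp: quad_flip_def)
  have m1: "lifted_side N T1 u v" if "lifted_side N T0 u v" for u v
    using that unfolding lifted_side_def by blast
  note s1 = s0[THEN m1]
  have n: "nrm N a \<noteq> nrm N x" "nrm N b \<noteq> nrm N y" using nrm_neq o len by auto
  have "Periph i i \<in> T1 \<longleftrightarrow> Periph i i \<in> T2" for i using rest n e e' by auto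
  then have u: "unfold_arc T1 D = unfold_arc T2 D" for D by (cases D) auto
  have ue: "unfold_arc T1 D = e \<longleftrightarrow> D = e" for D using n e by (cases D) auto
  have ue': "unfold_arc T2 e' = e'" using e' by simp
  note pe = parc_eq_window[of a _ N]
  have d: "distinct [parc N a b, parc N b x, parc N x y, parc N a y, e, e']"
    unfolding e e' using o len by (simp add: pe del: arc.inject)
  have v: "arc_val e = lam a x" "arc_val e' = lam b y"
    unfolding e e' using o len by (simp_all only: arc_val_parc)
  have "arc_val e * arc_val e' = side_val T1 (parc N a b) * side_val T1 (parc N x y)
     + side_val T1 (parc N b x) * side_val T1 (parc N a y)"
    unfolding s1[THEN side_val_side[OF t1.triang_axioms]] v by (rule ptolemy)
  then show ?thesis
    using good_flip_quad_general[OF fl d quad_tri_sum(1)[OF Q] quad_tri_sum(2)[OF Q] u ue ue'] by blast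
qed

lemma good_flip_spoke:
  assumes fl: "flip N T1 T2 e e'" and Q: "spoke_flip N (T1 - {e}) e e' a b x"
    and len: "x < a + int N"
  shows "good_flip T1 T2 e e'"
proof -
  interpret flip N T1 T2 e e' by fact
  from Q have o: "a < b" "b < x" "x \<le> a + int N" and e: "e = parc N a x" and e': "e' = spoke N b"
    and s0: "lifted_side N T0 a b" "lifted_side N T0 b x" and C0: "lifted_spoke N T0 a" "lifted_spoke N T0 x"
    by (auto simp: spoke_flip_def)
  have m1: "lifted_side N T1 u v" if "lifted_side N T0 u v" for u v
    using that unfolding lifted_side_def by blast
  have c1: "lifted_spoke N T1 u" and c2: "lifted_spoke N T2 u" if "lifted_spoke N T0 u" for u
    using that rest unfolding lifted_spoke_def by blast+
  note s1 = s0[THEN m1] and C1 = C0[THEN c1] and C2 = C0[THEN c2]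
  have n: "nrm N a \<noteq> nrm N x" using nrm_neq o len by auto
  \<comment> \<open>A loop would leave a single central arc, but those at \<open>a\<close> and
    \<open>x\<close> are different.\<close>
  have nl1: "Periph i i \<notin> T1" for i
    using t1.loop_T[of i] t1.loop_C_only[of i a] t1.loop_C_only[of i x] C1 n by auto
  have nl2: "Periph i i \<notin> T2" for i
    using t2.loop_T[of i] t2.loop_C_only[of i a] t2.loop_C_only[of i x] C2 n by auto
  have u1: "unfold_arc T1 D = D" for D using nl1 by (cases D) auto
  have u2: "unfold_arc T2 D = D" for D using nl2 by (cases D) auto
  note pe = parc_eq_window[of a _ N] and nw = nrm_eq_window[of a _ N]
  have d: "distinct [parc N a b, parc N b x, spoke N x, spoke N a, e, e']"
    unfolding e e' using o len by (simp add: pe nw del: arc.inject(1))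
  have v: "arc_val e = lam a x" "arc_val e' = c b"
    unfolding e e' using o len arc_val_parc[of a x] by simp_all
  have "arc_val e * arc_val e' = side_val T1 (parc N a b) * side_val T1 (spoke N x)
     + side_val T1 (parc N b x) * side_val T1 (spoke N a)"
    unfolding s1[THEN side_val_side[OF t1.triang_axioms]] C1[THEN side_val_spoke[OF t1.triang_axioms _ nl1]]
    unfolding v by (rule ptolemy_spoke)
  then show ?thesis
    using good_flip_quad_general[OF fl d, OF spoke_tri_sum(1)[OF Q, THEN trans] spoke_tri_sum(2)[OF Q]] u1 u2 len
    by simp
qed

lemma good_flip_digon:
  assumes fl: "flip N T1 T2 e e'" and Q: "spoke_flip N (T1 - {e}) e e' a b (a + int N)"
  shows "good_flip T1 T2 e e'"
  unfolding good_flip_def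
proof (intro allI impI conjI)
  interpret flip N T1 T2 e e' by fact
  let ?A = "spoke N a"
  from Q have o: "a < b" "b < a + int N" and e: "e = parc N a (a + int N)" and e': "e' = spoke N b"
    and s0: "lifted_side N T0 a b" "lifted_side N T0 b (a + int N)" and C0: "lifted_spoke N T0 a"
    by (auto simp: spoke_flip_def)
  have nN: "nrm N (a + int N) = nrm N a" using nrm_shift[of N a 1] by simp
  have ep: "e = Periph (nrm N a) (nrm N a)" using e nN by simp
  have m1: "lifted_side N T1 u v" if "lifted_side N T0 u v" for u v
    using that unfolding lifted_side_def by blast
  note s1 = s0[THEN m1]
  have C2: "lifted_spoke N T2 a" "lifted_spoke N T2 b"
    using C0 e2 e' rest unfolding lifted_spoke_def by blast+
  have n: "nrm N a \<noteq> nrm N b" using nrm_neq o by auto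
  have nl2: "Periph i i \<notin> T2" for i
    using t2.loop_T[of i] t2.loop_C_only[of i a] t2.loop_C_only[of i b] C2 n by auto
  have u2: "unfold_arc T2 D = D" for D using nl2 by (cases D) auto
  have La: "plift N T1 a (a + int N)" using e1 e N3 by (simp add: plift_def)
  have Conly: "nrm N z = nrm N a" if "lifted_spoke N T1 z" for z using t1.loop_C_only[OF La that] .
  have p: "e \<in> plain_arcs N" "e' \<in> plain_arcs N" using e1 e2 t1.T_plain t2.T_plain by auto
  \<comment> \<open>The central arc at \<open>a\<close> could only be a side of the self-folded
    triangle, whose loop has been removed from \<open>T0\<close>.\<close>
  have WA: "tri_weight N \<Delta> ?A D = 0 \<and> tri_weight N \<Delta> D ?A = 0" if "\<Delta> \<in> triangles N T0" for \<Delta> D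
  proof (cases \<Delta>)
    case (Tri u v w)
    then show ?thesis by (simp add: tri_weight_Tri cyc_sign_def)
  next
    case (CTri u v)
    then have uv: "u < v" "lifted_side N T0 u v" "lifted_spoke N T0 u" "lifted_spoke N T0 v"
      using that by (auto simp: triangles_def CTri_lifted)
    then have "nrm N u = nrm N a" "nrm N v = nrm N a" using Conly by (auto simp: lifted_spoke_def)
    moreover have "v \<le> u + int N" using t1.side_len[OF m1[OF uv(2)]] by simp
    ultimately have "v = u + int N" using nrm_neq[of u v] uv(1) by force
    then have "parc N u v \<in> T0" using uv(2) N3 by (simp add: lifted_side_def)
    then show ?thesis using ep \<open>nrm N u = nrm N a\<close> \<open>nrm N v = nrm N a\<close> by simp
  qed
  then have WA': "tri_sum N T0 ?A D = 0" "tri_sum N T0 D ?A = 0" for D by (simp_all add: tri_sum_def)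
  have W: "tri_sum N T0 e D = 0 \<and> tri_sum N T0 D e = 0 \<and> tri_sum N T0 e' D = 0 \<and> tri_sum N T0 D e' = 0
     \<and> tri_sum N T0 ?A D = 0 \<and> tri_sum N T0 D ?A = 0" for D
    using tri_sum_0[OF N3 p(1), of T0 D] tri_sum_0[OF N3 p(2), of T0 D] e'_notin WA' by auto
  note pe = parc_eq_window[of a _ N]
  have d: "distinct [parc N a b, parc N b (a + int N), ?A, e, e']"
    unfolding e e' using o n by (simp add: pe del: arc.inject(1))
  have ue: "unfold_arc T1 e = e" using ep by simp
  fix m k assume m: "bij_betw m {..<N} T1" "k < N" "m k = e"
  have h: "(unfold_arc T2 ((m(k := e')) i) = unfold_arc T1 (m i) \<and> unfold_arc T1 (m i) \<noteq> e \<and> unfold_arc T1 (m i) \<noteq> e' \<and> unfold_arc T1 (m i) \<noteq> ?A)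
     \<or> unfold_arc T1 (m i) = e \<and> unfold_arc T2 ((m(k := e')) i) = ?A"
    if i: "i < N" "i \<noteq> k" for i
  proof -
    have mi: "m i \<in> T1" "m i \<noteq> e" using m i by (auto simp: bij_betw_def inj_on_def)
    show ?thesis
    proof (cases "m i")
      case (Central z)
      then have "z = nrm N a" using t1.Central_T[of z] Conly[of z] mi by simp
      then show ?thesis using Central i e1 ep unfolding u2 by simp
    next
      case (Periph z w)
      then show ?thesis using i mi e' u2 by simp
    qed
  qed
  {
    fix i j assume ij: "i < N" "j < N"
    show "mutate_matrix k (\<lambda>i j. signed_adj N T1 (m i) (m j)) i j = signed_adj N T2 ((m(k := e')) i) ((m(k := e')) j)"
      by (rule digon_mutation[OF d, where W = "tri_sum N T0" and ?h1.0 = "\<lambda>i. unfold_arc T1 (m i)"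
           and ?h2.0 = "\<lambda>i. unfold_arc T2 ((m(k := e')) i)"
           and ?B2.0 = "\<lambda>i j. signed_adj N T2 ((m(k := e')) i) ((m(k := e')) j)"])
        (use W h ij m ue u2 nN in \<open>simp_all add: signed_adj_tri_sum spoke_tri_sum[OF Q]\<close>)
  }
  have d3: "distinct [parc N a b, parc N b (a + int N), e]" using d by simp
  have d2: "parc N a b \<noteq> parc N b (a + int N)" using d by auto
  have b: "signed_adj N T1 (m i) e = of_bool (unfold_arc T1 (m i) = parc N b (a + int N)) - of_bool (unfold_arc T1 (m i) = parc N a b)" for i
    using ue by (simp add: signed_adj_tri_sum spoke_tri_sum(1)[OF Q] W cyc_sign_entry[OF d3])
  \<comment> \<open>This is \<open>ptolemy_spoke\<close> for \<open>a\<close>, \<open>b\<close>,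
    \<open>a + int N\<close> divided by \<open>c a\<close>, because the value of \<open>e\<close> is
    that of the notched arc and not that of the loop.\<close>
  have "arc_val e * arc_val e' = S * c a * c b" using arc_val_loop e e' by simp
  also have "\<dots> = lam b (a + int N) + lam a b"
    using c_per[of a] t_per[of a] by (simp add: lam_def algebra_simps)
  finally show "arc_val e * arc_val e' = (\<Prod>i<N. arc_val (m i) ^ nat (signed_adj N T1 (m i) e)) +
       (\<Prod>i<N. arc_val (m i) ^ nat (- signed_adj N T1 (m i) e))"
    unfolding digon_product[OF m(1) d2, of "\<lambda>i. signed_adj N T1 (m i) e", OF b]
      s1[THEN side_val_side[OF t1.triang_axioms]] .
qed

theorem good_flip_all:
  assumes fl: "flip N T1 T2 e e'" shows "good_flip T1 T2 e e'"
proof -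
  interpret flip N T1 T2 e e' by fact
  have sp: "good_flip U1 U2 u u'" if "flip N U1 U2 u u'" "spoke_flip N (U1 - {u}) u u' a b x" for U1 U2 u u' a b x
  proof (cases "x = a + int N")
    case True
    then show ?thesis using good_flip_digon that by blast
  next
    case False
    then have "x < a + int N" using that(2) by (simp add: spoke_flip_def)
    then show ?thesis using good_flip_spoke that by blast
  qed
  show ?thesis
  proof (rule flip_cases)
    fix a b x y assume "quad_flip N T0 e e' a b x y" "x < a + int N" "y < b + int N"
    then show ?thesis using good_flip_quad[OF fl] by blast
  next
    fix a b x y assume "quad_flip N T0 e' e a b x y" "x < a + int N" "y < b + int N"
    then show ?thesis using good_flip_quad[OF flip_sym] good_flip_sym[OF fl] rest by simp
  next
    fix a b x assume "spoke_flip N T0 e e' a b x"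
    then show ?thesis using sp[OF fl] by blast
  next
    fix a b x assume "spoke_flip N T0 e' e a b x"
    then show ?thesis using sp[OF flip_sym] good_flip_sym[OF fl] rest by simp
  qed
qed

end

subsection \<open>Evaluation at ones\<close>

lemma poly_at_ones_superset:
  assumes "finite A" "Poly_Mapping.keys p \<subseteq> A"
  shows "poly_at_ones p = (\<Sum>m\<in>A. Poly_Mapping.lookup p m)"
  unfolding poly_at_ones_def using assms by (intro sum.mono_neutral_left) (auto simp: in_keys_iff)

lemma poly_at_ones_add: "poly_at_ones (p + q) = poly_at_ones p + poly_at_ones q"
proof -
  let ?A = "Poly_Mapping.keys p \<union> Poly_Mapping.keys q"
  have "poly_at_ones (p + q) = (\<Sum>m\<in>?A. Poly_Mapping.lookup (p + q) m)"
    using Poly_Mapping.keys_add[of p q] by (intro poly_at_ones_superset) auto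
  also have "\<dots> = poly_at_ones p + poly_at_ones q"
    by (simp add: lookup_add sum.distrib poly_at_ones_superset[of ?A])
  finally show ?thesis .
qed

lemma poly_at_ones_single: "poly_at_ones (Poly_Mapping.single m a) = a"
  by (simp add: poly_at_ones_def)

lemma poly_at_ones_0 [simp]: "poly_at_ones 0 = 0"
  by (simp add: poly_at_ones_def)

lemma poly_at_ones_1 [simp]: "poly_at_ones 1 = 1"
  using poly_at_ones_single[of 0 1] by simp

lemma poly_mapping_add_induct:
  assumes "P 0" "\<And>p m a. P p \<Longrightarrow> P (p + Poly_Mapping.single m a)"
  shows "P (p :: 'a \<Rightarrow>\<^sub>0 'b :: monoid_add)"
proof (induction p rule: update_induct)
  case const
  then show ?case by (rule assms(1))
next
  case (update f a b)
  have "Poly_Mapping.update a b f = f + Poly_Mapping.single a b"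
    using update by (intro poly_mapping_eqI) (auto simp: lookup_update lookup_add lookup_single in_keys_iff)
  then show ?case using assms(2) update by metis
qed

lemma poly_at_ones_mult_single:
  "poly_at_ones (p * Poly_Mapping.single m a) = poly_at_ones p * a"
  by (induction p rule: poly_mapping_add_induct)
    (simp_all add: poly_at_ones_add poly_at_ones_single distrib_right mult_single)

text \<open>Evaluation at ones is a ring homomorphism; so the value of a fraction can be read off
  from any representation whose denominator does not vanish there.\<close>

lemma poly_at_ones_mult: "poly_at_ones (p * q) = poly_at_ones p * poly_at_ones q"
  by (induction q rule: poly_mapping_add_induct)
    (simp_all add: poly_at_ones_add poly_at_ones_single distrib_left poly_at_ones_mult_single)

lemma value_at_ones_unique: "value_at_ones z u \<Longrightarrow> value_at_ones z v \<Longrightarrow> u = v"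
proof -
  assume "value_at_ones z u" "value_at_ones z v"
  then obtain p q p' q' where z: "z = Fraction_Field.Fract p q" "poly_at_ones q \<noteq> 0" "u = poly_at_ones p / poly_at_ones q"
    "z = Fraction_Field.Fract p' q'" "poly_at_ones q' \<noteq> 0" "v = poly_at_ones p' / poly_at_ones q'"
    unfolding value_at_ones_def by blast
  then have "p * q' = p' * q" using eq_fract(1)[of q q' p p'] by force
  then have "poly_at_ones p * poly_at_ones q' = poly_at_ones p' * poly_at_ones q"
    by (metis poly_at_ones_mult)
  then show "u = v" using z by (simp add: frac_eq_eq)
qed

lemma value_at_ones_1: "value_at_ones 1 1"
  unfolding value_at_ones_def by (rule exI[of _ 1], rule exI[of _ 1]) (simp add: One_fract_def)

lemma value_at_ones_indet: "value_at_ones (indet i) 1"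
  unfolding value_at_ones_def indet_def
  by (rule exI[of _ "Poly_Mapping.single (Poly_Mapping.single i 1) 1"], rule exI[of _ 1])
    (simp add: poly_at_ones_single)

lemma value_at_ones_add: assumes "value_at_ones z u" "value_at_ones w v" shows "value_at_ones (z + w) (u + v)"
proof -
  obtain p q p' q' where z: "z = Fraction_Field.Fract p q" "poly_at_ones q \<noteq> 0" "u = poly_at_ones p / poly_at_ones q"
    "w = Fraction_Field.Fract p' q'" "poly_at_ones q' \<noteq> 0" "v = poly_at_ones p' / poly_at_ones q'"
    using assms unfolding value_at_ones_def by blast
  then have "q \<noteq> 0" "q' \<noteq> 0" by auto
  then have "z + w = Fraction_Field.Fract (p * q' + p' * q) (q * q')" using z by simp
  moreover have "u + v = poly_at_ones (p * q' + p' * q) / poly_at_ones (q * q')"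
    using z by (simp add: poly_at_ones_mult poly_at_ones_add add_frac_eq)
  ultimately show ?thesis unfolding value_at_ones_def using z by (metis poly_at_ones_mult mult_eq_0_iff)
qed

lemma value_at_ones_mult: assumes "value_at_ones z u" "value_at_ones w v" shows "value_at_ones (z * w) (u * v)"
proof -
  obtain p q p' q' where z: "z = Fraction_Field.Fract p q" "poly_at_ones q \<noteq> 0" "u = poly_at_ones p / poly_at_ones q"
    "w = Fraction_Field.Fract p' q'" "poly_at_ones q' \<noteq> 0" "v = poly_at_ones p' / poly_at_ones q'"
    using assms unfolding value_at_ones_def by blast
  then have "z * w = Fraction_Field.Fract (p * p') (q * q')" by simp
  moreover have "u * v = poly_at_ones (p * p') / poly_at_ones (q * q')"
    using z by (simp add: poly_at_ones_mult)
  ultimately show ?thesis unfolding value_at_ones_def using z by (metis poly_at_ones_mult mult_eq_0_iff)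
qed

lemma value_at_ones_divide:
  assumes "value_at_ones z u" "value_at_ones w v" "v \<noteq> 0" shows "value_at_ones (z / w) (u / v)"
proof -
  obtain p q p' q' where z: "z = Fraction_Field.Fract p q" "poly_at_ones q \<noteq> 0" "u = poly_at_ones p / poly_at_ones q"
    "w = Fraction_Field.Fract p' q'" "poly_at_ones q' \<noteq> 0" "v = poly_at_ones p' / poly_at_ones q'"
    using assms unfolding value_at_ones_def by blast
  then have "z / w = Fraction_Field.Fract (p * q') (q * p')" by simp
  moreover have "u / v = poly_at_ones (p * q') / poly_at_ones (q * p')"
    using z by (simp add: poly_at_ones_mult)
  moreover have "poly_at_ones (q * p') \<noteq> 0" using z assms(3) by (auto simp: poly_at_ones_mult)
  ultimately show ?thesis unfolding value_at_ones_def by blast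
qed

lemma value_at_ones_power: "value_at_ones z u \<Longrightarrow> value_at_ones (z ^ n) (u ^ n)"
  by (induction n) (auto simp: value_at_ones_1 value_at_ones_mult)

lemma value_at_ones_prod:
  assumes "\<And>i. i \<in> A \<Longrightarrow> value_at_ones (f i) (g i)"
  shows "value_at_ones (\<Prod>i\<in>A. f i) (\<Prod>i\<in>A. g i)"
  using assms by (induction A rule: infinite_finite_induct) (auto simp: value_at_ones_1 value_at_ones_mult)

subsection \<open>Signed adjacency matrices of tagged triangulations\<close>

context triang begin

lemma loop_unique: "Periph i i \<in> T \<Longrightarrow> Periph j j \<in> T \<Longrightarrow> i = j"
  using loop_T[of i] loop_T[of j] loop_C[of j] loop_C_only[of i j] by auto

lemma signed_adj_tag:
  assumes "D \<in> T" "E \<in> T"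
  shows "signed_adj_tagged N (tag ` T) (tag D) (tag E) = signed_adj N T D E"
proof -
  have "{i. TNotched i \<in> tag ` T} = {i. Periph i i \<in> T}"
  proof -
    have "TNotched i = tag D \<longleftrightarrow> D = Periph i i" for i D by (cases D) auto
    then show ?thesis by (auto simp: image_iff)
  qed
  moreover have "card {i. Periph i i \<in> T} \<le> 1"
    using loop_unique by (metis (mono_tags, lifting) card_le_Suc0_iff_eq card.infinite mem_Collect_eq One_nat_def zero_le)
  ultimately have "\<not> many_notched (tag ` T)" by (simp add: many_notched_def)
  then show ?thesis by (simp add: signed_adj_tagged_def image_image)
qed

text \<open>With a loop, swapping tags exchanges the loop and the central arc inside it, which
  unfold to the same side. Without one, at least two arcs become notched, so
  \<open>signed_adj_tagged\<close> forgets the tags and recovers \<open>T\<close>.\<close>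

lemma signed_adj_swap:
  assumes "D \<in> T" "E \<in> T"
  shows "signed_adj_tagged N (swap_tag ` tag ` T) (swap_tag (tag D)) (swap_tag (tag E)) = signed_adj N T D E"
proof (cases "\<exists>i. Periph i i \<in> T")
  case True
  then obtain i where i: "Periph i i \<in> T" by blast
  have Ci: "Central i \<in> T" using loop_C[of i] loop_T[OF i] by (simp add: lifted_spoke_def)
  have "\<exists>D'\<in>T. swap_tag (tag D) = tag D' \<and> unfold_arc T D' = unfold_arc T D" if "D \<in> T" for D
  proof (cases D)
    case (Central j)
    then have "j = i" using Central_T[of j] loop_C_only[of i j] loop_T[OF i] that by simp
    then show ?thesis using Central i by (intro bexI[of _ "Periph i i"]) auto
  next
    case (Periph j k)
    show ?thesis
    proof (cases "j = k")
      case True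
      then have "j = i" using loop_unique i that Periph by blast
      then show ?thesis using Periph True i Ci by (intro bexI[of _ "Central i"]) auto
    next
      case False
      then show ?thesis using Periph that by (intro bexI[of _ D]) auto
    qed
  qed
  then obtain D' E' where "D' \<in> T" "swap_tag (tag D) = tag D'" "unfold_arc T D' = unfold_arc T D"
     "E' \<in> T" "swap_tag (tag E) = tag E'" "unfold_arc T E' = unfold_arc T E" using assms by metis
  then show ?thesis using swap_loop[OF i] signed_adj_tag[of D' E'] by (simp add: signed_adj_tri_sum)
next
  case False
  then obtain i j where ij: "i \<noteq> j" "Central i \<in> T" "Central j \<in> T" using two_spokes by blast
  have fin: "finite T" using T_plain finite_plain_arcs finite_subset by blast
  have n: "TNotched x = swap_tag (tag D) \<longleftrightarrow> D = Central x" for x D by (cases D) auto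
  have "{x. TNotched x \<in> swap_tag ` tag ` T} = {x. Central x \<in> T}"
    by (auto simp: image_iff n)
  moreover have "finite {x. Central x \<in> T}"
    using fin finite_vimageI[of T Central] by (simp add: inj_def vimage_def)
  then have "card {i, j} \<le> card {x. Central x \<in> T}" using ij by (intro card_mono) auto
  ultimately have "many_notched (swap_tag ` tag ` T)" using ij by (simp add: many_notched_def)
  moreover have f: "forget_tag (swap_tag (tag D)) = D" if "D \<in> T" for D
    using that False by (cases D) auto
  then have "forget_tag ` swap_tag ` tag ` T = T" by (simp add: image_image)
  ultimately show ?thesis using assms by (simp add: signed_adj_tagged_def f)
qed

end

subsection \<open>Connectedness of the flip graph\<close>

text \<open>A longest diagonal \<open>(a, c)\<close> is outermost, so its ends carry central arcs.
  Once it is removed, the apex \<open>b\<close> of the triangle below it sees the puncture: any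
  other diagonal over \<open>b\<close> would cover \<open>(a, c)\<close> and be longer.\<close>

lemma (in triang) flip_up:
  assumes "L u v"
  obtains e b where "flip N T (insert (spoke N b) (T - {e})) e (spoke N b)" "e \<in> T" "e \<notin> range Central"
proof -
  note K = that
  obtain a c where ac: "L a c" and longest: "\<And>x y. L x y \<Longrightarrow> y - x \<le> c - a" using ex_longest[OF assms] by blast
  obtain b where b: "a < b" "b < c" "side a b" "side b c" using inner_triangle[OF ac] .
  have aclen: "a + 2 \<le> c" "c \<le> a + int N" using L_len[OF ac] by auto
  have CC: "C a \<and> C c" by (rule no_arc_above_C[OF ac]) (use longest in force)+
  define e where "e = parc N a c"
  define T2 where "T2 = insert (spoke N b) (T - {e})"
  have eT: "e \<in> T" using ac by (simp add: plift_def e_def)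
  have L2: "plift N T2 x y \<longleftrightarrow> L x y \<and> parc N x y \<noteq> e" for x y by (auto simp: plift_def T2_def)
  have C2: "lifted_spoke N T2 x \<longleftrightarrow> C x \<or> nrm N x = nrm N b" for x by (auto simp: lifted_spoke_def T2_def e_def)
  have eq: "\<exists>k. x = a + k * int N \<and> y = c + k * int N" if "L x y" "parc N x y = e" for x y
  proof -
    have "parc N a c = parc N x y" using that e_def by simp
    then show ?thesis using parc_eqE[of N a c x y] L_len[OF that(1)] aclen by (smt (verit))
  qed
  have p2: "T2 \<subseteq> plain_arcs N" using T_plain spoke_plain[OF N3] by (auto simp: T2_def)
  have pp: "\<forall>x y z w. plift N T2 x y \<longrightarrow> plift N T2 z w \<longrightarrow> \<not> (x < z \<and> z < y \<and> y < w)"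
    using L2 L_nc by (meson not_le)
  have ps: "\<forall>x y z. plift N T2 x y \<longrightarrow> lifted_spoke N T2 z \<longrightarrow> \<not> (x < z \<and> z < y)"
  proof (intro allI impI notI)
    fix x y z assume xy: "plift N T2 x y" and z: "lifted_spoke N T2 z" and o: "x < z \<and> z < y"
    have Lxy: "L x y" "parc N x y \<noteq> e" using xy L2 by auto
    from z C2 consider "C z" | "nrm N b = nrm N z" by metis
    then show False
    proof cases
      case 1
      then show False using L_C Lxy o by blast
    next
      case 2
      then obtain k where k: "z = b + k * int N" by (auto simp: nrm_eq_iff)
      define x' where "x' = x - k * int N" define y' where "y' = y - k * int N"
      have x: "x = x' + k * int N" "y = y' + k * int N" by (simp_all add: x'_def y'_def)
      have L': "L x' y'" using Lxy(1) unfolding x by (simp only: plift_shift)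
      have o': "x' < b" "b < y'" using o k x by auto
      have "x' \<le> a" using side_nc[OF b(3) L_side[OF L']] o' by force
      moreover have "c \<le> y'" using side_nc[OF L_side[OF L'] b(4)] o' by force
      ultimately have "x' = a" "y' = c" using longest[OF L'] by auto
      then have "parc N x y = e" unfolding x e_def by simp
      then show False using Lxy by simp
    qed
  qed
  have mp: "\<forall>x y. x + 2 \<le> y \<longrightarrow> y \<le> x + int N \<longrightarrow>
       (\<forall>z w. plift N T2 z w \<longrightarrow> \<not> (x < z \<and> z < y \<and> y < w) \<and> \<not> (z < x \<and> x < w \<and> w < y)) \<longrightarrow>
       (\<forall>z. lifted_spoke N T2 z \<longrightarrow> \<not> (x < z \<and> z < y)) \<longrightarrow> plift N T2 x y"
  proof (intro allI impI)
    fix x y assume xy: "x + 2 \<le> y" "y \<le> x + int N"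
      and p: "\<forall>z w. plift N T2 z w \<longrightarrow> \<not> (x < z \<and> z < y \<and> y < w) \<and> \<not> (z < x \<and> x < w \<and> w < y)"
      and s: "\<forall>z. lifted_spoke N T2 z \<longrightarrow> \<not> (x < z \<and> z < y)"
    have sC: "\<not> (x < z \<and> z < y)" if "C z" for z using s C2 that by blast
    have CCk: "C (a + k * int N)" "C (c + k * int N)" for k using CC by (simp_all only: lifted_spoke_shift)
    \<comment> \<open>Crossing a translate of the removed arc would mean passing over one of its
      ends, where there is a central arc.\<close>
    have L: "L x y"
    proof (rule L_I[OF xy])
      fix z w assume zw: "L z w" "x < z" "z < y" "y < w"
      show False
      proof (cases "parc N z w = e")
        case True
        then show False using eq[OF zw(1) True] CCk sC zw by blast
      next
        case False
        then show False using p L2 zw by blast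
      qed
    next
      fix z w assume zw: "L z w" "z < x" "x < w" "w < y"
      show False
      proof (cases "parc N z w = e")
        case True
        then show False using eq[OF zw(1) True] CCk sC zw by blast
      next
        case False
        then show False using p L2 zw by blast
      qed
    next
      fix z assume "C z" "x < z" "z < y"
      then show False using sC by blast
    qed
    have "parc N x y \<noteq> e"
    proof
      assume "parc N x y = e"
      then obtain k where "x = a + k * int N" "y = c + k * int N" using eq[OF L] by blast
      moreover have "lifted_spoke N T2 (b + k * int N)" using C2[of "b + k * int N"] by simp
      ultimately show False using s[rule_format, of "b + k * int N"] b(1,2) by simp
    qed
    then show "plift N T2 x y" using L L2 by simp
  qed
  have ms: "\<forall>z. (\<forall>x y. plift N T2 x y \<longrightarrow> \<not> (x < z \<and> z < y)) \<longrightarrow> lifted_spoke N T2 z"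
  proof (intro allI impI)
    fix z assume p: "\<forall>x y. plift N T2 x y \<longrightarrow> \<not> (x < z \<and> z < y)"
    have "C z" if nz: "nrm N z \<noteq> nrm N b"
    proof (rule C_I)
      fix x y assume xy: "L x y" "x < z" "z < y"
      then have "parc N x y = e" using p L2 by blast
      then obtain k where k: "x = a + k * int N" "y = c + k * int N" using eq[OF xy(1)] by blast
      \<comment> \<open>A point below the removed arc other than \<open>b\<close> lies below one of
        the two remaining sides of its triangle and is still cut off from the puncture.\<close>
      have "z \<noteq> b + k * int N" using nz by auto
      then consider "z < b + k * int N" | "b + k * int N < z" by linarith
      then show False
      proof cases
        case 1
        then have "L a b" using side_L[OF b(3)] xy k by simp
        then have "L (a + k * int N) (b + k * int N)" by (simp only: plift_shift)
        moreover have "parc N (a + k * int N) (b + k * int N) \<noteq> e" using eq[OF \<open>L a b\<close>] b by force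
        ultimately show False using p L2 xy k 1 by blast
      next
        case 2
        then have "L b c" using side_L[OF b(4)] xy k by simp
        then have "L (b + k * int N) (c + k * int N)" by (simp only: plift_shift)
        moreover have "parc N (b + k * int N) (c + k * int N) \<noteq> e" using eq[OF \<open>L b c\<close>] b by force
        ultimately show False using p L2 xy k 2 by blast
      qed
    qed
    then show "lifted_spoke N T2 z" using C2 by blast
  qed
  have t2: "triangulation N T2" unfolding triangulation_iff[OF N3] using p2 pp ps mp ms by (intro conjI)
  have "spoke N b \<notin> T" using L_C[OF ac, of b] b by (auto simp: lifted_spoke_def)
  moreover have "e \<noteq> spoke N b" by (simp add: e_def)
  ultimately have "flip N T T2 e (spoke N b)"
    using t2 N3 eT tri by unfold_locales (auto simp: T2_def)
  then show thesis using K[of b e] eT unfolding T2_def e_def by auto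
qed

definition flip_step :: "nat \<Rightarrow> arc set \<Rightarrow> arc set \<Rightarrow> bool" where
  "flip_step N T1 T2 \<longleftrightarrow> (\<exists>e e'. flip N T1 T2 e e')"

lemma flip_step_sym: "flip_step N T1 T2 \<Longrightarrow> flip_step N T2 T1"
  unfolding flip_step_def using flip.flip_sym by blast

text \<open>Each flip from \<open>flip_up\<close> lowers the number of peripheral arcs; when none is
  left, every boundary point sees the puncture.\<close>

lemma reach_star:
  assumes "triang N T"
  shows "(flip_step N)\<^sup>*\<^sup>* T (Central ` {1..int N})"
  using assms
proof (induction "card (T - range Central)" arbitrary: T rule: less_induct)
  case less
  interpret triang N T by (rule less.prems)
  have fin: "finite T" using T_plain finite_plain_arcs finite_subset by blast
  show ?case
  proof (cases "\<exists>u v. L u v")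
    case True
    then obtain e b where f: "flip N T (insert (spoke N b) (T - {e})) e (spoke N b)" "e \<in> T" "e \<notin> range Central"
      using flip_up by blast
    define T2 where "T2 = insert (spoke N b) (T - {e})"
    have "T2 - range Central = (T - range Central) - {e}" by (auto simp: T2_def)
    then have "card (T2 - range Central) < card (T - range Central)"
      using f fin by (metis DiffI card_Diff1_less finite_Diff)
    moreover have "triang N T2" using f unfolding T2_def flip_def by blast
    ultimately have "(flip_step N)\<^sup>*\<^sup>* T2 (Central ` {1..int N})" using less.hyps by blast
    moreover have "flip_step N T T2" using f unfolding T2_def flip_step_def by blast
    ultimately show ?thesis by (rule converse_rtranclp_into_rtranclp[rotated])
  next
    case False
    have "Central i \<in> T" if "i \<in> {1..int N}" for i
      using C_I[of i] False that by (simp add: lifted_spoke_def nrm_id)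
    moreover have "D \<in> Central ` {1..int N}" if "D \<in> T" for D
    proof (rule plain_arc_cases[OF N3, of D])
      show "D \<in> plain_arcs N" using that T_plain by blast
    next
      fix a b assume "D = parc N a b" "a + 2 \<le> b" "b \<le> a + int N"
      then show ?thesis using False that by (auto simp: plift_def)
    next
      fix a assume "D = spoke N a"
      then show ?thesis using nrm_range[of N a] N3 by simp
    qed
    ultimately have "T = Central ` {1..int N}" by blast
    then show ?thesis by simp
  qed
qed

lemma flip_connected:
  assumes "triang N T1" "triang N T2" shows "(flip_step N)\<^sup>*\<^sup>* T1 T2"
proof -
  have "symp (flip_step N)" using flip_step_sym by (rule sympI)
  then have "symp (flip_step N)\<^sup>*\<^sup>*" by (rule symp_rtranclp)
  then have "(flip_step N)\<^sup>*\<^sup>* (Central ` {1..int N}) T2" using reach_star[OF assms(2)] by (auto dest: sympD)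
  then show ?thesis using reach_star[OF assms(1)] by simp
qed

lemma triangulation_extend:
  assumes "N \<ge> 3" "D \<in> plain_arcs N"
  obtains T where "triang N T" "D \<in> T"
proof -
  let ?A = "{T. noncrossing N T \<and> D \<in> T}"
  have "finite ?A" by (rule finite_subset[of _ "Pow (plain_arcs N)"]) (auto simp: noncrossing_def finite_plain_arcs)
  moreover have "{D} \<in> ?A" using assms crosses_irrefl[OF assms] by (simp add: noncrossing_def)
  ultimately obtain T where T: "T \<in> ?A" "\<And>T'. T' \<in> ?A \<Longrightarrow> T \<subseteq> T' \<Longrightarrow> T = T'"
    using finite_has_maximal[of ?A] by blast
  then have "triangulation N T" unfolding triangulation_def by blast
  then show thesis using that[of T] T assms(1) by (simp add: triang_def)
qed

subsection \<open>Values of the cluster variables\<close>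

context lambda_data begin

fun tval :: "tarc \<Rightarrow> rat" where
  "tval (TPeriph i j) = lam i (i + blen N i j)"
| "tval (TPlain i) = c i"
| "tval (TNotched i) = S * c i"

lemma tval_tag: "tval (tag D) = arc_val D"
  by (cases D) auto

text \<open>Exchanging plain and notched arcs multiplies \<open>c\<close> by \<open>S\<close>.
  Dividing \<open>t\<close> by \<open>S\<^sup>2\<close> keeps all determinants \<open>lam\<close>,
  and the increment over one turn becomes \<open>S / S\<^sup>2 = 1 / S\<close>; a second exchange
  restores the original data.\<close>

lemma swapped: "lambda_data N (\<lambda>x. S * c x) (\<lambda>x. t x / S\<^sup>2) (1 / S)"
proof
  fix x
  show "t (x + 1) / S\<^sup>2 = t x / S\<^sup>2 + 1 / (S * c x * (S * c (x + 1)))"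
    by (simp add: t_step add_divide_distrib power2_eq_square mult_ac)
  show "t (x + int N) / S\<^sup>2 = t x / S\<^sup>2 + 1 / S"
    using S_pos by (simp add: t_per add_divide_distrib power2_eq_square)
qed (use N3 c_pos c_per S_pos in auto)

lemma swapped_lam: "lambda_data.lam (\<lambda>x. S * c x) (\<lambda>x. t x / S\<^sup>2) a b = lam a b"
proof -
  interpret sw: lambda_data N "\<lambda>x. S * c x" "\<lambda>x. t x / S\<^sup>2" "1 / S" by (rule swapped)
  show ?thesis unfolding sw.lam_def lam_def
    using S_pos by (simp add: power2_eq_square diff_divide_distrib[symmetric])
qed

lemma tval_swap_tag:
  "tval (swap_tag (tag D)) = lambda_data.arc_val N (\<lambda>x. S * c x) (\<lambda>x. t x / S\<^sup>2) (1 / S) D"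
proof -
  interpret sw: lambda_data N "\<lambda>x. S * c x" "\<lambda>x. t x / S\<^sup>2" "1 / S" by (rule swapped)
  show ?thesis using S_pos swapped_lam by (cases D) auto
qed

lemma flip_update:
  assumes fl: "flip N T1 T2 e e'" and m: "bij_betw m {..<N} T1" "k < N" "m k = e"
    and B: "\<And>i j. i < N \<Longrightarrow> j < N \<Longrightarrow> B i j = signed_adj N T1 (m i) (m j)"
    and x: "\<And>i. i < N \<Longrightarrow> value_at_ones (x i) (arc_val (m i))"
    and ij: "i < N" "j < N"
  shows "mutate_matrix k B i j = signed_adj N T2 ((m(k := e')) i) ((m(k := e')) j)"
    and "value_at_ones (mutate_cluster N k B x i) (arc_val ((m(k := e')) i))"
proof -
  interpret flip N T1 T2 e e' by fact
  note g = good_flip_all[OF fl, unfolded good_flip_def, rule_format, OF m]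
  show "mutate_matrix k B i j = signed_adj N T2 ((m(k := e')) i) ((m(k := e')) j)"
  proof -
    have "mutate_matrix k B i j = mutate_matrix k (\<lambda>i j. signed_adj N T1 (m i) (m j)) i j"
      using B ij m(2) by (simp add: mutate_matrix_def)
    also have "\<dots> = signed_adj N T2 ((m(k := e')) i) ((m(k := e')) j)"
      by (rule conjunct1[OF g, rule_format, OF ij])
    finally show ?thesis .
  qed
  show "value_at_ones (mutate_cluster N k B x i) (arc_val ((m(k := e')) i))"
  proof (cases "i = k")
    case False
    then show ?thesis using x ij by (simp add: mutate_cluster_def)
  next
    case True
    have pos: "arc_val e > 0" using arc_val_pos e1 t1.T_plain by blast
    have b: "B i k = signed_adj N T1 (m i) e" if "i < N" for i using B[OF that m(2)] m(3) by simp
    have "value_at_ones (\<Prod>i<N. x i ^ nat (B i k)) (\<Prod>i<N. arc_val (m i) ^ nat (signed_adj N T1 (m i) e))"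
      by (rule value_at_ones_prod) (use b x value_at_ones_power in auto)
    moreover have "value_at_ones (\<Prod>i<N. x i ^ nat (- B i k)) (\<Prod>i<N. arc_val (m i) ^ nat (- signed_adj N T1 (m i) e))"
      by (rule value_at_ones_prod) (use b x value_at_ones_power in auto)
    ultimately have "value_at_ones (((\<Prod>i<N. x i ^ nat (B i k)) + (\<Prod>i<N. x i ^ nat (- B i k))) / x k)
       (arc_val e * arc_val e' / arc_val e)"
      unfolding conjunct2[OF g] using x[OF m(2)] m(3) pos
      by (intro value_at_ones_divide value_at_ones_add) auto
    then show ?thesis using True pos by (simp add: mutate_cluster_def)
  qed
qed

end

section \<open>Tagged flips and the invariant of seeds\<close>

lemma flip_insertI:
  assumes "triang N T1" "triang N T2" "T2 = insert e' (T1 - {e})" "e \<in> T1" "e \<noteq> e'"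
  shows "flip N T1 T2 e e'"
proof -
  interpret t1: triang N T1 by fact
  interpret t2: triang N T2 by fact
  have "e' \<notin> T1"
  proof
    assume "e' \<in> T1"
    then have "T2 \<subseteq> T1" "e \<notin> T2" using assms by auto
    moreover have "noncrossing N T1" "\<forall>T'. noncrossing N T' \<longrightarrow> T2 \<subseteq> T' \<longrightarrow> T' = T2"
      using t1.tri t2.tri by (simp_all add: triangulation_def)
    ultimately show False using assms(4) by blast
  qed
  then show ?thesis using assms by unfold_locales auto
qed

text \<open>If one of the two triangulations has a loop, its tagged set suits either tagging. If
  neither has one, opposite taggings cannot occur: one set has at least two central arcs with a tag
  that is absent from the other, but the sets differ in one arc only.\<close>

lemma common_tagging:
  assumes N: "N \<ge> 3" and TT: "tagged_triangulation N TT1" "tagged_triangulation N TT2" "TT2 = insert \<gamma> (TT1 - {\<delta>})"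
  obtains T1 T2 sw where "triang N T1" "triang N T2" "sw = id \<or> sw = swap_tag"
    "TT1 = sw ` tag ` T1" "TT2 = sw ` tag ` T2"
proof -
  obtain T1 where T1: "triangulation N T1" "TT1 = tag ` T1 \<or> TT1 = swap_tag ` tag ` T1"
    using TT(1) tagged_triangulation_iff[OF N] by auto
  obtain T2 where T2: "triangulation N T2" "TT2 = tag ` T2 \<or> TT2 = swap_tag ` tag ` T2"
    using TT(2) tagged_triangulation_iff[OF N] by auto
  interpret t1: triang N T1 using N T1 by unfold_locales
  interpret t2: triang N T2 using N T2 by unfold_locales
  note K = that[OF t1.triang_axioms t2.triang_axioms]
  have A: "swap_tag ` tag ` T1 = tag ` T1" if "Periph i i \<in> T1" for i using t1.swap_loop that .
  have B: "swap_tag ` tag ` T2 = tag ` T2" if "Periph i i \<in> T2" for i using t2.swap_loop that .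
  show thesis
  proof (cases "(\<exists>i. Periph i i \<in> T1) \<or> (\<exists>i. Periph i i \<in> T2)")
    case True
    then have "swap_tag ` tag ` T1 = tag ` T1 \<or> swap_tag ` tag ` T2 = tag ` T2" using A B by blast
    then have "(TT1 = tag ` T1 \<and> TT2 = tag ` T2) \<or> (TT1 = swap_tag ` tag ` T1 \<and> TT2 = swap_tag ` tag ` T2)"
      using T1(2) T2(2) by (elim disjE) simp_all
    then show thesis using K[of id] K[of swap_tag] by auto
  next
    case False
    obtain i j where ij: "i \<noteq> j" "Central i \<in> T1" "Central j \<in> T1" using t1.two_spokes False by blast
    have p: "TPlain x = tag D \<longleftrightarrow> D = Central x" "TPlain x = swap_tag (tag D) \<longleftrightarrow> D = Periph x x"
      "TNotched x = tag D \<longleftrightarrow> D = Periph x x" "TNotched x = swap_tag (tag D) \<longleftrightarrow> D = Central x" for x D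
      by (cases D; auto)+
    have "\<not> (TT1 = tag ` T1 \<and> TT2 = swap_tag ` tag ` T2)"
    proof
      assume a: "TT1 = tag ` T1 \<and> TT2 = swap_tag ` tag ` T2"
      then have "TPlain i \<in> TT1" "TPlain j \<in> TT1" using ij by (auto simp: image_iff p)
      moreover have "TPlain x \<notin> TT2" for x using a False by (auto simp: image_iff p)
      ultimately show False using TT(3) ij(1) by auto
    qed
    moreover have "\<not> (TT1 = swap_tag ` tag ` T1 \<and> TT2 = tag ` T2)"
    proof
      assume a: "TT1 = swap_tag ` tag ` T1 \<and> TT2 = tag ` T2"
      then have "TNotched i \<in> TT1" "TNotched j \<in> TT1" using ij by (auto simp: image_iff p)
      moreover have "TNotched x \<notin> TT2" for x using a False by (auto simp: image_iff p)
      ultimately show False using TT(3) ij(1) by auto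
    qed
    ultimately have "(TT1 = tag ` T1 \<and> TT2 = tag ` T2) \<or> (TT1 = swap_tag ` tag ` T1 \<and> TT2 = swap_tag ` tag ` T2)"
      using T1(2) T2(2) by blast
    then show thesis using K[of id] K[of swap_tag] by auto
  qed
qed

context lambda_data begin

text \<open>Keeps the value at ones of each cluster variable instead of the variable itself. This
  already makes the value of an arc independent of the sequence of flips.\<close>

definition seed_inv :: "(nat \<Rightarrow> tarc) \<Rightarrow> (nat \<Rightarrow> nat \<Rightarrow> int) \<Rightarrow> (nat \<Rightarrow> ratfun) \<Rightarrow> bool" where
  "seed_inv l B x \<longleftrightarrow> inj_on l {..<N} \<and> tagged_triangulation N (l ` {..<N}) \<and>
     (\<forall>i<N. \<forall>j<N. B i j = signed_adj_tagged N (l ` {..<N}) (l i) (l j)) \<and>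
     (\<forall>i<N. value_at_ones (x i) (tval (l i)))"

text \<open>After a common retagging \<open>sw\<close> the flip is one of plain triangulations. If
  \<open>sw\<close> swaps the tags, the same computation is run with the swapped lambda
  lengths.\<close>

lemma seed_inv_flip:
  assumes inv: "seed_inv l B x" and k: "k < N" and \<gamma>: "\<gamma> \<noteq> l k"
    and tt: "tagged_triangulation N ((l(k := \<gamma>)) ` {..<N})"
  shows "seed_inv (l(k := \<gamma>)) (mutate_matrix k B) (mutate_cluster N k B x)"
proof -
  define TT1 where "TT1 = l ` {..<N}"
  define TT2 where "TT2 = (l(k := \<gamma>)) ` {..<N}"
  have inj: "inj_on l {..<N}" and tt1: "tagged_triangulation N TT1"
    and B: "\<And>i j. i < N \<Longrightarrow> j < N \<Longrightarrow> B i j = signed_adj_tagged N TT1 (l i) (l j)"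
    and x: "\<And>i. i < N \<Longrightarrow> value_at_ones (x i) (tval (l i))"
    using inv by (auto simp: seed_inv_def TT1_def)
  have tt2: "tagged_triangulation N TT2" using tt by (simp add: TT2_def)
  have im: "l ` ({..<N} - {k}) = TT1 - {l k}"
    using inj k by (auto simp: TT1_def inj_on_def)
  have "TT2 = insert \<gamma> (l ` ({..<N} - {k}))" using k by (auto simp: TT2_def)
  then have TT2: "TT2 = insert \<gamma> (TT1 - {l k})" using im by simp
  obtain T1 T2 sw where T: "triang N T1" "triang N T2" "sw = id \<or> sw = swap_tag"
    "TT1 = sw ` tag ` T1" "TT2 = sw ` tag ` T2"
    using common_tagging[OF N3 tt1 tt2 TT2] by blast
  have sw: "sw (sw \<alpha>) = \<alpha>" for \<alpha> using T(3) by auto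
  define u where "u = (\<lambda>\<alpha>. plain_of (sw \<alpha>))"
  have u: "u (sw (tag D)) = D" for D by (simp add: u_def sw)
  have uu: "sw (tag (u \<alpha>)) = \<alpha>" if "\<alpha> \<in> TT1 \<union> TT2" for \<alpha>
    using that T(4,5) u by auto
  define m where "m = (\<lambda>i. u (l i))"
  define e where "e = u (l k)" define e' where "e' = u \<gamma>"
  have lT: "l i \<in> TT1" if "i < N" for i using that by (simp add: TT1_def)
  have \<gamma>T: "\<gamma> \<in> TT2" using TT2 by simp
  have T1u: "T1 = u ` TT1" "T2 = u ` TT2" using T(4,5) u by (simp_all add: image_image)
  have inju: "inj_on u (TT1 \<union> TT2)" using uu by (metis inj_onI)
  have m: "bij_betw m {..<N} T1"
  proof -
    have "inj_on u (l ` {..<N})" using inju by (rule inj_on_subset) (simp add: TT1_def)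
    then have "inj_on (u \<circ> l) {..<N}" using inj by (rule comp_inj_on[rotated])
    then show ?thesis using T1u(1) by (auto simp: bij_betw_def m_def TT1_def comp_def image_image)
  qed
  have mk: "m k = e" by (simp add: m_def e_def)
  have ne: "e \<noteq> e'" using \<gamma> uu[of \<gamma>] uu[of "l k"] lT[OF k] \<gamma>T unfolding e_def e'_def by auto
  have eT: "e \<in> T1" using lT[OF k] T1u(1) by (simp add: e_def)
  have "u ` (TT1 - {l k}) = u ` TT1 - u ` {l k}"
    using inju lT[OF k] by (intro inj_on_image_set_diff[of _ "TT1 \<union> TT2"]) auto
  then have "T2 = insert e' (T1 - {e})" using T1u TT2 by (simp add: e_def e'_def)
  then have fl: "flip N T1 T2 e e'" using flip_insertI[OF T(1,2)] eT ne by blast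
  interpret t1: triang N T1 by (rule T(1))
  interpret t2: triang N T2 by (rule T(2))
  have adj1: "signed_adj_tagged N TT1 (sw (tag D)) (sw (tag E)) = signed_adj N T1 D E" if "D \<in> T1" "E \<in> T1" for D E
    using t1.signed_adj_tag[OF that] t1.signed_adj_swap[OF that] T(3) unfolding T(4) by auto
  have adj2: "signed_adj_tagged N TT2 (sw (tag D)) (sw (tag E)) = signed_adj N T2 D E" if "D \<in> T2" "E \<in> T2" for D E
    using t2.signed_adj_tag[OF that] t2.signed_adj_swap[OF that] T(3) unfolding T(5) by auto
  have lm: "l i = sw (tag (m i))" "m i \<in> T1" if "i < N" for i
    using uu[of "l i"] lT[OF that] T1u(1) by (simp_all add: m_def)
  have lm': "(l(k := \<gamma>)) i = sw (tag ((m(k := e')) i))" if "i < N" for i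
    using lm[OF that] uu[of \<gamma>] \<gamma>T by (simp add: e'_def)
  have m': "bij_betw (m(k := e')) {..<N} T2" using flip_bij[OF fl m k mk] .
  then have mT2: "(m(k := e')) i \<in> T2" if "i < N" for i using that by (auto simp: bij_betw_def)
  have B1: "B i j = signed_adj N T1 (m i) (m j)" if "i < N" "j < N" for i j
    using B[OF that] adj1[of "m i" "m j"] lm that by simp
  define av where "av = (\<lambda>D. tval (sw (tag D)))"
  have upd: "mutate_matrix k B i j = signed_adj N T2 ((m(k := e')) i) ((m(k := e')) j) \<and>
     value_at_ones (mutate_cluster N k B x i) (av ((m(k := e')) i))" if ij: "i < N" "j < N" for i j
  proof -
    from T(3) show ?thesis
    proof
      assume "sw = id"
      then have av: "av = arc_val" by (intro ext) (simp add: av_def tval_tag)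
      have x': "value_at_ones (x i) (arc_val (m i))" if "i < N" for i
        using x[OF that] lm[OF that] av unfolding av_def by (metis tval_tag)
      show ?thesis unfolding av using flip_update[OF fl m k mk B1 x' ij] by blast
    next
      assume s: "sw = swap_tag"
      interpret sw: lambda_data N "\<lambda>x. S * c x" "\<lambda>x. t x / S\<^sup>2" "1 / S" by (rule swapped)
      have av: "av = sw.arc_val" by (intro ext) (simp add: av_def tval_swap_tag s)
      have x': "value_at_ones (x i) (sw.arc_val (m i))" if "i < N" for i
        using x[OF that] lm[OF that] s by (metis tval_swap_tag)
      show ?thesis unfolding av using sw.flip_update[OF fl m k mk B1 x' ij] by blast
    qed
  qed
  show ?thesis unfolding seed_inv_def TT2_def[symmetric]
  proof (intro conjI allI impI)
    show "inj_on (l(k := \<gamma>)) {..<N}"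
    proof (rule inj_onI)
      fix i j assume ij: "i \<in> {..<N}" "j \<in> {..<N}" "(l(k := \<gamma>)) i = (l(k := \<gamma>)) j"
      then have "sw (tag ((m(k := e')) i)) = sw (tag ((m(k := e')) j))" using lm' by simp
      then have "(m(k := e')) i = (m(k := e')) j" using u by metis
      then show "i = j" using m' ij by (auto simp: bij_betw_def inj_on_def)
    qed
    show "tagged_triangulation N TT2" by (rule tt2)
    fix i assume i: "i < N"
    show "value_at_ones (mutate_cluster N k B x i) (tval ((l(k := \<gamma>)) i))"
      using upd[OF i i] lm'[OF i] by (simp add: av_def)
    fix j assume j: "j < N"
    show "mutate_matrix k B i j = signed_adj_tagged N TT2 ((l(k := \<gamma>)) i) ((l(k := \<gamma>)) j)"
      using upd[OF i j] adj2[OF mT2[OF i] mT2[OF j]] lm'[OF i] lm'[OF j] by simp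
  qed
qed

lemma seed_inv_seed:
  assumes "tagged_seed N TT l B x" "tagged_triangulation N TT" "\<And>\<gamma>. \<gamma> \<in> TT \<Longrightarrow> tval \<gamma> = 1"
  shows "seed_inv l B x"
  using assms(1)
proof (induction rule: tagged_seed.induct)
  case (initial l)
  then have "l ` {..<N} = TT" "inj_on l {..<N}" by (auto simp: bij_betw_def)
  moreover from this have "tval (l i) = 1" if "i < N" for i using assms(3) that by blast
  ultimately show ?case using assms(2) by (simp add: seed_inv_def value_at_ones_indet)
next
  case (flip l B x k \<gamma>)
  then show ?case using seed_inv_flip by blast
qed

lemma seed_exists:
  assumes TT: "tagged_triangulation N TT" "card TT = N" "\<And>\<gamma>. \<gamma> \<in> TT \<Longrightarrow> tval \<gamma> = 1"
    and D: "D \<in> plain_arcs N"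
  obtains l B x k where "tagged_seed N TT l B x" "k < N" "l k = tag D"
proof -
  define R where "R = {TT'. \<exists>l B x. tagged_seed N TT l B x \<and> l ` {..<N} = TT'}"
  have "finite TT" using TT(2) N3 by (metis card.infinite not_numeral_le_zero)
  then obtain l where "bij_betw l {..<N} TT"
    using TT(2) ex_bij_betw_nat_finite[of TT] by (auto simp: atLeast0LessThan)
  then have R0: "TT \<in> R" using tagged_seed.initial[of l N TT] unfolding R_def bij_betw_def by blast
  have Rstep: "sw ` tag ` T2 \<in> R"
    if h: "sw ` tag ` T1 \<in> R" "flip_step N T1 T2" and sw: "sw = id \<or> sw = swap_tag" for T1 T2 sw
  proof -
    obtain e e' where fl: "flip N T1 T2 e e'" using h(2) by (auto simp: flip_step_def)
    interpret flip N T1 T2 e e' by (rule fl)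
    obtain l B x where s: "tagged_seed N TT l B x" "l ` {..<N} = sw ` tag ` T1"
      using h(1) unfolding R_def by blast
    have inj: "inj_on l {..<N}" using seed_inv_seed[OF s(1) TT(1,3)] by (simp add: seed_inv_def)
    have injs: "inj sw" using sw by (metis inj_on_id inj_on_inverseI swap_swap)
    obtain k where k: "k < N" "l k = sw (tag e)" using s(2) e1 by (metis (no_types, lifting) imageE imageI lessThan_iff)
    have nn: "sw (tag e') \<noteq> l k" using ne k injs inj_tag by (auto dest: injD)
    have "l ` ({..<N} - {k}) = sw ` tag ` (T1 - {e})"
    proof -
      have "l ` ({..<N} - {k}) = l ` {..<N} - {l k}" using inj k(1) by (auto simp: inj_on_def)
      also have "\<dots> = sw ` tag ` T1 - sw ` tag ` {e}" using s(2) k(2) by simp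
      also have "\<dots> = sw ` tag ` (T1 - {e})"
        using injs inj_tag by (simp only: image_set_diff)
      finally show ?thesis .
    qed
    moreover have "(l(k := sw (tag e'))) ` {..<N} = insert (sw (tag e')) (l ` ({..<N} - {k}))"
      using k(1) by auto
    ultimately have im: "(l(k := sw (tag e'))) ` {..<N} = sw ` tag ` T2"
      using rest e2 by auto
    moreover have "tagged_triangulation N (sw ` tag ` T2)"
      using tagged_triangulation_iff[OF N3] t2.tri sw by auto
    ultimately have "tagged_seed N TT (l(k := sw (tag e'))) (mutate_matrix k B) (mutate_cluster N k B x)"
      using tagged_seed.flip[OF s(1) k(1) nn] by simp
    then show ?thesis using im unfolding R_def by blast
  qed
  have Rall: "sw ` tag ` T2 \<in> R"
    if h: "sw ` tag ` T1 \<in> R" "triang N T1" "triang N T2" and sw: "sw = id \<or> sw = swap_tag" for T1 T2 sw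
    using flip_connected[OF h(2,3)] h(1)
  proof (induction rule: rtranclp_induct)
    case (step y z)
    then show ?case using Rstep sw by blast
  qed simp
  obtain T where T: "triang N T" "TT = tag ` T \<or> TT = swap_tag ` tag ` T"
    using TT(1) tagged_triangulation_iff[OF N3] N3 by (auto simp: triang_def)
  \<comment> \<open>Flips of plain triangulations stay within one tagging. A triangulation with a
    loop has the same tagged set in both and serves as a bridge between them.\<close>
  obtain TL where TL: "triang N TL" "parc N 1 (1 + int N) \<in> TL"
    using triangulation_extend[OF N3 parc_plain[OF N3, of 1 "1 + int N"]] N3 by auto
  have "Periph 1 1 \<in> TL" using TL(2) nrm_shift[of N 1 1] N3 by (simp add: nrm_id)
  then have "swap_tag ` tag ` TL = tag ` TL" using triang.swap_loop[OF TL(1)] by blast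
  then have "tag ` TL \<in> R"
    using T(2) R0 Rall[of id T TL] Rall[of swap_tag T TL] T(1) TL(1) by auto
  moreover obtain TD where TD: "triang N TD" "D \<in> TD" using triangulation_extend[OF N3 D] .
  ultimately have "tag ` TD \<in> R" using Rall[of id TL TD] TL(1) by simp
  then obtain l B x where s: "tagged_seed N TT l B x" "l ` {..<N} = tag ` TD" unfolding R_def by blast
  moreover obtain k where "k < N" "l k = tag D" using s(2) TD(2) by (metis (no_types, lifting) imageE imageI lessThan_iff)
  ultimately show thesis using that by blast
qed

theorem F_cluster_tval:
  assumes TT: "tagged_triangulation N TT" "card TT = N" "\<And>\<gamma>. \<gamma> \<in> TT \<Longrightarrow> tval \<gamma> = 1"
    and D: "D \<in> plain_arcs N"
  shows "F_cluster N TT D = arc_val D"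
  unfolding F_cluster_def
proof (rule the_equality)
  have val: "value_at_ones z (arc_val D)" if "cluster_variable N TT (tag D) z" for z
    using that seed_inv_seed[OF _ TT(1,3)] tval_tag[of D]
    unfolding cluster_variable_def seed_inv_def by metis
  obtain l B x k where "tagged_seed N TT l B x" "k < N" "l k = tag D" using seed_exists[OF TT D] .
  then have "cluster_variable N TT (tag D) (x k)" unfolding cluster_variable_def by blast
  then show "\<exists>z. cluster_variable N TT (tag D) z \<and> value_at_ones z (arc_val D)" using val by blast
  show "u = arc_val D" if "\<exists>z. cluster_variable N TT (tag D) z \<and> value_at_ones z u" for u
    using that val value_at_ones_unique by blast
qed

end

subsection \<open>Counting matchings\<close>

lemma finite_corners [simp]: "finite (corners \<Delta>)"
  by (cases \<Delta>) auto

lemma finite_matchings: "finite I \<Longrightarrow> finite R \<Longrightarrow> finite (matchings \<pi> I R)"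
  unfolding matchings_def by (rule finite_subset[of _ "I \<rightarrow>\<^sub>E (SIGMA \<Delta>:R. corners \<Delta>)"]) (auto intro!: finite_PiE)

lemma matchings_iff:
  "f \<in> matchings \<pi> I R \<longleftrightarrow> (\<forall>v\<in>I. fst (f v) \<in> R \<and> snd (f v) \<in> corners (fst (f v)) \<and> \<pi> (snd (f v)) = v) \<and>
     (\<forall>v. v \<notin> I \<longrightarrow> f v = undefined) \<and> inj_on (\<lambda>v. fst (f v)) I"
proof -
  have "z \<in> (SIGMA \<Delta>:R. corners \<Delta>) \<longleftrightarrow> fst z \<in> R \<and> snd z \<in> corners (fst z)" for z by (cases z) auto
  then show ?thesis unfolding matchings_def PiE_iff extensional_def mem_Collect_eq by (simp only:) blast
qed

definition match_count :: "(vertex \<Rightarrow> vertex) \<Rightarrow> vertex set \<Rightarrow> ltri set \<Rightarrow> rat" where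
  "match_count \<pi> I R = of_nat (card (matchings \<pi> I R))"

lemma match_count_insert:
  assumes fin: "finite I" "finite R" and \<Delta>: "\<Delta> \<notin> R"
  shows "match_count \<pi> I (insert \<Delta> R) =
    match_count \<pi> I R + (\<Sum>v\<in>{v \<in> corners \<Delta>. \<pi> v \<in> I}. match_count \<pi> (I - {\<pi> v}) R)"
proof -
  let ?V = "{v \<in> corners \<Delta>. \<pi> v \<in> I}"
  let ?u = "\<lambda>v g. g(\<pi> v := (\<Delta>, v))"
  define A where "A v = ?u v ` matchings \<pi> (I - {\<pi> v}) R" for v
  have eq: "matchings \<pi> I (insert \<Delta> R) = matchings \<pi> I R \<union> (\<Union>v\<in>?V. A v)"
  proof (intro equalityI subsetI)
    fix f assume f: "f \<in> matchings \<pi> I (insert \<Delta> R)"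
    show "f \<in> matchings \<pi> I R \<union> (\<Union>v\<in>?V. A v)"
    proof (cases "\<exists>w\<in>I. fst (f w) = \<Delta>")
      case False
      then have "f \<in> matchings \<pi> I R" using f unfolding matchings_iff by auto
      then show ?thesis by blast
    next
      case True
      then obtain w where w: "w \<in> I" "fst (f w) = \<Delta>" by blast
      define v where "v = snd (f w)"
      have v: "v \<in> corners \<Delta>" "\<pi> v = w" "f w = (\<Delta>, v)"
        using f w unfolding matchings_iff v_def by (auto simp: prod_eq_iff)
      define g where "g = f(w := undefined)"
      have "g \<in> matchings \<pi> (I - {\<pi> v}) R"
        unfolding matchings_iff
      proof (intro conjI ballI allI impI)
        fix z assume z: "z \<in> I - {\<pi> v}"
        then have "fst (f z) \<noteq> \<Delta>" using f w v(2) unfolding matchings_iff inj_on_def by (metis DiffE insertI1)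
        then show "fst (g z) \<in> R" "snd (g z) \<in> corners (fst (g z))" "\<pi> (snd (g z)) = z"
          using z f v(2) unfolding matchings_iff g_def by auto
      next
        fix z assume "z \<notin> I - {\<pi> v}"
        then show "g z = undefined" using f v(2) unfolding matchings_iff g_def by auto
      next
        show "inj_on (\<lambda>v. fst (g v)) (I - {\<pi> v})"
          using f v(2) unfolding matchings_iff g_def by (auto simp: inj_on_def)
      qed
      moreover have "f = ?u v g" using v by (auto simp: g_def)
      ultimately have "f \<in> A v" unfolding A_def by blast
      then show ?thesis using v w by auto
    qed
  next
    fix f assume "f \<in> matchings \<pi> I R \<union> (\<Union>v\<in>?V. A v)"
    then show "f \<in> matchings \<pi> I (insert \<Delta> R)"
    proof
      assume "f \<in> matchings \<pi> I R"
      then show ?thesis unfolding matchings_iff by auto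
    next
      assume "f \<in> (\<Union>v\<in>?V. A v)"
      then obtain v g where v: "v \<in> corners \<Delta>" "\<pi> v \<in> I" and g: "g \<in> matchings \<pi> (I - {\<pi> v}) R" "f = ?u v g"
        unfolding A_def by blast
      have "inj_on (\<lambda>w. fst (f w)) I"
      proof (rule inj_onI)
        fix y z assume yz: "y \<in> I" "z \<in> I" "fst (f y) = fst (f z)"
        have n: "fst (g w) \<noteq> \<Delta>" if "w \<in> I" "w \<noteq> \<pi> v" for w
          using g(1) that \<Delta> unfolding matchings_iff by auto
        show "y = z"
        proof (cases "y = \<pi> v \<or> z = \<pi> v")
          case True
          then show ?thesis using yz n g(2) by (auto split: if_splits)
        next
          case False
          then show ?thesis using yz g unfolding matchings_iff inj_on_def by auto
        qed
      qed
      then show ?thesis using g v unfolding matchings_iff by auto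
    qed
  qed
  have finA: "finite (A v)" for v unfolding A_def using fin by (intro finite_imageI finite_matchings) auto
  have cA: "card (A v) = card (matchings \<pi> (I - {\<pi> v}) R)" for v
    unfolding A_def
  proof (rule card_image, rule inj_onI)
    fix g h assume gh: "g \<in> matchings \<pi> (I - {\<pi> v}) R" "h \<in> matchings \<pi> (I - {\<pi> v}) R" "?u v g = ?u v h"
    then have "g (\<pi> v) = h (\<pi> v)" unfolding matchings_iff by auto
    then show "g = h" using gh(3) by (metis fun_upd_triv fun_upd_upd)
  qed
  have fA: "f (\<pi> v) = (\<Delta>, v)" if "f \<in> A v" for f v using that by (auto simp: A_def)
  have d1: "matchings \<pi> I R \<inter> (\<Union>v\<in>?V. A v) = {}"
    using fA \<Delta> unfolding matchings_iff by (force simp: matchings_iff)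
  have d2: "A v \<inter> A w = {}" if "v \<in> ?V" "w \<in> ?V" "v \<noteq> w" for v w
  proof (rule ccontr)
    assume "A v \<inter> A w \<noteq> {}"
    then obtain f where f: "f \<in> A v" "f \<in> A w" by blast
    show False
    proof (cases "\<pi> v = \<pi> w")
      case True
      then show False using fA[OF f(1)] fA[OF f(2)] that(3) by simp
    next
      case False
      have "f \<in> matchings \<pi> I (insert \<Delta> R)" using f(1) that(1) eq by blast
      then have "\<pi> v = \<pi> w" using fA[OF f(1)] fA[OF f(2)] that unfolding matchings_iff inj_on_def by auto
      then show False using False by simp
    qed
  qed
  have "card (matchings \<pi> I (insert \<Delta> R)) = card (matchings \<pi> I R) + (\<Sum>v\<in>?V. card (A v))"
  proof -
    have "card (\<Union>v\<in>?V. A v) = (\<Sum>v\<in>?V. card (A v))"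
    proof (rule card_UN_disjoint)
      show "\<forall>v\<in>?V. \<forall>w\<in>?V. v \<noteq> w \<longrightarrow> A v \<inter> A w = {}" using d2 by blast
    qed (use finA in auto)
    then show ?thesis unfolding eq using fin finA d1 by (subst card_Un_disjoint) (auto simp: finite_matchings)
  qed
  then show ?thesis unfolding match_count_def cA by simp
qed

lemma match_count_empty [simp]: "match_count \<pi> {} R = 1"
proof -
  have "matchings \<pi> {} R = {\<lambda>_. undefined}" unfolding matchings_def by auto
  then show ?thesis by (simp add: match_count_def)
qed

lemma match_count_isolated:
  assumes "w \<in> I" "\<And>\<Delta> v. \<Delta> \<in> R \<Longrightarrow> v \<in> corners \<Delta> \<Longrightarrow> \<pi> v \<noteq> w"
  shows "match_count \<pi> I R = 0"
proof -
  have "matchings \<pi> I R = {}" using assms by (auto simp: matchings_iff) (metis)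
  then show ?thesis by (simp add: match_count_def)
qed

lemma match_count_card:
  assumes "finite R" "card R < card I" shows "match_count \<pi> I R = 0"
proof -
  have "matchings \<pi> I R = {}"
  proof (rule ccontr)
    assume "matchings \<pi> I R \<noteq> {}"
    then obtain f where "f \<in> matchings \<pi> I R" by blast
    then have "inj_on (\<lambda>v. fst (f v)) I" "(\<lambda>v. fst (f v)) ` I \<subseteq> R"
      unfolding matchings_iff by auto
    then have "card I \<le> card R" using assms(1) card_inj_on_le by blast
    then show False using assms by simp
  qed
  then show ?thesis by (simp add: match_count_def)
qed

section \<open>Matchings of boundary points in the universal cover\<close>

definition bd_count :: "int set \<Rightarrow> ltri set \<Rightarrow> rat" where
  "bd_count J R = match_count id (Bd ` J) R"

lemma bd_count_empty [simp]: "bd_count {} R = 1"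
  by (simp add: bd_count_def)

definition inc :: "int \<Rightarrow> ltri \<Rightarrow> bool" where
  "inc v \<Delta> \<longleftrightarrow> Bd v \<in> corners \<Delta>"

lemma inc_simps [simp]: "inc v (Tri a b c) \<longleftrightarrow> v = a \<or> v = b \<or> v = c" "inc v (CTri a b) \<longleftrightarrow> v = a \<or> v = b"
  by (auto simp: inc_def)

lemma bd_count_insert:
  assumes "finite J" "finite R" "\<Delta> \<notin> R"
  shows "bd_count J (insert \<Delta> R) = bd_count J R + (\<Sum>v\<in>{v \<in> J. inc v \<Delta>}. bd_count (J - {v}) R)"
proof -
  have V: "{v \<in> corners \<Delta>. id v \<in> Bd ` J} = Bd ` {v \<in> J. inc v \<Delta>}" by (auto simp: inc_def)
  have im: "Bd ` J - {Bd v} = Bd ` (J - {v})" for v by auto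
  show ?thesis unfolding bd_count_def match_count_insert[OF finite_imageI[OF assms(1)] assms(2,3)] V
    by (subst sum.reindex) (simp_all add: inj_on_def im comp_def del: image_insert)
qed

lemma bd_count_isolated:
  assumes "w \<in> J" "\<And>\<Delta>. \<Delta> \<in> R \<Longrightarrow> \<not> inc w \<Delta>" shows "bd_count J R = 0"
  unfolding bd_count_def using assms by (intro match_count_isolated[of "Bd w"]) (auto simp: inc_def)

lemma bd_count_card: "finite R \<Longrightarrow> card R < card J \<Longrightarrow> bd_count J R = 0"
  unfolding bd_count_def by (rule match_count_card) (auto simp: card_image inj_on_def)

text \<open>Only regions incident with a point of \<open>J\<close> can be used. This replaces the
  infinite set of all lifted triangles by a finite one.\<close>

lemma bd_count_cong:
  assumes "\<And>\<Delta> v. v \<in> J \<Longrightarrow> inc v \<Delta> \<Longrightarrow> \<Delta> \<in> R \<longleftrightarrow> \<Delta> \<in> R'"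
  shows "bd_count J R = bd_count J R'"
proof -
  have sub: "matchings id (Bd ` J) R1 \<subseteq> matchings id (Bd ` J) R2"
    if R: "\<And>\<Delta> v. v \<in> J \<Longrightarrow> inc v \<Delta> \<Longrightarrow> \<Delta> \<in> R1 \<Longrightarrow> \<Delta> \<in> R2" for R1 R2
  proof
    fix f assume f: "f \<in> matchings id (Bd ` J) R1"
    have "fst (f w) \<in> R2" if w: "w \<in> Bd ` J" for w
    proof -
      obtain v where v: "v \<in> J" "w = Bd v" using w by blast
      have "fst (f w) \<in> R1" "snd (f w) \<in> corners (fst (f w))" "snd (f w) = w"
        using f w unfolding matchings_iff by auto
      then show ?thesis using R[of v "fst (f w)"] v by (simp add: inc_def)
    qed
    then show "f \<in> matchings id (Bd ` J) R2" using f unfolding matchings_iff by blast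
  qed
  have "matchings id (Bd ` J) R = matchings id (Bd ` J) R'"
    using assms by (intro equalityI sub) auto
  then show ?thesis by (simp add: match_count_def bd_count_def)
qed

lemma sum_collect_if3:
  fixes f :: "int \<Rightarrow> rat"
  assumes "finite J" "a \<noteq> b" "a \<noteq> c" "b \<noteq> c"
  shows "(\<Sum>v\<in>{v \<in> J. v = a \<or> v = b \<or> v = c}. f v) =
    (if a \<in> J then f a else 0) + (if b \<in> J then f b else 0) + (if c \<in> J then f c else 0)"
proof -
  have "{v \<in> J. v = a \<or> v = b \<or> v = c} = {a, b, c} \<inter> J" by blast
  then show ?thesis using assms sum.inter_restrict[of "{a, b, c}" f J] by simp
qed

lemma sum_collect_if2:
  fixes f :: "int \<Rightarrow> rat"
  assumes "finite J" "a \<noteq> b"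
  shows "(\<Sum>v\<in>{v \<in> J. v = a \<or> v = b}. f v) = (if a \<in> J then f a else 0) + (if b \<in> J then f b else 0)"
proof -
  have "{v \<in> J. v = a \<or> v = b} = {a, b} \<inter> J" by blast
  then show ?thesis using assms sum.inter_restrict[of "{a, b}" f J] by simp
qed

lemma bd_count_Tri:
  assumes "finite J" "finite R" "Tri a b c \<notin> R" "a < b" "b < c"
  shows "bd_count J (insert (Tri a b c) R) = bd_count J R + (if a \<in> J then bd_count (J - {a}) R else 0)
     + (if b \<in> J then bd_count (J - {b}) R else 0) + (if c \<in> J then bd_count (J - {c}) R else 0)"
proof -
  have "a \<noteq> b" "a \<noteq> c" "b \<noteq> c" using assms by auto
  then show ?thesis
    unfolding bd_count_insert[OF assms(1-3)] inc_simps sum_collect_if3[OF assms(1) \<open>a \<noteq> b\<close> \<open>a \<noteq> c\<close> \<open>b \<noteq> c\<close>]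
    by (simp only: add.assoc)
qed

lemma bd_count_CTri:
  assumes "finite J" "finite R" "CTri a b \<notin> R" "a < b"
  shows "bd_count J (insert (CTri a b) R) = bd_count J R + (if a \<in> J then bd_count (J - {a}) R else 0)
     + (if b \<in> J then bd_count (J - {b}) R else 0)"
proof -
  have "a \<noteq> b" using assms by auto
  then show ?thesis
    unfolding bd_count_insert[OF assms(1-3)] inc_simps sum_collect_if2[OF assms(1) \<open>a \<noteq> b\<close>]
    by (simp only: add.assoc)
qed

lemma bd_count_Un:
  assumes "finite R1" "finite R2" "finite J1" "finite J2" "R1 \<inter> R2 = {}" "J1 \<inter> J2 = {}"
    "\<And>\<Delta> v. \<Delta> \<in> R1 \<Longrightarrow> v \<in> J2 \<Longrightarrow> \<not> inc v \<Delta>" "\<And>\<Delta> v. \<Delta> \<in> R2 \<Longrightarrow> v \<in> J1 \<Longrightarrow> \<not> inc v \<Delta>"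
  shows "bd_count (J1 \<union> J2) (R1 \<union> R2) = bd_count J1 R1 * bd_count J2 R2"
  using assms
proof (induction R1 arbitrary: J1 rule: finite_induct)
  case empty
  show ?case
  proof (cases "J1 = {}")
    case False
    then obtain w where "w \<in> J1" by blast
    then have "bd_count (J1 \<union> J2) ({} \<union> R2) = 0" "bd_count J1 {} = 0"
      using empty by (auto intro!: bd_count_isolated[of w])
    then show ?thesis by simp
  qed simp
next
  case (insert \<Delta> R1)
  have IH: "bd_count (J \<union> J2) (R1 \<union> R2) = bd_count J R1 * bd_count J2 R2" if "J \<subseteq> J1" for J
    by (rule insert.IH) (use insert.prems that in \<open>auto intro: finite_subset\<close>)
  have V: "{v \<in> J1 \<union> J2. inc v \<Delta>} = {v \<in> J1. inc v \<Delta>}" using insert.prems by auto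
  have "bd_count (J1 \<union> J2) (insert \<Delta> (R1 \<union> R2)) = bd_count (J1 \<union> J2) (R1 \<union> R2)
     + (\<Sum>v\<in>{v \<in> J1 \<union> J2. inc v \<Delta>}. bd_count (J1 \<union> J2 - {v}) (R1 \<union> R2))"
    using insert by (intro bd_count_insert) auto
  also have "\<dots> = bd_count J1 R1 * bd_count J2 R2 + (\<Sum>v\<in>{v \<in> J1. inc v \<Delta>}. bd_count (J1 - {v}) R1 * bd_count J2 R2)"
    unfolding V
  proof (intro arg_cong2[of _ _ _ _ "(+)"] IH sum.cong refl)
    fix v assume "v \<in> {v \<in> J1. inc v \<Delta>}"
    then have "J1 \<union> J2 - {v} = (J1 - {v}) \<union> J2" using insert.prems by auto
    then show "bd_count (J1 \<union> J2 - {v}) (R1 \<union> R2) = bd_count (J1 - {v}) R1 * bd_count J2 R2"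
      using IH[of "J1 - {v}"] by auto
  qed auto
  also have "\<dots> = bd_count J1 (insert \<Delta> R1) * bd_count J2 R2"
    using insert by (simp add: bd_count_insert distrib_right sum_distrib_right)
  finally show ?case by simp
qed

text \<open>The point \<open>\<beta>\<close> at which the two pieces meet is matched on one side or
  on the other.\<close>

lemma bd_count_Un_shared:
  assumes "finite R1" "finite R2" "finite J1" "finite J2" "R1 \<inter> R2 = {}" "J1 \<inter> J2 = {}" "\<beta> \<notin> J1" "\<beta> \<notin> J2"
    "\<And>\<Delta> v. \<Delta> \<in> R1 \<Longrightarrow> v \<in> J2 \<Longrightarrow> \<not> inc v \<Delta>" "\<And>\<Delta> v. \<Delta> \<in> R2 \<Longrightarrow> v \<in> J1 \<Longrightarrow> \<not> inc v \<Delta>"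
  shows "bd_count (insert \<beta> (J1 \<union> J2)) (R1 \<union> R2) =
    bd_count (insert \<beta> J1) R1 * bd_count J2 R2 + bd_count J1 R1 * bd_count (insert \<beta> J2) R2"
  using assms
proof (induction R1 arbitrary: J1 rule: finite_induct)
  case empty
  have z: "bd_count (insert \<beta> J1) {} = 0" by (rule bd_count_isolated[of \<beta>]) auto
  show ?case
  proof (cases "J1 = {}")
    case False
    then obtain w where "w \<in> J1" by blast
    then have "bd_count (insert \<beta> (J1 \<union> J2)) ({} \<union> R2) = 0" "bd_count J1 {} = 0"
      using empty by (auto intro!: bd_count_isolated[of w])
    then show ?thesis using z by simp
  next
    case True
    then show ?thesis using z by simp
  qed
next
  case (insert \<Delta> R1)
  have IH: "bd_count (insert \<beta> (J \<union> J2)) (R1 \<union> R2) =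
    bd_count (insert \<beta> J) R1 * bd_count J2 R2 + bd_count J R1 * bd_count (insert \<beta> J2) R2" if "J \<subseteq> J1" for J
    by (rule insert.IH) (use insert.prems that in \<open>auto intro: finite_subset\<close>)
  have prod: "bd_count (J1 \<union> J2) (R1 \<union> R2) = bd_count J1 R1 * bd_count J2 R2"
    by (rule bd_count_Un) (use insert in auto)
  let ?V = "{v \<in> J1. inc v \<Delta>}"
  have \<beta>s: "(\<Sum>v\<in>{v \<in> insert \<beta> J. inc v \<Delta>}. f v) = (if inc \<beta> \<Delta> then f \<beta> else 0) + (\<Sum>v\<in>{v \<in> J. inc v \<Delta>}. f v)"
    if "finite J" "\<beta> \<notin> J" for J and f :: "int \<Rightarrow> rat"
  proof -
    have "{v \<in> insert \<beta> J. inc v \<Delta>} = (if inc \<beta> \<Delta> then {\<beta>} else {}) \<union> {v \<in> J. inc v \<Delta>}" by auto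
    then show ?thesis using that by simp
  qed
  have V: "{v \<in> J1 \<union> J2. inc v \<Delta>} = ?V" using insert.prems by auto
  have "bd_count (insert \<beta> (J1 \<union> J2)) (insert \<Delta> (R1 \<union> R2)) = bd_count (insert \<beta> (J1 \<union> J2)) (R1 \<union> R2)
     + (\<Sum>v\<in>{v \<in> insert \<beta> (J1 \<union> J2). inc v \<Delta>}. bd_count (insert \<beta> (J1 \<union> J2) - {v}) (R1 \<union> R2))"
    using insert by (intro bd_count_insert) auto
  also have "\<dots> = bd_count (insert \<beta> (J1 \<union> J2)) (R1 \<union> R2)
     + ((if inc \<beta> \<Delta> then bd_count (J1 \<union> J2) (R1 \<union> R2) else 0)
     + (\<Sum>v\<in>?V. bd_count (insert \<beta> ((J1 - {v}) \<union> J2)) (R1 \<union> R2)))"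
  proof -
    have f: "finite (J1 \<union> J2)" "\<beta> \<notin> J1 \<union> J2" using insert.prems by auto
    have "insert \<beta> (J1 \<union> J2) - {v} = insert \<beta> ((J1 - {v}) \<union> J2)" if "v \<in> ?V" for v
      using that insert.prems by auto
    then have "(\<Sum>v\<in>?V. bd_count (insert \<beta> (J1 \<union> J2) - {v}) (R1 \<union> R2))
       = (\<Sum>v\<in>?V. bd_count (insert \<beta> ((J1 - {v}) \<union> J2)) (R1 \<union> R2))" by (intro sum.cong) auto
    moreover have "insert \<beta> (J1 \<union> J2) - {\<beta>} = J1 \<union> J2" using insert.prems by auto
    ultimately show ?thesis unfolding \<beta>s[OF f] V by simp
  qed
  also have "\<dots> = (bd_count (insert \<beta> J1) R1 * bd_count J2 R2 + bd_count J1 R1 * bd_count (insert \<beta> J2) R2)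
     + ((if inc \<beta> \<Delta> then bd_count J1 R1 * bd_count J2 R2 else 0)
     + (\<Sum>v\<in>?V. bd_count (insert \<beta> (J1 - {v})) R1 * bd_count J2 R2 + bd_count (J1 - {v}) R1 * bd_count (insert \<beta> J2) R2))"
  proof -
    have "(\<Sum>v\<in>?V. bd_count (insert \<beta> ((J1 - {v}) \<union> J2)) (R1 \<union> R2))
      = (\<Sum>v\<in>?V. bd_count (insert \<beta> (J1 - {v})) R1 * bd_count J2 R2 + bd_count (J1 - {v}) R1 * bd_count (insert \<beta> J2) R2)"
      by (rule sum.cong[OF refl], rule IH) blast
    then show ?thesis unfolding prod IH[OF order_refl] by simp
  qed
  also have "\<dots> = bd_count (insert \<beta> J1) (insert \<Delta> R1) * bd_count J2 R2 + bd_count J1 (insert \<Delta> R1) * bd_count (insert \<beta> J2) R2"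
  proof -
    have f: "finite J1" "\<beta> \<notin> J1" using insert.prems by auto
    have "insert \<beta> J1 - {v} = insert \<beta> (J1 - {v})" if "v \<in> ?V" for v
      using that insert.prems by auto
    then have "(\<Sum>v\<in>?V. bd_count (insert \<beta> J1 - {v}) R1) = (\<Sum>v\<in>?V. bd_count (insert \<beta> (J1 - {v})) R1)"
      by (intro sum.cong) auto
    moreover have "insert \<beta> J1 - {\<beta>} = J1" using insert.prems by auto
    moreover have "bd_count (insert \<beta> J1) (insert \<Delta> R1) = bd_count (insert \<beta> J1) R1
       + (\<Sum>v\<in>{v \<in> insert \<beta> J1. inc v \<Delta>}. bd_count (insert \<beta> J1 - {v}) R1)"
      using insert by (intro bd_count_insert) auto
    ultimately have "bd_count (insert \<beta> J1) (insert \<Delta> R1) = bd_count (insert \<beta> J1) R1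
       + ((if inc \<beta> \<Delta> then bd_count J1 R1 else 0) + (\<Sum>v\<in>?V. bd_count (insert \<beta> (J1 - {v})) R1))"
      unfolding \<beta>s[OF f] by simp
    moreover have "bd_count J1 (insert \<Delta> R1) = bd_count J1 R1 + (\<Sum>v\<in>?V. bd_count (J1 - {v}) R1)"
      using insert by (simp add: bd_count_insert)
    ultimately show ?thesis
      by (simp add: distrib_right sum_distrib_right sum.distrib)
  qed
  finally show ?case by simp
qed

subsection \<open>Polygons triangulated by a slice\<close>

text \<open>\<open>fan p q R Q\<close>: the polygon with vertices \<open>p, \<dots>, q\<close> is triangulated by \<open>R\<close>, and \<open>Q\<close> are its diagonals
  together with the side \<open>(p, q)\<close>; it grows from a boundary segment by adding one triangle at a time
  on the outermost side.\<close>

inductive fan :: "int \<Rightarrow> int \<Rightarrow> ltri set \<Rightarrow> (int \<times> int) set \<Rightarrow> bool" where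
  base: "fan p (p + 1) {} {}"
| right: "fan p q R Q \<Longrightarrow> fan p (q + 1) (insert (Tri p q (q + 1)) R) (insert (p, q + 1) Q)"
| left: "fan p q R Q \<Longrightarrow> fan (p - 1) q (insert (Tri (p - 1) p q) R) (insert (p - 1, q) Q)"

lemma fan_less: "fan p q R Q \<Longrightarrow> p < q"
  by (induction rule: fan.induct) auto

lemma fan_finite: "fan p q R Q \<Longrightarrow> finite R"
  by (induction rule: fan.induct) auto

lemma fan_card: "fan p q R Q \<Longrightarrow> int (card R) \<le> q - p - 1"
proof (induction rule: fan.induct)
  case (right p q R Q)
  then show ?case by (simp add: card_insert_if fan_finite)
next
  case (left p q R Q)
  then show ?case by (simp add: card_insert_if fan_finite)
qed simp

lemma fan_tri: "fan p q R Q \<Longrightarrow> \<Delta> \<in> R \<Longrightarrow> \<exists>a b c. \<Delta> = Tri a b c \<and> p \<le> a \<and> a < b \<and> b < c \<and> c \<le> q"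
proof (induction rule: fan.induct)
  case (right p q R Q)
  then show ?case using fan_less[OF right.hyps] by fastforce
next
  case (left p q R Q)
  then show ?case using fan_less[OF left.hyps] by fastforce
qed simp

lemma fan_inc: "fan p q R Q \<Longrightarrow> \<Delta> \<in> R \<Longrightarrow> inc v \<Delta> \<Longrightarrow> p \<le> v \<and> v \<le> q"
  using fan_tri[of p q R Q \<Delta>] by auto

lemma fan_diag: "fan p q R Q \<Longrightarrow> (a, b) \<in> Q \<Longrightarrow> p \<le> a \<and> a + 2 \<le> b \<and> b \<le> q"
proof (induction rule: fan.induct)
  case (right p q R Q)
  then show ?case using fan_less[OF right.hyps] by auto
next
  case (left p q R Q)
  then show ?case using fan_less[OF left.hyps] by auto
qed simp

lemma fan_outer: "fan p q R Q \<Longrightarrow> q = p + 1 \<or> (p, q) \<in> Q"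
  by (induction rule: fan.induct) auto

text \<open>The newest vertex is an end of just one diagonal, the new outer side; so the triangle
  just added is the only new closed triple of sides and diagonals.\<close>

lemma fan_triangles:
  assumes "fan p q R Q"
  shows "Tri a b c \<in> R \<longleftrightarrow> a < b \<and> b < c \<and> (b = a + 1 \<or> (a, b) \<in> Q) \<and> (c = b + 1 \<or> (b, c) \<in> Q) \<and> (a, c) \<in> Q"
  using assms
proof (induction arbitrary: a b c rule: fan.induct)
  case (right p q R Q)
  note d = fan_diag[OF right.hyps] and l = fan_less[OF right.hyps]
  have "Tri a b c \<in> insert (Tri p q (q + 1)) R \<longleftrightarrow> (a = p \<and> b = q \<and> c = q + 1) \<or> Tri a b c \<in> R" by auto
  also have "\<dots> \<longleftrightarrow> (a = p \<and> b = q \<and> c = q + 1) \<or>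
     (a < b \<and> b < c \<and> (b = a + 1 \<or> (a, b) \<in> Q) \<and> (c = b + 1 \<or> (b, c) \<in> Q) \<and> (a, c) \<in> Q)"
    using right.IH by blast
  also have "\<dots> \<longleftrightarrow> a < b \<and> b < c \<and> (b = a + 1 \<or> (a, b) \<in> insert (p, q + 1) Q) \<and>
     (c = b + 1 \<or> (b, c) \<in> insert (p, q + 1) Q) \<and> (a, c) \<in> insert (p, q + 1) Q"
    using d[of a b] d[of b c] d[of a c] l fan_outer[OF right.hyps] by auto
  finally show ?case .
next
  case (left p q R Q)
  note d = fan_diag[OF left.hyps] and l = fan_less[OF left.hyps]
  have "Tri a b c \<in> insert (Tri (p - 1) p q) R \<longleftrightarrow> (a = p - 1 \<and> b = p \<and> c = q) \<or> Tri a b c \<in> R" by auto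
  also have "\<dots> \<longleftrightarrow> (a = p - 1 \<and> b = p \<and> c = q) \<or>
     (a < b \<and> b < c \<and> (b = a + 1 \<or> (a, b) \<in> Q) \<and> (c = b + 1 \<or> (b, c) \<in> Q) \<and> (a, c) \<in> Q)"
    using left.IH by blast
  also have "\<dots> \<longleftrightarrow> a < b \<and> b < c \<and> (b = a + 1 \<or> (a, b) \<in> insert (p - 1, q) Q) \<and>
     (c = b + 1 \<or> (b, c) \<in> insert (p - 1, q) Q) \<and> (a, c) \<in> insert (p - 1, q) Q"
    using d[of a b] d[of b c] d[of a c] l fan_outer[OF left.hyps] by auto
  finally show ?case .
qed simp

lemma fan_shift: "fan p q R Q \<Longrightarrow> fan (p + s) (q + s) (shift_tri s ` R) ((\<lambda>(a, b). (a + s, b + s)) ` Q)"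
proof (induction rule: fan.induct)
  case (base p)
  then show ?case using fan.base[of "p + s"] by (simp add: algebra_simps)
next
  case (right p q R Q)
  then show ?case using fan.right[OF right.IH] by (simp add: algebra_simps)
next
  case (left p q R Q)
  then show ?case using fan.left[OF left.IH] by (simp add: algebra_simps)
qed

text \<open>Inserting the vertex opposite to the outermost side adds the weights of the two end points: this
  determines the lambda lengths of the central arcs from the outside to the inside.\<close>

lemma mult_eq_1_divide: "a * u = 1 \<Longrightarrow> u = 1 / (a :: rat)"
  by (cases "a = 0") (auto simp: eq_divide_eq mult.commute)

lemma fan_weights:
  assumes "fan p q R Q" "A > 0" "B > 0"
  shows "\<exists>c :: int \<Rightarrow> rat. c p = A \<and> c q = B \<and> (\<forall>x. c x > 0) \<and>
    (\<forall>t. (\<forall>x. p \<le> x \<longrightarrow> x < q \<longrightarrow> t (x + 1) = t x + 1 / (c x * c (x + 1))) \<longrightarrow>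
       (\<forall>(a, b)\<in>insert (p, q) Q. c a * c b * (t b - t a) = 1))"
  using assms
proof (induction arbitrary: A B rule: fan.induct)
  case (base p)
  define c where "c = (\<lambda>x. if x = p then A else B)"
  \<comment> \<open>The claim concerns every \<open>t\<close> with the right increments on the
    polygon, because the global \<open>t\<close> can be built only after the weights have been
    extended periodically.\<close>
  have "c p * c (p + 1) * (t (p + 1) - t p) = 1"
    if "\<forall>x. p \<le> x \<longrightarrow> x < p + 1 \<longrightarrow> t (x + 1) = t x + 1 / (c x * c (x + 1))" for t
    using that[rule_format, of p] base by (simp add: c_def)
  then show ?case using base by (intro exI[of _ c]) (auto simp: c_def)
next
  case (right p q R Q)
  have l: "p < q" using fan_less[OF right.hyps] .
  obtain c0 where c0: "c0 p = A" "c0 q = A + B" "\<And>x. c0 x > 0"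
    and t0: "\<And>t. (\<forall>x. p \<le> x \<longrightarrow> x < q \<longrightarrow> t (x + 1) = t x + 1 / (c0 x * c0 (x + 1))) \<Longrightarrow>
       (\<forall>(a, b)\<in>insert (p, q) Q. c0 a * c0 b * (t b - t a) = 1)"
    using right.IH[of A "A + B"] right.prems by auto
  define c where "c = c0(q + 1 := B)"
  have cc: "c x = c0 x" if "x \<le> q" for x using that by (simp add: c_def)
  have "\<forall>(a, b)\<in>insert (p, q + 1) (insert (p, q + 1) Q). c a * c b * (t b - t a) = 1"
    if t: "\<forall>x. p \<le> x \<longrightarrow> x < q + 1 \<longrightarrow> t (x + 1) = t x + 1 / (c x * c (x + 1))" for t
  proof -
    have "t (x + 1) = t x + 1 / (c0 x * c0 (x + 1))" if "p \<le> x" "x < q" for x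
      using t[rule_format, of x] that cc by simp
    then have Q: "\<forall>(a, b)\<in>insert (p, q) Q. c0 a * c0 b * (t b - t a) = 1" by (intro t0) auto
    then have "A * (A + B) * (t q - t p) = 1" using c0 by auto
    then have tq: "t q - t p = 1 / (A * (A + B))" by (rule mult_eq_1_divide)
    have "t (q + 1) - t q = 1 / ((A + B) * B)"
      using t[rule_format, of q] l c0 by (simp add: c_def)
    then have "t (q + 1) - t p = 1 / (A * (A + B)) + 1 / ((A + B) * B)" using tq by simp
    also have "\<dots> = 1 / (A * B)"
    proof -
      have "A + B \<noteq> 0" "A \<noteq> 0" "B \<noteq> 0" using right.prems by auto
      then show ?thesis by (simp add: divide_simps)
    qed
    finally have "c p * c (q + 1) * (t (q + 1) - t p) = 1"
      using right.prems c0 l by (simp add: c_def)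
    moreover have "c a * c b * (t b - t a) = 1" if "(a, b) \<in> Q" for a b
      using Q that fan_diag[OF right.hyps that] cc by auto
    ultimately show ?thesis by auto
  qed
  then show ?case using c0 right.prems l by (intro exI[of _ c]) (auto simp: c_def)
next
  case (left p q R Q)
  have l: "p < q" using fan_less[OF left.hyps] .
  obtain c0 where c0: "c0 p = A + B" "c0 q = B" "\<And>x. c0 x > 0"
    and t0: "\<And>t. (\<forall>x. p \<le> x \<longrightarrow> x < q \<longrightarrow> t (x + 1) = t x + 1 / (c0 x * c0 (x + 1))) \<Longrightarrow>
       (\<forall>(a, b)\<in>insert (p, q) Q. c0 a * c0 b * (t b - t a) = 1)"
    using left.IH[of "A + B" B] left.prems by auto
  define c where "c = c0(p - 1 := A)"
  have cc: "c x = c0 x" if "x \<ge> p" for x using that by (simp add: c_def)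
  have "\<forall>(a, b)\<in>insert (p - 1, q) (insert (p - 1, q) Q). c a * c b * (t b - t a) = 1"
    if t: "\<forall>x. p - 1 \<le> x \<longrightarrow> x < q \<longrightarrow> t (x + 1) = t x + 1 / (c x * c (x + 1))" for t
  proof -
    have "t (x + 1) = t x + 1 / (c0 x * c0 (x + 1))" if "p \<le> x" "x < q" for x
      using t[rule_format, of x] that cc by simp
    then have Q: "\<forall>(a, b)\<in>insert (p, q) Q. c0 a * c0 b * (t b - t a) = 1" by (intro t0) auto
    then have "(A + B) * B * (t q - t p) = 1" using c0 by auto
    then have tq: "t q - t p = 1 / ((A + B) * B)" by (rule mult_eq_1_divide)
    have "t p - t (p - 1) = 1 / (A * (A + B))"
      using t[rule_format, of "p - 1"] l c0 by (simp add: c_def)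
    then have "t q - t (p - 1) = 1 / (A * (A + B)) + 1 / ((A + B) * B)" using tq by simp
    also have "\<dots> = 1 / (A * B)"
    proof -
      have "A + B \<noteq> 0" "A \<noteq> 0" "B \<noteq> 0" using left.prems by auto
      then show ?thesis by (simp add: divide_simps)
    qed
    finally have "c (p - 1) * c q * (t q - t (p - 1)) = 1"
      using left.prems c0 l by (simp add: c_def)
    moreover have "c a * c b * (t b - t a) = 1" if "(a, b) \<in> Q" for a b
      using Q that fan_diag[OF left.hyps that] cc by auto
    ultimately show ?thesis by auto
  qed
  then show ?case using c0 left.prems l by (intro exI[of _ c]) (auto simp: c_def)
qed

section \<open>Lambda lengths as matching numbers in a fan\<close>

context lambda_data begin

lemma lam_same [simp]: "lam x x = 0" by (simp add: lam_def)

text \<open>Ptolemy's relation for \<open>p\<close>, \<open>x\<close>, \<open>q\<close>,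
  \<open>q + 1\<close>, where the triangle \<open>p\<close>, \<open>q\<close>, \<open>q + 1\<close>
  has all sides of length 1.\<close>

lemma lam_right:
  assumes "lam p q = 1" "lam p (q + 1) = 1" shows "lam x (q + 1) = lam p x + lam x q"
  using ptolemy[of p q x "q + 1"] assms by simp

lemma lam_left:
  assumes "lam p q = 1" "lam (p - 1) q = 1" shows "lam (p - 1) x = lam p x + lam x q"
  using ptolemy[of "p - 1" x p q] assms lam_unit[of "p - 1"] by simp

lemma fan_counts:
  assumes "fan p q R Q" "\<And>a b. (a, b) \<in> Q \<Longrightarrow> lam a b = 1"
  shows "(\<forall>x y. p \<le> x \<longrightarrow> x < y \<longrightarrow> y \<le> q \<longrightarrow> bd_count {x<..<y} R = lam x y) \<and>
    (\<forall>x. p \<le> x \<longrightarrow> x \<le> q \<longrightarrow> bd_count {x<..q} R = lam p x) \<and>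
    (\<forall>x. p \<le> x \<longrightarrow> x \<le> q \<longrightarrow> bd_count {p..<x} R = lam x q) \<and>
    (\<forall>x y. p \<le> x \<longrightarrow> x < y \<longrightarrow> y \<le> q \<longrightarrow> bd_count ({p..q} - {x, y}) R = lam x y)"
  using assms
proof (induction rule: fan.induct)
  case (base p)
  have z: "bd_count J {} = 0" if "J \<noteq> {}" for J using that by (auto intro: bd_count_isolated)
  have c: "x = p \<or> x = p + 1" if "p \<le> x" "x \<le> p + 1" for x :: int using that by linarith
  have s: "{p<..p + 1} = {p + 1}" "{p..<p + 1} = {p}" "{p<..<p + 1} = {}" "{p..p + 1} - {p, p + 1} = {}" by auto
  show ?case
  proof (intro conjI allI impI)
    fix x y assume "p \<le> x" "x < y" "y \<le> p + 1"
    then have "x = p" "y = p + 1" by auto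
    then show "bd_count {x<..<y} {} = lam x y" "bd_count ({p..p + 1} - {x, y}) {} = lam x y"
      unfolding s by (simp_all only: s bd_count_empty lam_unit)
  next
    fix x assume x: "p \<le> x" "x \<le> p + 1"
    show "bd_count {x<..p + 1} {} = lam p x" using c[OF x] s z by auto
    show "bd_count {p..<x} {} = lam x (p + 1)" using c[OF x] s z by auto
  qed
next
  case (right p q R Q)
  have IH1: "\<And>x y. p \<le> x \<Longrightarrow> x < y \<Longrightarrow> y \<le> q \<Longrightarrow> bd_count {x<..<y} R = lam x y"
    and IH2: "\<And>x. p \<le> x \<Longrightarrow> x \<le> q \<Longrightarrow> bd_count {x<..q} R = lam p x"
    and IH3: "\<And>x. p \<le> x \<Longrightarrow> x \<le> q \<Longrightarrow> bd_count {p..<x} R = lam x q"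
    and IH4: "\<And>x y. p \<le> x \<Longrightarrow> x < y \<Longrightarrow> y \<le> q \<Longrightarrow> bd_count ({p..q} - {x, y}) R = lam x y"
    using right by auto
  note f = right.hyps
  have l: "p < q" using fan_less[OF f] .
  have pq: "lam p q = 1" using fan_outer[OF f] right.prems by auto
  have pq1: "lam p (q + 1) = 1" using right.prems by auto
  note lr = lam_right[OF pq pq1]
  \<comment> \<open>The new vertex lies on no older triangle and can be matched to the outer one
    only.\<close>
  have iso: "bd_count J R = 0" if "q + 1 \<in> J" for J
    using that fan_inc[OF f, of _ "q + 1"] by (intro bd_count_isolated[of "q + 1"]) auto
  have notin: "Tri p q (q + 1) \<notin> R" using fan_tri[OF f, of "Tri p q (q + 1)"] by auto
  note G = bd_count_Tri[OF _ fan_finite[OF f] notin l, of _, simplified]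
  \<comment> \<open>There are at most \<open>q - p - 1\<close> older triangles, so leaving out at
    most one of the points from \<open>p\<close> to \<open>q\<close> forces the use of the outer
    triangle.\<close>
  have card0: "bd_count J R = 0" if "int (card J) > q - p - 1" for J
    using that fan_card[OF f] fan_finite[OF f] by (intro bd_count_card) auto
  show ?case
  proof (intro conjI allI impI)
    fix x y assume xy: "p \<le> x" "x < y" "y \<le> q + 1"
    show "bd_count {x<..<y} (insert (Tri p q (q + 1)) R) = lam x y"
    proof (cases "y = q + 1")
      case False
      then show ?thesis using xy by (simp add: G IH1)
    next
      case True
      show ?thesis
      proof (cases "x = q")
        case True
        then have "{x<..<y} = {}" using \<open>y = q + 1\<close> by auto
        then show ?thesis using True \<open>y = q + 1\<close> by simp
      next
        case False
        have e: "{x<..<y} = {x<..q}" "{x<..q} - {q} = {x<..<q}" using True xy by auto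
        show ?thesis unfolding e(1) using True False xy by (simp add: G e(2) IH1 IH2 lr)
      qed
    qed
  next
    fix x assume x: "p \<le> x" "x \<le> q + 1"
    show "bd_count {x<..q + 1} (insert (Tri p q (q + 1)) R) = lam p x"
    proof (cases "x = q + 1")
      case True
      then show ?thesis using pq1 by simp
    next
      case False
      have e: "{x<..q + 1} - {q + 1} = {x<..q}" by auto
      show ?thesis using False x by (simp add: G e IH2 iso)
    qed
  next
    fix x assume x: "p \<le> x" "x \<le> q + 1"
    show "bd_count {p..<x} (insert (Tri p q (q + 1)) R) = lam x (q + 1)"
    proof (cases "x = q + 1")
      case True
      have e: "{p..<x} - {p} = {p<..q}" "{p..<x} - {q} = {p..<q}" using True l by auto
      have "bd_count {p..<x} R = 0" using True by (intro card0) simp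
      then show ?thesis using True l x e by (simp add: G IH2 IH3)
    next
      case False
      have e: "{p..<x} - {p} = {p<..<x}" by auto
      show ?thesis
      proof (cases "x = p")
        case True
        then show ?thesis using pq1 by simp
      next
        case F: False
        then show ?thesis using False x by (simp add: G e IH1 IH3 lr)
      qed
    qed
  next
    fix x y assume xy: "p \<le> x" "x < y" "y \<le> q + 1"
    show "bd_count ({p..q + 1} - {x, y}) (insert (Tri p q (q + 1)) R) = lam x y"
    proof (cases "y = q + 1")
      case False
      have e: "{p..q + 1} - {x, y} - {q + 1} = {p..q} - {x, y}" by auto
      show ?thesis using xy l False by (simp add: G e IH4 iso)
    next
      case True
      have e: "{p..q + 1} - {x, y} = {p..q} - {x}" using True by auto
      have e2: "{p..q} - {x} - {p} = {p..q} - {p, x}" "{p..q} - {x} - {q} = {p..q} - {x, q}" by auto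
      have c0: "bd_count ({p..q} - {x}) R = 0" using True xy by (intro card0) (simp add: card_Diff_singleton)
      have a: "x \<noteq> p \<Longrightarrow> bd_count ({p..q} - {x} - {p}) R = lam p x" "x \<noteq> q \<Longrightarrow> bd_count ({p..q} - {x} - {q}) R = lam x q"
        unfolding e2 using xy True by (auto intro!: IH4)
      show ?thesis unfolding e unfolding True using xy l a c0 lr[of x] pq1
        by (cases "x = p"; cases "x = q") (simp_all add: G)
    qed
  qed
next
  case (left p q R Q)
  have IH1: "\<And>x y. p \<le> x \<Longrightarrow> x < y \<Longrightarrow> y \<le> q \<Longrightarrow> bd_count {x<..<y} R = lam x y"
    and IH2: "\<And>x. p \<le> x \<Longrightarrow> x \<le> q \<Longrightarrow> bd_count {x<..q} R = lam p x"
    and IH3: "\<And>x. p \<le> x \<Longrightarrow> x \<le> q \<Longrightarrow> bd_count {p..<x} R = lam x q"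
    and IH4: "\<And>x y. p \<le> x \<Longrightarrow> x < y \<Longrightarrow> y \<le> q \<Longrightarrow> bd_count ({p..q} - {x, y}) R = lam x y"
    using left by auto
  note f = left.hyps
  have l: "p < q" using fan_less[OF f] .
  have pq: "lam p q = 1" using fan_outer[OF f] left.prems by auto
  have pq1: "lam (p - 1) q = 1" using left.prems by auto
  have up: "lam (p - 1) p = 1" using lam_unit[of "p - 1"] by simp
  note lr = lam_left[OF pq pq1]
  have iso: "bd_count J R = 0" if "p - 1 \<in> J" for J
    using that fan_inc[OF f, of _ "p - 1"] by (intro bd_count_isolated[of "p - 1"]) auto
  have notin: "Tri (p - 1) p q \<notin> R" using fan_tri[OF f, of "Tri (p - 1) p q"] by auto
  note G = bd_count_Tri[OF _ fan_finite[OF f] notin _ l, of _, simplified]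
  have card0: "bd_count J R = 0" if "int (card J) > q - p - 1" for J
    using that fan_card[OF f] fan_finite[OF f] by (intro bd_count_card) auto
  show ?case
  proof (intro conjI allI impI)
    fix x y assume xy: "p - 1 \<le> x" "x < y" "y \<le> q"
    show "bd_count {x<..<y} (insert (Tri (p - 1) p q) R) = lam x y"
    proof (cases "x = p - 1")
      case False
      then show ?thesis using xy by (simp add: G IH1)
    next
      case True
      show ?thesis
      proof (cases "y = p")
        case y: True
        then have "{x<..<y} = {}" using True by auto
        then show ?thesis using True y up by simp
      next
        case False
        have e: "{x<..<y} = {p..<y}" "{p..<y} - {p} = {p<..<y}" using True xy by auto
        show ?thesis unfolding e(1) using True False xy by (simp add: G e(2) IH1 IH3 lr)
      qed
    qed
  next
    fix x assume x: "p - 1 \<le> x" "x \<le> q"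
    show "bd_count {x<..q} (insert (Tri (p - 1) p q) R) = lam (p - 1) x"
    proof (cases "x = p - 1")
      case True
      have e: "{x<..q} - {p} = {p<..q}" "{x<..q} - {q} = {p..<q}" using True l by auto
      have "bd_count {x<..q} R = 0" using True l by (intro card0) simp
      then show ?thesis using True l x e by (simp add: G IH2 IH3)
    next
      case False
      have e: "{x<..q} - {q} = {x<..<q}" by auto
      show ?thesis
      proof (cases "x = q")
        case True
        then show ?thesis using pq1 by simp
      next
        case F: False
        then show ?thesis using False x by (simp add: G e IH1 IH2 lr)
      qed
    qed
  next
    fix x assume x: "p - 1 \<le> x" "x \<le> q"
    show "bd_count {p - 1..<x} (insert (Tri (p - 1) p q) R) = lam x q"
    proof (cases "x = p - 1")
      case True
      then show ?thesis using pq1 by simp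
    next
      case False
      have e: "{p - 1..<x} - {p - 1} = {p..<x}" by auto
      show ?thesis using False x by (simp add: G e IH3 iso)
    qed
  next
    fix x y assume xy: "p - 1 \<le> x" "x < y" "y \<le> q"
    show "bd_count ({p - 1..q} - {x, y}) (insert (Tri (p - 1) p q) R) = lam x y"
    proof (cases "x = p - 1")
      case False
      have e: "{p - 1..q} - {x, y} - {p - 1} = {p..q} - {x, y}" by auto
      show ?thesis using xy l False by (simp add: G e IH4 iso)
    next
      case True
      have e: "{p - 1..q} - {x, y} = {p..q} - {y}" using True by auto
      have e2: "{p..q} - {y} - {p} = {p..q} - {p, y}" "{p..q} - {y} - {q} = {p..q} - {y, q}" by auto
      have c0: "bd_count ({p..q} - {y}) R = 0" using True xy by (intro card0) (simp add: card_Diff_singleton)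
      have a: "y \<noteq> p \<Longrightarrow> bd_count ({p..q} - {y} - {p}) R = lam p y" "y \<noteq> q \<Longrightarrow> bd_count ({p..q} - {y} - {q}) R = lam y q"
        unfolding e2 using xy True by (auto intro!: IH4)
      show ?thesis unfolding e unfolding True using xy l a c0 lr[of y] pq1 up
        by (cases "y = p"; cases "y = q") (simp_all add: G)
    qed
  qed
qed

end

text \<open>The fan covers one turn around the puncture. It ends at
  \<open>\<alpha> + int N - 1\<close> when the slice has two central arcs, and at
  \<open>\<alpha> + int N\<close> when its outer side is a loop around a single one; then the two
  \<open>spoke\<close> terms in \<open>T_eq\<close> coincide.\<close>

locale slice_tri = lambda_data +
  fixes T :: "arc set" and \<alpha> \<beta> :: int and R :: "ltri set" and Q :: "(int \<times> int) set"
  assumes fan: "fan \<alpha> \<beta> R Q" and len: "\<beta> = \<alpha> + int N - 1 \<or> \<beta> = \<alpha> + int N"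
    and T_eq: "T = (\<lambda>(a, b). parc N a b) ` Q \<union> {spoke N \<alpha>, spoke N \<beta>}"
    and lamQ: "(a, b) \<in> Q \<Longrightarrow> lam a b = 1" and c_ends: "c \<alpha> = 1" "c \<beta> = 1"
begin

text \<open>Deck transformations move the fundamental polygon to any given point, so the counts
  below are first made in the window that starts at \<open>\<alpha>\<close>.\<close>

lemma shifted: "slice_tri N c t S T (\<alpha> + k * int N) (\<beta> + k * int N) (shift_tri (k * int N) ` R)
    ((\<lambda>(a, b). (a + k * int N, b + k * int N)) ` Q)"
proof
  show "fan (\<alpha> + k * int N) (\<beta> + k * int N) (shift_tri (k * int N) ` R) ((\<lambda>(a, b). (a + k * int N, b + k * int N)) ` Q)"
    by (rule fan_shift[OF fan])
  show "T = (\<lambda>(a, b). parc N a b) ` (\<lambda>(a, b). (a + k * int N, b + k * int N)) ` Q \<union>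
      {spoke N (\<alpha> + k * int N), spoke N (\<beta> + k * int N)}"
    unfolding T_eq image_image by (simp add: case_prod_beta)
qed (use len lamQ c_ends in auto)

lemma side_iff: "lifted_side N T a b \<longleftrightarrow> b = a + 1 \<or> (\<exists>k. (a + k * int N, b + k * int N) \<in> Q)"
proof
  assume s: "lifted_side N T a b"
  show "b = a + 1 \<or> (\<exists>k. (a + k * int N, b + k * int N) \<in> Q)"
  proof (cases "b = a + 1")
    case False
    then have ab: "a + 2 \<le> b" "b \<le> a + int N" "parc N a b \<in> T" using s by (auto simp: lifted_side_def)
    then obtain a' b' where q: "(a', b') \<in> Q" "parc N a b = parc N a' b'" unfolding T_eq by auto
    have "a' < b'" "b' \<le> a' + int N" using fan_diag[OF fan q(1)] len by auto
    then obtain k where "a' = a + k * int N" "b' = b + k * int N" using parc_eqE[OF q(2)] ab by auto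
    then show ?thesis using q(1) by blast
  qed simp
next
  assume "b = a + 1 \<or> (\<exists>k. (a + k * int N, b + k * int N) \<in> Q)"
  then show "lifted_side N T a b"
  proof
    assume "\<exists>k. (a + k * int N, b + k * int N) \<in> Q"
    then obtain k where k: "(a + k * int N, b + k * int N) \<in> Q" by blast
    have l: "a + 2 \<le> b" "b \<le> a + int N" using fan_diag[OF fan k] len by auto
    have "parc N (a + k * int N) (b + k * int N) \<in> T" unfolding T_eq using k by force
    then show ?thesis using l by (simp add: lifted_side_def)
  qed (simp add: lifted_side_def)
qed

lemma spoke_iff: "lifted_spoke N T x \<longleftrightarrow> (\<exists>k. x = \<alpha> + k * int N \<or> x = \<beta> + k * int N)"
proof -
  have "lifted_spoke N T x \<longleftrightarrow> nrm N \<alpha> = nrm N x \<or> nrm N \<beta> = nrm N x"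
    unfolding lifted_spoke_def T_eq by auto
  then show ?thesis by (auto simp: nrm_eq_iff)
qed

text \<open>The triangles at the puncture up to deck transformations: the self-folded one in the
  case of a loop, otherwise one over the outer side of the fan and one over the boundary segment
  from \<open>\<beta>\<close> to \<open>\<alpha> + int N\<close>.\<close>

definition "CT = (if \<beta> = \<alpha> + int N then {CTri \<alpha> \<beta>} else {CTri \<alpha> \<beta>, CTri \<beta> (\<alpha> + int N)})"

lemma outer_side: "lifted_side N T \<alpha> \<beta>"
  unfolding side_iff using fan_outer[OF fan] by (metis add.right_neutral mult_zero_left)

text \<open>The sides of a lifted triangle are boundary segments or translated diagonals of the fan.
  As the fan spans at most \<open>N\<close>, a diagonal lying between \<open>\<alpha>\<close> and
  \<open>\<beta>\<close> cannot come from a nontrivial translate, so all sides of a triangle away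
  from the puncture come from the same copy of the fan.\<close>

lemma lifted_iff:
  "\<Delta> \<in> lifted_triangles N T \<longleftrightarrow> (\<exists>k. \<exists>\<Delta>0\<in>R \<union> CT. \<Delta> = shift_tri (k * int N) \<Delta>0)"
proof
  assume "\<exists>k. \<exists>\<Delta>0\<in>R \<union> CT. \<Delta> = shift_tri (k * int N) \<Delta>0"
  then obtain k \<Delta>0 where k: "\<Delta>0 \<in> R \<union> CT" "\<Delta> = shift_tri (k * int N) \<Delta>0" by blast
  have "\<Delta>0 \<in> lifted_triangles N T"
  proof (cases "\<Delta>0 \<in> R")
    case True
    then obtain a b x where t: "\<Delta>0 = Tri a b x" using fan_tri[OF fan] by blast
    then have "a < b \<and> b < x \<and> (b = a + 1 \<or> (a, b) \<in> Q) \<and> (x = b + 1 \<or> (b, x) \<in> Q) \<and> (a, x) \<in> Q"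
      using True fan_triangles[OF fan] by blast
    then show ?thesis unfolding t Tri_lifted side_iff
      by (metis add.right_neutral mult_zero_left)
  next
    case False
    have 1: "CTri \<alpha> \<beta> \<in> lifted_triangles N T"
      unfolding CTri_lifted spoke_iff using outer_side fan_less[OF fan]
      by (metis add.right_neutral mult_zero_left)
    have 2: "CTri \<beta> (\<alpha> + int N) \<in> lifted_triangles N T" if "\<beta> \<noteq> \<alpha> + int N"
    proof -
      have "lifted_side N T \<beta> (\<alpha> + int N)" unfolding side_iff using that len by simp
      moreover have "lifted_spoke N T \<beta>" "lifted_spoke N T (\<alpha> + int N)"
        unfolding spoke_iff by (metis add.right_neutral mult_zero_left) (metis mult_1)
      ultimately show ?thesis using that len by (simp add: CTri_lifted)
    qed
    show ?thesis using False k(1) 1 2 by (auto simp: CT_def split: if_splits)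
  qed
  then show "\<Delta> \<in> lifted_triangles N T" using k(2) by simp
next
  assume \<Delta>: "\<Delta> \<in> lifted_triangles N T"
  have bound: "\<beta> \<le> \<alpha> + int N" using len by auto
  have CT1: "CTri \<alpha> \<beta> \<in> CT" and CT2: "\<beta> \<noteq> \<alpha> + int N \<Longrightarrow> CTri \<beta> (\<alpha> + int N) \<in> CT"
    by (simp_all add: CT_def)
  show "\<exists>k. \<exists>\<Delta>0\<in>R \<union> CT. \<Delta> = shift_tri (k * int N) \<Delta>0"
  proof (cases \<Delta>)
    case (Tri a b x)
    then have s: "a < b" "b < x" "lifted_side N T a b" "lifted_side N T b x" "lifted_side N T a x"
      using \<Delta> by (auto simp: Tri_lifted)
    then obtain k where k: "(a + k * int N, x + k * int N) \<in> Q" unfolding side_iff by auto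
    define a' b' x' where "a' = a + k * int N" and "b' = b + k * int N" and "x' = x + k * int N"
    have q: "(a', x') \<in> Q" using k by (simp add: a'_def x'_def)
    have o: "a' < b'" "b' < x'" "\<alpha> \<le> a'" "x' \<le> \<beta>" using s fan_diag[OF fan q] by (auto simp: a'_def b'_def x'_def)
    have s': "lifted_side N T a' b'" "lifted_side N T b' x'" using s by (simp_all add: a'_def b'_def x'_def)
    have "b' = a' + 1 \<or> (a', b') \<in> Q"
    proof (rule ccontr)
      assume n: "\<not> ?thesis"
      then obtain j where j: "(a' + j * int N, b' + j * int N) \<in> Q" using s'(1) unfolding side_iff by blast
      then have "j \<noteq> 0" using n by auto
      then show False using fan_diag[OF fan j] o bound by (cases rule: shift_cases[of j N]) linarith+
    qed
    moreover have "x' = b' + 1 \<or> (b', x') \<in> Q"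
    proof (rule ccontr)
      assume n: "\<not> ?thesis"
      then obtain j where j: "(b' + j * int N, x' + j * int N) \<in> Q" using s'(2) unfolding side_iff by blast
      then have "j \<noteq> 0" using n by auto
      then show False using fan_diag[OF fan j] o bound by (cases rule: shift_cases[of j N]) linarith+
    qed
    ultimately have "Tri a' b' x' \<in> R" using fan_triangles[OF fan] q o by blast
    moreover have "\<Delta> = shift_tri ((-k) * int N) (Tri a' b' x')" using Tri by (simp add: a'_def b'_def x'_def)
    ultimately show ?thesis by blast
  next
    case (CTri a b)
    then have s: "a < b" "lifted_side N T a b" "lifted_spoke N T a" "lifted_spoke N T b"
      using \<Delta> by (auto simp: CTri_lifted)
    have ab: "b \<le> a + int N" using s(2) N3 by (auto simp: lifted_side_def)
    have noloop: False if "\<beta> \<noteq> \<alpha> + int N" "b = a + int N"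
    proof -
      have "b \<noteq> a + 1" using that N3 by simp
      then obtain k where k: "(a + k * int N, b + k * int N) \<in> Q" using s(2) unfolding side_iff by blast
      then show False using fan_diag[OF fan k] that len by auto
    qed
    obtain k where k: "a = \<alpha> + k * int N \<or> a = \<beta> + k * int N" using s(3) unfolding spoke_iff by blast
    obtain j where j: "b = \<alpha> + j * int N \<or> b = \<beta> + j * int N" using s(4) unfolding spoke_iff by blast
    have m: "j * int N = (j - k) * int N + k * int N" by (simp add: algebra_simps)
    have m2: "j * int N = (j - k - 1) * int N + k * int N + int N" by (simp add: algebra_simps)
    show ?thesis
    proof (cases "\<beta> = \<alpha> + int N")
      case True
      obtain k' where k': "a = \<alpha> + k' * int N"
      proof (cases "a = \<alpha> + k * int N")
        case False
        then have "a = \<alpha> + (k + 1) * int N" using k True by (simp add: algebra_simps)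
        then show ?thesis using that by blast
      qed (use that in blast)
      obtain j' where j': "b = \<alpha> + j' * int N"
      proof (cases "b = \<alpha> + j * int N")
        case False
        then have "b = \<alpha> + (j + 1) * int N" using j True by (simp add: algebra_simps)
        then show ?thesis using that by blast
      qed (use that in blast)
      have "b = a + (j' - k') * int N" using k' j' by (simp add: algebra_simps)
      then have "b = a + int N" using s(1) ab by (cases rule: shift_cases[of "j' - k'" N]) linarith+
      then have "\<Delta> = shift_tri (k' * int N) (CTri \<alpha> \<beta>)" using CTri k' True by simp
      then show ?thesis using CT1 by blast
    next
      case False
      then have \<beta>: "\<beta> = \<alpha> + int N - 1" using len by simp
      have eqN: "b \<noteq> a + int N" using noloop[OF False] by blast
      from k j consider "a = \<alpha> + k * int N" "b = \<beta> + j * int N" | "a = \<beta> + k * int N" "b = \<alpha> + j * int N"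
        | "b = a + (j - k) * int N" by (auto simp: algebra_simps)
      then show ?thesis
      proof cases
        case 1
        have "j = k" using 1 s(1) ab \<beta> m eqN by (cases rule: shift_cases[of "j - k" N]) linarith+
        then have "\<Delta> = shift_tri (k * int N) (CTri \<alpha> \<beta>)" using CTri 1 by simp
        then show ?thesis using CT1 by blast
      next
        case 2
        have "j = k + 1" using 2 s(1) ab \<beta> m2 eqN N3 by (cases rule: shift_cases[of "j - k - 1" N]) linarith+
        then have "\<Delta> = shift_tri (k * int N) (CTri \<beta> (\<alpha> + int N))" using CTri 2 by (simp add: algebra_simps)
        then show ?thesis using CT2[OF False] by blast
      next
        case 3
        then show ?thesis using s(1) ab eqN by (cases rule: shift_cases[of "j - k" N]) linarith+
      qed
    qed
  qed
qed

lemma lam_outer: "lam \<alpha> \<beta> = 1"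
  using fan_outer[OF fan] lamQ by auto

text \<open>Apply \<open>ptolemy_spoke\<close> to the outer side, which has length 1 and weight 1 at
  both ends.\<close>

lemma c_split: "c x = lam \<alpha> x + lam x \<beta>"
  using ptolemy_spoke[of \<alpha> \<beta> x] lam_outer c_ends by simp

lemma t_outer: "t \<beta> = t \<alpha> + 1"
  using lam_outer c_ends by (simp add: lam_def)

text \<open>Each triangle at the puncture raises \<open>t\<close> by 1, since all its sides have
  length 1.\<close>

lemma S_value: "S = (if \<beta> = \<alpha> + int N then 1 else 2)"
proof (cases "\<beta> = \<alpha> + int N")
  case True
  then show ?thesis using t_outer t_per[of \<alpha>] by simp
next
  case False
  then have "\<alpha> + int N = \<beta> + 1" using len by simp
  then have "t (\<alpha> + int N) = t \<beta> + 1" using t_step[of \<beta>] c_ends c_per[of \<alpha>] by simp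
  then show ?thesis using t_outer t_per[of \<alpha>] False by simp
qed

lemmas counts = fan_counts[OF fan lamQ]
lemmas count_open = counts[THEN conjunct1, rule_format]
lemmas count_right = counts[THEN conjunct2, THEN conjunct1, rule_format]
lemmas count_left = counts[THEN conjunct2, THEN conjunct2, THEN conjunct1, rule_format]
lemmas count_two = counts[THEN conjunct2, THEN conjunct2, THEN conjunct2, rule_format]

lemma finR: "finite R" using fan_finite[OF fan] .

lemma R_inc: "\<Delta> \<in> R \<Longrightarrow> inc v \<Delta> \<Longrightarrow> \<alpha> \<le> v \<and> v \<le> \<beta>" using fan_inc[OF fan] .

lemma CTri_notin: "CTri a b \<notin> R" using fan_tri[OF fan, of "CTri a b"] by auto

lemma inc_shift: "inc v (shift_tri s \<Delta>) \<longleftrightarrow> inc (v - s) \<Delta>"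
  by (cases \<Delta>) auto

lemma CT_inc: "\<Delta> \<in> CT \<Longrightarrow> inc v \<Delta> \<Longrightarrow> v = \<alpha> \<or> v = \<beta> \<or> v = \<alpha> + int N"
  by (auto simp: CT_def split: if_splits)

text \<open>A point strictly between \<open>\<alpha>\<close> and \<open>\<beta>\<close> lies on no
  triangles other than those of the fan.\<close>

lemma inner_count:
  assumes "\<alpha> \<le> x" "x < y" "y \<le> \<beta>"
  shows "bd_count {x<..<y} (lifted_triangles N T) = lam x y"
proof -
  have "\<Delta> \<in> lifted_triangles N T \<longleftrightarrow> \<Delta> \<in> R" if v: "v \<in> {x<..<y}" "inc v \<Delta>" for v \<Delta>
  proof
    assume "\<Delta> \<in> R"
    then show "\<Delta> \<in> lifted_triangles N T" unfolding lifted_iff by (intro exI[of _ 0]) auto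
  next
    assume "\<Delta> \<in> lifted_triangles N T"
    then obtain k \<Delta>0 where k: "\<Delta>0 \<in> R \<union> CT" "\<Delta> = shift_tri (k * int N) \<Delta>0" unfolding lifted_iff by blast
    have i: "inc (v - k * int N) \<Delta>0" using v(2) k(2) by (simp add: inc_shift)
    from k(1) show "\<Delta> \<in> R"
    proof
      assume R: "\<Delta>0 \<in> R"
      have "k = 0" using R_inc[OF R i] v(1) assms len by (cases rule: shift_cases[of k N]) auto
      then show ?thesis using R k(2) by simp
    next
      assume "\<Delta>0 \<in> CT"
      then have "v = \<alpha> + k * int N \<or> v = \<beta> + k * int N \<or> v = \<alpha> + int N + k * int N"
        using CT_inc[of \<Delta>0, OF _ i] by auto
      then have False using v(1) assms len by (cases rule: shift_cases[of k N]) auto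
      then show ?thesis ..
    qed
  qed
  then have "bd_count {x<..<y} (lifted_triangles N T) = bd_count {x<..<y} R" by (rule bd_count_cong)
  then show ?thesis using count_open assms by simp
qed

end

lemma shift_cases2:
  obtains "k = 0" "k * int N = 0" | "k = 1" "k * int N = int N" | "k * int N \<ge> 2 * int N" | "k * int N \<le> - int N"
proof -
  consider "k = 0" | "k = 1" | "k \<ge> 2" | "k \<le> -1" by linarith
  then show thesis
  proof cases
    case 3
    then show ?thesis using that(3) mult_right_mono[of 2 k "int N"] by simp
  next
    case 4
    then show ?thesis using that(4) mult_right_mono[of k "-1" "int N"] by simp
  qed (use that in simp_all)
qed

section \<open>Arcs that leave the fundamental polygon\<close>

context slice_tri begin

text \<open>The arc passes over \<open>\<beta>\<close>, where two copies of the fan and two lifts of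
  the self-folded triangle meet. So \<open>\<beta>\<close> is matched to one of these two lifts,
  which gives a factor 2, or within the fan on its left or on its right.\<close>

lemma straddle_loop:
  assumes \<beta>: "\<beta> = \<alpha> + int N" and x: "\<alpha> \<le> x" "x < \<beta>" and y: "\<beta> < y" "y < x + int N"
  shows "bd_count {x<..<y} (lifted_triangles N T) = lam x y"
proof -
  interpret s2: slice_tri N c t S T "\<alpha> + 1 * int N" "\<beta> + 1 * int N" "shift_tri (1 * int N) ` R"
    "(\<lambda>(a, b). (a + 1 * int N, b + 1 * int N)) ` Q" by (rule shifted)
  define R2 where "R2 = shift_tri (1 * int N) ` R"
  define W1 where "W1 = insert (CTri \<beta> (\<beta> + int N)) (R \<union> R2)"
  define W where "W = insert (CTri \<alpha> \<beta>) W1"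
  define J1 J2 where "J1 = {x<..<\<beta>}" and "J2 = {\<beta><..<y}"
  have CT: "CT = {CTri \<alpha> \<beta>}" unfolding CT_def using \<beta> by simp
  have "\<Delta> \<in> lifted_triangles N T \<longleftrightarrow> \<Delta> \<in> W" if v: "v \<in> {x<..<y}" "inc v \<Delta>" for v \<Delta>
  proof
    assume "\<Delta> \<in> W"
    then consider "\<Delta> \<in> R \<union> CT" | "\<exists>\<Delta>0\<in>R \<union> CT. \<Delta> = shift_tri (1 * int N) \<Delta>0"
      using \<beta> unfolding W_def W1_def R2_def CT by auto
    then show "\<Delta> \<in> lifted_triangles N T" unfolding lifted_iff by cases (metis shift_0 mult_zero_left, blast)
  next
    assume "\<Delta> \<in> lifted_triangles N T"
    then obtain k \<Delta>0 where k: "\<Delta>0 \<in> R \<union> CT" "\<Delta> = shift_tri (k * int N) \<Delta>0" unfolding lifted_iff by blast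
    have i: "inc (v - k * int N) \<Delta>0" using v(2) k(2) by (simp add: inc_shift)
    have "\<alpha> \<le> v - k * int N \<and> v - k * int N \<le> \<beta>" using k(1) R_inc[OF _ i] i \<beta> unfolding CT by auto
    then have "k = 0 \<or> k = 1" using v(1) x y \<beta> by (cases rule: shift_cases2[of k N]) auto
    then show "\<Delta> \<in> W" using k \<beta> unfolding W_def W1_def R2_def CT by auto
  qed
  then have "bd_count {x<..<y} (lifted_triangles N T) = bd_count {x<..<y} W" by (rule bd_count_cong)
  moreover have J: "{x<..<y} = insert \<beta> (J1 \<union> J2)" using x y by (auto simp: J1_def J2_def)
  have fin: "finite R2" "finite (R \<union> R2)" "finite W1" using finR by (auto simp: R2_def W1_def)
  have n1: "CTri \<beta> (\<beta> + int N) \<notin> R \<union> R2" using CTri_notin s2.CTri_notin unfolding R2_def by blast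
  have n2: "CTri \<alpha> \<beta> \<notin> W1" using CTri_notin s2.CTri_notin x unfolding R2_def W1_def by auto
  have less: "\<beta> < \<beta> + int N" "\<alpha> < \<beta>" using N3 \<beta> by auto
  have mem: "\<beta> \<in> insert \<beta> (J1 \<union> J2)" "\<alpha> \<notin> insert \<beta> (J1 \<union> J2)" "\<beta> + int N \<notin> insert \<beta> (J1 \<union> J2)" "\<beta> \<notin> J1 \<union> J2"
      "\<beta> + int N \<notin> J1 \<union> J2" "insert \<beta> (J1 \<union> J2) - {\<beta>} = J1 \<union> J2"
    using x y less by (auto simp: J1_def J2_def)
  have finJ: "finite J1" "finite J2" "finite (J1 \<union> J2)" "finite (insert \<beta> (J1 \<union> J2))" by (auto simp: J1_def J2_def)
  have "bd_count (insert \<beta> (J1 \<union> J2)) W = bd_count (insert \<beta> (J1 \<union> J2)) (R \<union> R2) + 2 * bd_count (J1 \<union> J2) (R \<union> R2)"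
    unfolding W_def bd_count_CTri[OF finJ(4) fin(3) n2 less(2)]
    unfolding W1_def bd_count_CTri[OF finJ(4) fin(2) n1 less(1)] mem(6) bd_count_CTri[OF finJ(3) fin(2) n1 less(1)]
    using mem by simp
  moreover have disj: "R \<inter> R2 = {}"
  proof -
    have False if "\<Delta> \<in> R" "\<Delta> \<in> R2" for \<Delta>
      using fan_tri[OF fan that(1)] fan_tri[OF s2.fan that(2)[unfolded R2_def]] \<beta> by auto
    then show ?thesis by blast
  qed
  have i1: "\<not> inc v \<Delta>" if "\<Delta> \<in> R" "v \<in> J2" for \<Delta> v using R_inc[OF that(1)] that(2) by (force simp: J2_def)
  have i2: "\<not> inc v \<Delta>" if "\<Delta> \<in> R2" "v \<in> J1" for \<Delta> v
    using s2.R_inc[OF that(1)[unfolded R2_def]] that(2) \<beta> by (force simp: J1_def)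
  have d: "J1 \<inter> J2 = {}" "\<beta> \<notin> J1" "\<beta> \<notin> J2" by (auto simp: J1_def J2_def)
  have e: "insert \<beta> J1 = {x<..\<beta>}" "insert \<beta> J2 = {\<alpha> + 1 * int N..<y}" using x y \<beta> by (auto simp: J1_def J2_def)
  have J2': "J2 = {\<alpha> + 1 * int N<..<y}" using \<beta> by (simp add: J2_def)
  have v: "bd_count J1 R = lam x \<beta>" "bd_count {x<..\<beta>} R = lam \<alpha> x" using count_open count_right x by (simp_all add: J1_def)
  have v2: "bd_count J2 R2 = lam \<beta> y" unfolding J2' R2_def using s2.count_open[of "\<alpha> + 1 * int N" y] x y \<beta> by simp
  have v3: "bd_count {\<alpha> + 1 * int N..<y} R2 = lam y (\<beta> + int N)" unfolding R2_def using s2.count_left[of y] x y \<beta> by simp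
  have "bd_count (insert \<beta> (J1 \<union> J2)) (R \<union> R2) = lam \<alpha> x * lam \<beta> y + lam x \<beta> * lam y (\<beta> + int N)"
    by (simp only: bd_count_Un_shared[OF finR fin(1) finJ(1,2) disj d i1 i2] e v v2 v3)
  moreover have "bd_count (J1 \<union> J2) (R \<union> R2) = lam x \<beta> * lam \<beta> y"
    by (simp only: bd_count_Un[OF finR fin(1) finJ(1,2) disj d(1) i1 i2] v v2)
  moreover have "c y = lam \<beta> y + lam y (\<beta> + int N)" using s2.c_split[of y] \<beta> by simp
  moreover have "lam x y = c x * lam \<beta> y + c y * lam x \<beta>" using c_ends by (simp add: lam_def algebra_simps)
  ultimately show ?thesis unfolding J c_split[of x] by (simp add: algebra_simps)
qed

text \<open>The arc passes over the gap between two copies of the fan. Three consecutive triangles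
  at the puncture are involved, and \<open>\<beta>\<close> and \<open>\<gamma> = \<beta> + 1\<close>
  are the only points below the arc that may touch them.\<close>

lemma straddle_two:
  assumes \<beta>: "\<beta> = \<alpha> + int N - 1" and x: "\<alpha> \<le> x" "x \<le> \<beta>" and y: "\<alpha> + int N \<le> y" "y < x + int N"
  shows "bd_count {x<..<y} (lifted_triangles N T) = lam x y"
proof -
  interpret s2: slice_tri N c t S T "\<alpha> + 1 * int N" "\<beta> + 1 * int N" "shift_tri (1 * int N) ` R"
    "(\<lambda>(a, b). (a + 1 * int N, b + 1 * int N)) ` Q" by (rule shifted)
  define \<gamma> where "\<gamma> = \<alpha> + int N"
  define R2 where "R2 = shift_tri (1 * int N) ` R"
  define W1 where "W1 = insert (CTri \<gamma> (\<beta> + int N)) (R \<union> R2)"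
  define W2 where "W2 = insert (CTri \<beta> \<gamma>) W1"
  define W where "W = insert (CTri \<alpha> \<beta>) W2"
  define J1 J2 where "J1 = {x<..\<beta>}" and "J2 = {\<gamma>..<y}"
  have \<gamma>: "\<gamma> = \<beta> + 1" using \<beta> by (simp add: \<gamma>_def)
  have CT: "CT = {CTri \<alpha> \<beta>, CTri \<beta> \<gamma>}" unfolding CT_def \<gamma>_def using \<beta> by simp
  have "\<Delta> \<in> lifted_triangles N T \<longleftrightarrow> \<Delta> \<in> W" if v: "v \<in> {x<..<y}" "inc v \<Delta>" for v \<Delta>
  proof
    assume "\<Delta> \<in> W"
    then consider "\<Delta> \<in> R \<union> CT" | "\<exists>\<Delta>0\<in>R \<union> CT. \<Delta> = shift_tri (1 * int N) \<Delta>0"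
      unfolding W_def W1_def W2_def R2_def CT \<gamma>_def by auto
    then show "\<Delta> \<in> lifted_triangles N T" unfolding lifted_iff by cases (metis shift_0 mult_zero_left, blast)
  next
    assume "\<Delta> \<in> lifted_triangles N T"
    then obtain k \<Delta>0 where k: "\<Delta>0 \<in> R \<union> CT" "\<Delta> = shift_tri (k * int N) \<Delta>0" unfolding lifted_iff by blast
    have i: "inc (v - k * int N) \<Delta>0" using v(2) k(2) by (simp add: inc_shift)
    show "\<Delta> \<in> W"
    proof (cases "\<Delta>0 = CTri \<beta> \<gamma>")
      case True
      then have "v = \<beta> + k * int N \<or> v = \<beta> + 1 + k * int N" using i \<gamma> by auto
      moreover have "x < v" "v < y" using v(1) by auto
      ultimately have "k = 0" using x y \<beta>
        by (elim disjE) (cases rule: shift_cases2[of k N]; linarith)+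
      then show ?thesis using True k(2) by (simp add: W_def W2_def)
    next
      case False
      then have "\<alpha> \<le> v - k * int N \<and> v - k * int N \<le> \<beta>" using k(1) R_inc[OF _ i] i x unfolding CT by auto
      then have "k = 0 \<or> k = 1" using v(1) x y \<beta> by (cases rule: shift_cases2[of k N]) auto
      then show ?thesis using k False unfolding W_def W2_def W1_def R2_def CT \<gamma>_def by auto
    qed
  qed
  then have W: "bd_count {x<..<y} (lifted_triangles N T) = bd_count {x<..<y} W" by (rule bd_count_cong)
  have J: "{x<..<y} = J1 \<union> J2" using x y \<gamma> by (auto simp: J1_def J2_def \<gamma>_def)
  have fin: "finite R2" "finite (R \<union> R2)" "finite W1" "finite W2" using finR by (auto simp: R2_def W1_def W2_def)
  have less: "\<gamma> < \<beta> + int N" "\<beta> < \<gamma>" "\<alpha> < \<beta>" using N3 \<beta> by (auto simp: \<gamma>_def)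
  have n1: "CTri \<gamma> (\<beta> + int N) \<notin> R \<union> R2" using CTri_notin s2.CTri_notin unfolding R2_def by blast
  have n2: "CTri \<beta> \<gamma> \<notin> W1" using CTri_notin s2.CTri_notin less unfolding R2_def W1_def by auto
  have n3: "CTri \<alpha> \<beta> \<notin> W2" using CTri_notin s2.CTri_notin less unfolding R2_def W1_def W2_def by auto
  have disj: "R \<inter> R2 = {}"
  proof -
    have False if "\<Delta> \<in> R" "\<Delta> \<in> R2" for \<Delta>
      using fan_tri[OF fan that(1)] fan_tri[OF s2.fan that(2)[unfolded R2_def]] \<beta> by auto
    then show ?thesis by blast
  qed
  have i1: "\<not> inc v \<Delta>" if "\<Delta> \<in> R" "v \<in> J2" for \<Delta> v using R_inc[OF that(1)] that(2) \<gamma> by (force simp: J2_def)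
  have i2: "\<not> inc v \<Delta>" if "\<Delta> \<in> R2" "v \<in> J1" for \<Delta> v
    using s2.R_inc[OF that(1)[unfolded R2_def]] that(2) \<beta> by (force simp: J1_def)
  have F: "bd_count (K1 \<union> K2) (R \<union> R2) = bd_count K1 R * bd_count K2 R2" if K: "K1 \<subseteq> J1" "K2 \<subseteq> J2" for K1 K2
  proof (rule bd_count_Un[OF finR fin(1) _ _ disj])
    have "J1 \<inter> J2 = {}" "finite J1" "finite J2" using \<gamma> by (auto simp: J1_def J2_def)
    then show "finite K1" "finite K2" "K1 \<inter> K2 = {}" using K finite_subset by blast+
  qed (use i1 i2 K in blast)+
  have fK: "finite K" if "K \<subseteq> J1 \<union> J2" for K using that by (rule finite_subset) (auto simp: J1_def J2_def)
  have nK: "\<beta> + int N \<notin> K" "\<alpha> \<notin> K" if "K \<subseteq> J1 \<union> J2" for K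
    using that x y less by (auto simp: J1_def J2_def)
  have G1: "bd_count K W1 = bd_count K (R \<union> R2) + (if \<gamma> \<in> K then bd_count (K - {\<gamma>}) (R \<union> R2) else 0)"
    if "K \<subseteq> J1 \<union> J2" for K
    unfolding W1_def bd_count_CTri[OF fK[OF that] fin(2) n1 less(1)] using nK[OF that] by simp
  have G2: "bd_count K W2 = bd_count K W1 + (if \<beta> \<in> K then bd_count (K - {\<beta>}) W1 else 0) + (if \<gamma> \<in> K then bd_count (K - {\<gamma>}) W1 else 0)"
    if "K \<subseteq> J1 \<union> J2" for K
    unfolding W2_def by (rule bd_count_CTri[OF fK[OF that] fin(3) n2 less(2)])
  have G: "bd_count K W = bd_count K W2 + (if \<beta> \<in> K then bd_count (K - {\<beta>}) W2 else 0)"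
    if "K \<subseteq> J1 \<union> J2" for K
    unfolding W_def bd_count_CTri[OF fK[OF that] fin(4) n3 less(3)] using nK[OF that] by simp
  have dJ: "\<beta> \<notin> J2" "\<gamma> \<notin> J1" using \<gamma> by (auto simp: J1_def J2_def)
  \<comment> \<open>In \<open>A\<close> and \<open>B\<close> the point \<open>\<beta>\<close>, resp.
    \<open>\<gamma>\<close>, is matched within its own fan if it lies below the arc; in
    \<open>A'\<close> and \<open>B'\<close> it is left to the triangles at the puncture.\<close>
  define A A' B B' where "A = lam \<alpha> x" and "A' = lam x \<beta>" and "B = lam y (\<beta> + int N)" and "B' = lam \<gamma> y"
  have cA: "bd_count J1 R = A" using count_right x by (simp add: J1_def A_def)
  have cA': "bd_count (J1 - {\<beta>}) R = A'" if "x < \<beta>"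
  proof -
    have "J1 - {\<beta>} = {x<..<\<beta>}" by (auto simp: J1_def)
    then show ?thesis using count_open x that by (simp add: A'_def)
  qed
  have cB: "bd_count J2 R2 = B" using s2.count_left[of y] x y by (simp add: J2_def R2_def B_def \<gamma>_def)
  have cB': "bd_count (J2 - {\<gamma>}) R2 = B'" if "\<gamma> < y"
  proof -
    have "J2 - {\<gamma>} = {\<gamma><..<y}" by (auto simp: J2_def)
    then show ?thesis using s2.count_open[of \<gamma> y] x y that by (simp add: B'_def R2_def \<gamma>_def)
  qed
  have f00: "bd_count (J1 \<union> J2) (R \<union> R2) = A * B" using F[of J1 J2] cA cB by simp
  \<comment> \<open>Each of \<open>\<beta>\<close> and \<open>\<gamma>\<close> lies on two triangles
    at the puncture, and one triangle is common to both: this gives 2 choices for a single point and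
    2 * 2 - 1 = 3 for the pair. If \<open>x = \<beta>\<close> or \<open>y = \<gamma>\<close>, that
    point is absent and \<open>A'\<close> or \<open>B'\<close> is 0.\<close>
  have main: "bd_count (J1 \<union> J2) W = A * B + 2 * (A * B') + 2 * (A' * B) + 3 * (A' * B')"
  proof (cases "x < \<beta>"; cases "\<gamma> < y")
    assume xb: "x < \<beta>" and gy: "\<gamma> < y"
    have m: "\<beta> \<in> J1" "\<gamma> \<in> J2" "\<beta> \<noteq> \<gamma>" using xb gy \<gamma> by (auto simp: J1_def J2_def)
    have s: "J1 \<union> J2 - {\<beta>} = (J1 - {\<beta>}) \<union> J2" "J1 \<union> J2 - {\<gamma>} = J1 \<union> (J2 - {\<gamma>})"
      "(J1 - {\<beta>}) \<union> J2 - {\<gamma>} = (J1 - {\<beta>}) \<union> (J2 - {\<gamma>})" "J1 \<union> (J2 - {\<gamma>}) - {\<beta>} = (J1 - {\<beta>}) \<union> (J2 - {\<gamma>})"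
      using dJ by auto
    have f: "bd_count ((J1 - {\<beta>}) \<union> J2) (R \<union> R2) = A' * B" "bd_count (J1 \<union> (J2 - {\<gamma>})) (R \<union> R2) = A * B'"
      "bd_count ((J1 - {\<beta>}) \<union> (J2 - {\<gamma>})) (R \<union> R2) = A' * B'"
      using F[of "J1 - {\<beta>}" J2] F[of J1 "J2 - {\<gamma>}"] F[of "J1 - {\<beta>}" "J2 - {\<gamma>}"] cA cB cA'[OF xb] cB'[OF gy] by auto
    have g: "bd_count (J1 \<union> J2) W1 = A * B + A * B'" using G1[of "J1 \<union> J2"] m f f00 s by simp
    have g1: "bd_count ((J1 - {\<beta>}) \<union> J2) W1 = A' * B + A' * B'"
      using G1[of "(J1 - {\<beta>}) \<union> J2"] m f s by auto
    have g2: "bd_count (J1 \<union> (J2 - {\<gamma>})) W1 = A * B'"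
      using G1[of "J1 \<union> (J2 - {\<gamma>})"] m f s dJ by auto
    have g3: "bd_count ((J1 - {\<beta>}) \<union> (J2 - {\<gamma>})) W1 = A' * B'"
      using G1[of "(J1 - {\<beta>}) \<union> (J2 - {\<gamma>})"] m f s dJ by auto
    have h: "bd_count (J1 \<union> J2) W2 = A * B + A * B' + (A' * B + A' * B') + A * B'"
      using G2[of "J1 \<union> J2"] m g g1 g2 s by simp
    have h1: "bd_count ((J1 - {\<beta>}) \<union> J2) W2 = A' * B + A' * B' + A' * B'"
      using G2[of "(J1 - {\<beta>}) \<union> J2"] m g1 g3 s dJ by auto
    show ?thesis using G[of "J1 \<union> J2"] m h h1 s by (simp add: algebra_simps)
  next
    assume xb: "x < \<beta>" and gy: "\<not> \<gamma> < y"
    then have y0: "y = \<gamma>" using y by (simp add: \<gamma>_def)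
    have J2: "J2 = {}" using y0 by (simp add: J2_def)
    have B': "B' = 0" using y0 by (simp add: B'_def)
    have m: "\<beta> \<in> J1" "\<gamma> \<notin> J1" using xb dJ by (auto simp: J1_def)
    have f: "bd_count (J1 - {\<beta>}) (R \<union> R2) = A' * B" using F[of "J1 - {\<beta>}" J2] cB cA'[OF xb] J2 by simp
    have f0: "bd_count J1 (R \<union> R2) = A * B" using f00 J2 by simp
    have g: "bd_count J1 W1 = A * B" "bd_count (J1 - {\<beta>}) W1 = A' * B" using G1[of J1] G1[of "J1 - {\<beta>}"] m f f0 by auto
    have h: "bd_count J1 W2 = A * B + A' * B" "bd_count (J1 - {\<beta>}) W2 = A' * B"
      using G2[of J1] G2[of "J1 - {\<beta>}"] m g by auto
    show ?thesis using G[of J1] m h J2 B' by simp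
  next
    assume xb: "\<not> x < \<beta>" and gy: "\<gamma> < y"
    then have x0: "x = \<beta>" using x by simp
    have J1: "J1 = {}" using x0 by (simp add: J1_def)
    have A': "A' = 0" using x0 by (simp add: A'_def)
    have m: "\<gamma> \<in> J2" "\<beta> \<notin> J2" using gy dJ by (auto simp: J2_def)
    have f: "bd_count (J2 - {\<gamma>}) (R \<union> R2) = A * B'" using F[of J1 "J2 - {\<gamma>}"] cA cB'[OF gy] J1 by simp
    have f0: "bd_count J2 (R \<union> R2) = A * B" using f00 J1 by simp
    have g: "bd_count J2 W1 = A * B + A * B'" "bd_count (J2 - {\<gamma>}) W1 = A * B'" using G1[of J2] G1[of "J2 - {\<gamma>}"] m f f0 by auto
    have h: "bd_count J2 W2 = A * B + A * B' + A * B'"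
      using G2[of J2] m g by auto
    show ?thesis using G[of J2] m h J1 A' by simp
  next
    assume xb: "\<not> x < \<beta>" and gy: "\<not> \<gamma> < y"
    then have J12: "J1 = {}" "J2 = {}" "A' = 0" "B' = 0" using x y by (auto simp: J1_def J2_def A'_def B'_def \<gamma>_def)
    then show ?thesis using f00 by simp
  qed
  have cy: "c y = B' + B" using s2.c_split[of y] by (simp add: B_def B'_def \<gamma>_def)
  have cx: "c x = A + A'" using c_split[of x] by (simp add: A_def A'_def)
  have t\<gamma>: "t \<gamma> = t \<beta> + 1" "c \<gamma> = 1" using t_step[of \<beta>] c_ends c_per[of \<alpha>] \<gamma> by (simp_all add: \<gamma>_def)
  have "lam x y = c y * A' + c x * c y + c x * B'"
    unfolding A'_def B'_def lam_def t\<gamma> using c_ends by (simp add: algebra_simps)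
  then have "lam x y = A * B + 2 * (A * B') + 2 * (A' * B) + 3 * (A' * B')"
    unfolding cx cy by (simp add: algebra_simps)
  then show ?thesis using W main J by simp
qed

lemma window: obtains k where "\<alpha> + k * int N \<le> x" "x < \<alpha> + k * int N + int N"
proof -
  have "x - \<alpha> = ((x - \<alpha>) div int N) * int N + (x - \<alpha>) mod int N" by simp
  moreover have "0 \<le> (x - \<alpha>) mod int N" "(x - \<alpha>) mod int N < int N" using N3 by auto
  ultimately show thesis using that[of "(x - \<alpha>) div int N"] by linarith
qed

lemma arc_count:
  assumes "x < y" "y < x + int N"
  shows "bd_count {x<..<y} (lifted_triangles N T) = lam x y"
proof -
  obtain k where k: "\<alpha> + k * int N \<le> x" "x < \<alpha> + k * int N + int N" using window .
  interpret s: slice_tri N c t S T "\<alpha> + k * int N" "\<beta> + k * int N" "shift_tri (k * int N) ` R"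
    "(\<lambda>(a, b). (a + k * int N, b + k * int N)) ` Q" by (rule shifted)
  show ?thesis
  proof (cases "y \<le> \<beta> + k * int N")
    case True
    then show ?thesis using s.inner_count assms k by simp
  next
    case False
    show ?thesis
    proof (cases "\<beta> = \<alpha> + int N")
      case True
      then show ?thesis using s.straddle_loop[of x y] False k assms by simp
    next
      case F: False
      then have "\<beta> = \<alpha> + int N - 1" using len by simp
      then show ?thesis using s.straddle_two[of x y] False k assms by simp
    qed
  qed
qed

lemma m_arc_value:
  assumes "i \<noteq> j" "1 \<le> i" "i \<le> int N" "1 \<le> j" "j \<le> int N"
  shows "of_nat (m_arc N T i j) = lam i (i + blen N i j)"
proof -
  have b: "1 \<le> blen N i j" "blen N i j \<le> int N" using blen_range N3 by auto
  have "blen N i j \<noteq> int N"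
  proof
    assume "blen N i j = int N"
    then have "nrm N i = nrm N j" using nrm_blen[of N i j] nrm_shift[of N i 1] by simp
    then show False using assms by (simp add: nrm_id)
  qed
  then have l: "i < i + blen N i j" "i + blen N i j < i + int N" using b by auto
  let ?J = "{i<..<i + blen N i j}"
  have "of_nat (m_arc N T i j) = bd_count ?J (pieces N T i j)"
    by (simp add: m_arc_def bd_count_def match_count_def)
  also have "\<dots> = bd_count ?J (lifted_triangles N T)"
    by (rule bd_count_cong) (auto simp: pieces_def inc_def)
  finally show ?thesis using arc_count[OF l] by simp
qed

end

section \<open>Matching numbers of central arcs\<close>

lemma finite_int_filter: "finite {k \<in> {a..b :: int}. P k}"
  by (rule finite_subset[of _ "{a..b}"]) auto

context slice_tri begin

text \<open>The fan alone has too few triangles, so the triangle at the puncture is matched to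
  \<open>\<alpha>\<close> or to \<open>\<beta>\<close>. The two cases are the two summands in
  \<open>c_split\<close>.\<close>

lemma central_count:
  assumes "\<alpha> \<le> x" "x \<le> \<beta>"
  shows "bd_count ({\<alpha>..\<beta>} - {x}) (insert (CTri \<alpha> \<beta>) R) = c x"
proof -
  have l: "\<alpha> < \<beta>" using fan_less[OF fan] .
  have "bd_count ({\<alpha>..\<beta>} - {x}) R = 0"
    using fan_card[OF fan] finR assms l by (intro bd_count_card) (simp_all add: card_Diff_singleton)
  moreover have "bd_count ({\<alpha>..\<beta>} - {x} - {\<alpha>}) R = lam \<alpha> x" if "x \<noteq> \<alpha>"
  proof -
    have "{\<alpha>..\<beta>} - {x} - {\<alpha>} = {\<alpha>..\<beta>} - {\<alpha>, x}" by auto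
    then show ?thesis using count_two[of \<alpha> x] that assms by simp
  qed
  moreover have "bd_count ({\<alpha>..\<beta>} - {x} - {\<beta>}) R = lam x \<beta>" if "x \<noteq> \<beta>"
  proof -
    have "{\<alpha>..\<beta>} - {x} - {\<beta>} = {\<alpha>..\<beta>} - {x, \<beta>}" by auto
    then show ?thesis using count_two[of x \<beta>] that assms by simp
  qed
  ultimately show ?thesis
    unfolding c_split[of x] bd_count_CTri[OF finite_Diff[OF finite_atLeastAtMost_int] finR CTri_notin l]
    using assms l by auto
qed

lemma polygon_triangles:
  "{\<Delta> \<in> lifted_triangles N T. corners \<Delta> \<subseteq> Bd ` {\<alpha>..\<beta>} \<union> {Puncture}} = insert (CTri \<alpha> \<beta>) R"
proof (intro equalityI subsetI)
  fix \<Delta> assume "\<Delta> \<in> insert (CTri \<alpha> \<beta>) R"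
  moreover have "CTri \<alpha> \<beta> \<in> CT" by (simp add: CT_def)
  ultimately have "\<Delta> \<in> R \<union> CT" by auto
  then have "\<Delta> \<in> lifted_triangles N T" unfolding lifted_iff by (intro exI[of _ 0]) auto
  moreover have "corners \<Delta> \<subseteq> Bd ` {\<alpha>..\<beta>} \<union> {Puncture}"
    using \<open>\<Delta> \<in> insert (CTri \<alpha> \<beta>) R\<close> fan_tri[OF fan, of \<Delta>] fan_less[OF fan] by auto
  ultimately show "\<Delta> \<in> {\<Delta> \<in> lifted_triangles N T. corners \<Delta> \<subseteq> Bd ` {\<alpha>..\<beta>} \<union> {Puncture}}" by simp
next
  fix \<Delta> assume "\<Delta> \<in> {\<Delta> \<in> lifted_triangles N T. corners \<Delta> \<subseteq> Bd ` {\<alpha>..\<beta>} \<union> {Puncture}}"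
  then obtain k \<Delta>0 where k: "\<Delta>0 \<in> R \<union> CT" "\<Delta> = shift_tri (k * int N) \<Delta>0"
    and sub: "corners \<Delta> \<subseteq> Bd ` {\<alpha>..\<beta>} \<union> {Puncture}" unfolding lifted_iff by blast
  show "\<Delta> \<in> insert (CTri \<alpha> \<beta>) R"
  proof (cases "\<Delta>0 \<in> R")
    case True
    then obtain a b d where t: "\<Delta>0 = Tri a b d" "\<alpha> \<le> a" "a < b" "b < d" "d \<le> \<beta>" using fan_tri[OF fan] by blast
    then have "\<alpha> \<le> a + k * int N" "d + k * int N \<le> \<beta>" using sub k(2) by auto
    then have "k = 0" using t len by (cases rule: shift_cases[of k N]) linarith+
    then show ?thesis using True k(2) by simp
  next
    case False
    then have "\<Delta>0 \<in> CT" using k(1) by simp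
    then consider "\<Delta>0 = CTri \<alpha> \<beta>" | "\<Delta>0 = CTri \<beta> (\<alpha> + int N)" "\<beta> \<noteq> \<alpha> + int N"
      unfolding CT_def by (auto split: if_splits)
    then show ?thesis
    proof cases
      case 1
      then have "\<alpha> \<le> \<alpha> + k * int N" "\<beta> + k * int N \<le> \<beta>" using sub k(2) by auto
      then have "k = 0" using N3 by (cases rule: shift_cases[of k N]) linarith+
      then show ?thesis using 1 k(2) by simp
    next
      case 2
      then have "\<alpha> \<le> \<beta> + k * int N" "\<alpha> + int N + k * int N \<le> \<beta>" using sub k(2) by auto
      then have False using 2(2) len by (cases rule: shift_cases[of k N]) linarith+
      then show ?thesis ..
    qed
  qed
qed

lemma m_central_ends:
  assumes "P_ends N T x = (\<alpha>, \<beta>)" "\<alpha> \<le> x" "x \<le> \<beta>"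
  shows "of_nat (m_central N T x) = c x"
proof -
  have "P_vertices N T x - {Bd x, Puncture} = Bd ` ({\<alpha>..\<beta>} - {x})"
    using assms by (auto simp: P_vertices_def)
  moreover have "P_triangles N T x = insert (CTri \<alpha> \<beta>) R"
    unfolding P_triangles_def P_vertices_def assms(1) fst_conv snd_conv by (rule polygon_triangles)
  ultimately have "of_nat (m_central N T x) = bd_count ({\<alpha>..\<beta>} - {x}) (insert (CTri \<alpha> \<beta>) R)"
    by (simp add: m_central_def bd_count_def match_count_def)
  then show ?thesis using central_count assms by simp
qed

lemma card_spokes: "card {k. Central k \<in> T} \<ge> 2 \<longleftrightarrow> \<beta> \<noteq> \<alpha> + int N"
proof -
  have s: "{k. Central k \<in> T} = {nrm N \<alpha>, nrm N \<beta>}" unfolding T_eq by auto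
  show ?thesis
  proof (cases "\<beta> = \<alpha> + int N")
    case True
    then have "nrm N \<beta> = nrm N \<alpha>" using nrm_shift[of N \<alpha> 1] by simp
    then show ?thesis unfolding s using True by simp
  next
    case False
    then have "\<beta> = \<alpha> + int N - 1" using len by simp
    then have "nrm N \<alpha> \<noteq> nrm N \<beta>" using nrm_neq[of \<alpha> \<beta>] N3 by simp
    then show ?thesis unfolding s using False by simp
  qed
qed

lemma spoke_cases:
  assumes "lifted_spoke N T z" "\<beta> \<noteq> \<alpha> + int N"
  obtains "z \<le> \<alpha> - 1" | "z = \<alpha>" | "z = \<beta>" | "z \<ge> \<alpha> + int N"
proof -
  have \<beta>: "\<beta> = \<alpha> + int N - 1" using len assms(2) by simp
  obtain k where "z = \<alpha> + k * int N \<or> z = \<beta> + k * int N" using assms(1) unfolding spoke_iff by blast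
  then show thesis
    by (elim disjE; cases rule: shift_cases[of k N]) (use that \<beta> N3 in linarith)+
qed

lemma spoke_ends: "lifted_spoke N T \<alpha>" "lifted_spoke N T \<beta>" "lifted_spoke N T (\<alpha> + int N)"
  unfolding spoke_iff by (metis add.right_neutral mult_zero_left, metis add.right_neutral mult_zero_left, metis mult_1)

text \<open>\<open>P_ends\<close> searches weakly to the left and strictly to the right. So points
  before \<open>\<beta>\<close> see the whole fan, whereas for \<open>x = \<beta>\<close> the
  polygon shrinks to the triangle over the segment from \<open>\<beta>\<close> to
  \<open>\<beta> + 1\<close>.\<close>

lemma m_central_two:
  assumes \<beta>: "\<beta> \<noteq> \<alpha> + int N" and x: "\<alpha> \<le> x" "x \<le> \<beta>"
  shows "of_nat (m_central N T x) = c x"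
proof -
  have b: "\<beta> = \<alpha> + int N - 1" using len \<beta> by simp
  have ends: "P_ends N T x = (Max {k \<in> {x - int N..x}. lifted_spoke N T k}, Min {j \<in> {x + 1..x + int N}. lifted_spoke N T j})"
    using card_spokes \<beta> unfolding P_ends_def by simp
  show ?thesis
  proof (cases "x = \<beta>")
    case False
    have "Max {k \<in> {x - int N..x}. lifted_spoke N T k} = \<alpha>"
    proof (rule Max_eqI)
      fix z assume z: "z \<in> {k \<in> {x - int N..x}. lifted_spoke N T k}"
      then show "z \<le> \<alpha>" using x False b by (elim CollectE conjE spoke_cases[OF _ \<beta>]) auto
    qed (rule finite_int_filter, use x b spoke_ends in auto)
    moreover have "Min {j \<in> {x + 1..x + int N}. lifted_spoke N T j} = \<beta>"
    proof (rule Min_eqI)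
      fix z assume z: "z \<in> {j \<in> {x + 1..x + int N}. lifted_spoke N T j}"
      then show "\<beta> \<le> z" using x b by (elim CollectE conjE spoke_cases[OF _ \<beta>]) auto
    qed (rule finite_int_filter, use x False b spoke_ends in auto)
    ultimately show ?thesis using m_central_ends ends x by simp
  next
    case True
    have "Max {k \<in> {x - int N..x}. lifted_spoke N T k} = \<beta>"
      by (rule Max_eqI, rule finite_int_filter) (use True spoke_ends in auto)
    moreover have "Min {j \<in> {x + 1..x + int N}. lifted_spoke N T j} = \<beta> + 1"
      by (rule Min_eqI, rule finite_int_filter) (use True spoke_ends b N3 in auto)
    ultimately have e: "P_ends N T x = (\<beta>, \<beta> + 1)" using ends by simp
    have v: "P_vertices N T x = Bd ` {\<beta>, \<beta> + 1} \<union> {Puncture}"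
    proof -
      have "{\<beta>..\<beta> + 1} = {\<beta>, \<beta> + 1}" by auto
      then show ?thesis by (simp add: P_vertices_def e)
    qed
    have "P_triangles N T x = {CTri \<beta> (\<beta> + 1)}"
    proof (intro equalityI subsetI)
      fix \<Delta> assume "\<Delta> \<in> P_triangles N T x"
      then have \<Delta>: "\<Delta> \<in> lifted_triangles N T" "corners \<Delta> \<subseteq> Bd ` {\<beta>, \<beta> + 1} \<union> {Puncture}"
        unfolding P_triangles_def v by auto
      show "\<Delta> \<in> {CTri \<beta> (\<beta> + 1)}"
        using \<Delta> by (cases \<Delta>) (auto simp: Tri_lifted CTri_lifted)
    next
      fix \<Delta> assume "\<Delta> \<in> {CTri \<beta> (\<beta> + 1)}"
      moreover have "CTri \<beta> (\<beta> + 1) \<in> lifted_triangles N T"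
        using spoke_ends b by (simp add: CTri_lifted lifted_side_def)
      ultimately show "\<Delta> \<in> P_triangles N T x" unfolding P_triangles_def v by auto
    qed
    moreover have "P_vertices N T x - {Bd x, Puncture} = Bd ` {\<beta> + 1}" unfolding v using True by auto
    ultimately have "of_nat (m_central N T x) = bd_count {\<beta> + 1} {CTri \<beta> (\<beta> + 1)}"
      by (simp add: m_central_def bd_count_def match_count_def)
    also have "\<dots> = 1"
    proof -
      have "bd_count {\<beta> + 1} {} = 0" by (rule bd_count_isolated[of "\<beta> + 1"]) auto
      then show ?thesis by (simp add: bd_count_CTri)
    qed
    finally show ?thesis using True c_ends by simp
  qed
qed

text \<open>With a single central arc the search to the left is strict, so the window excludes
  \<open>\<alpha>\<close> and includes \<open>\<beta>\<close>: the end of the central arc counts as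
  the right end of the strip.\<close>

lemma m_central_loop:
  assumes \<beta>: "\<beta> = \<alpha> + int N" and x: "\<alpha> < x" "x \<le> \<beta>"
  shows "of_nat (m_central N T x) = c x"
proof -
  have "Max {k \<in> {x - int N..x - 1}. lifted_spoke N T k} = \<alpha>"
  proof (rule Max_eqI)
    fix z assume z: "z \<in> {k \<in> {x - int N..x - 1}. lifted_spoke N T k}"
    then obtain k where "z = \<alpha> + k * int N \<or> z = \<beta> + k * int N" unfolding spoke_iff by blast
    moreover have "z \<le> x - 1" using z by simp
    ultimately show "z \<le> \<alpha>" using x \<beta> N3 by (elim disjE; cases rule: shift_cases[of k N]) linarith+
  qed (rule finite_int_filter, use x \<beta> spoke_ends in auto)
  then have "P_ends N T x = (\<alpha>, \<beta>)"
    using card_spokes \<beta> unfolding P_ends_def Let_def by simp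
  then show ?thesis using m_central_ends x by simp
qed

lemma m_central_value: "of_nat (m_central N T x) = c x"
proof (cases "\<beta> = \<alpha> + int N")
  case False
  obtain k where k: "\<alpha> + k * int N \<le> x" "x < \<alpha> + k * int N + int N" using window .
  interpret s: slice_tri N c t S T "\<alpha> + k * int N" "\<beta> + k * int N" "shift_tri (k * int N) ` R"
    "(\<lambda>(a, b). (a + k * int N, b + k * int N)) ` Q" by (rule shifted)
  show ?thesis using s.m_central_two[of x] k False len by simp
next
  case True
  \<comment> \<open>The shift by one gives a window that contains its right end and not its left
    end.\<close>
  obtain k where k: "\<alpha> + k * int N \<le> x - 1" "x - 1 < \<alpha> + k * int N + int N" using window[of "x - 1"] .
  interpret s: slice_tri N c t S T "\<alpha> + k * int N" "\<beta> + k * int N" "shift_tri (k * int N) ` R"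
    "(\<lambda>(a, b). (a + k * int N, b + k * int N)) ` Q" by (rule shifted)
  show ?thesis using s.m_central_loop[of x] k True by simp
qed

end

section \<open>Matching numbers of loops\<close>

fun shift_vertex :: "int \<Rightarrow> vertex \<Rightarrow> vertex" where
  "shift_vertex s (Bd a) = Bd (a + s)"
| "shift_vertex s Puncture = Puncture"

lemma corners_shift: "corners (shift_tri s \<Delta>) = shift_vertex s ` corners \<Delta>"
  by (cases \<Delta>) auto

lemma inj_shift_vertex: "inj (shift_vertex s)"
proof (rule injI)
  fix v w assume "shift_vertex s v = shift_vertex s w"
  then show "v = w" by (cases v; cases w) auto
qed

lemma proj_shift_vertex [simp]: "proj N (shift_vertex (k * int N) v) = proj N v"
  by (cases v) auto

text \<open>Translating a triangle does not change the projections of its corners, and the recursion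
  \<open>match_count_insert\<close> sees nothing else of a region.\<close>

lemma match_count_norm:
  assumes "finite R" "finite I" "inj_on (norm_tri N) R"
  shows "match_count (proj N) I (norm_tri N ` R) = match_count (proj N) I R"
  using assms
proof (induction R arbitrary: I rule: finite_induct)
  case (insert \<Delta> R)
  obtain k where k: "norm_tri N \<Delta> = shift_tri (k * int N) \<Delta>" using norm_tri_shift by blast
  have ni: "norm_tri N \<Delta> \<notin> norm_tri N ` R" using insert.prems(2) insert.hyps(2) by (auto simp: inj_on_def)
  have V: "{v \<in> corners (norm_tri N \<Delta>). proj N v \<in> I} = shift_vertex (k * int N) ` {v \<in> corners \<Delta>. proj N v \<in> I}"
    unfolding k corners_shift by auto
  have IH: "match_count (proj N) J (norm_tri N ` R) = match_count (proj N) J R" if "finite J" for J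
    using insert.IH[of J] that insert.prems(2) by simp
  have "match_count (proj N) I (insert (norm_tri N \<Delta>) (norm_tri N ` R)) = match_count (proj N) I R
     + (\<Sum>v\<in>{v \<in> corners \<Delta>. proj N v \<in> I}. match_count (proj N) (I - {proj N v}) R)"
    unfolding match_count_insert[OF insert.prems(1) finite_imageI[OF insert.hyps(1)] ni] V
    using insert.prems(1) inj_shift_vertex[of "k * int N"]
    by (subst sum.reindex) (auto simp: IH comp_def inj_on_def)
  then show ?case using match_count_insert[OF insert.prems(1) insert.hyps] by simp
qed simp

text \<open>As no point of \<open>W\<close> shares its residue with a different point of
  \<open>J\<close>, \<open>proj\<close> glues nothing that has to be matched, and one may count in
  the universal cover.\<close>

lemma proj_count:
  assumes "finite R" "finite J" "J \<subseteq> W" "\<And>v w. v \<in> W \<Longrightarrow> w \<in> J \<Longrightarrow> nrm N v = nrm N w \<Longrightarrow> v = w"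
    "\<And>\<Delta>. \<Delta> \<in> R \<Longrightarrow> corners \<Delta> \<subseteq> Bd ` W"
  shows "match_count (proj N) (Bd ` nrm N ` J) R = bd_count J R"
  using assms
proof (induction R arbitrary: J rule: finite_induct)
  case empty
  show ?case
  proof (cases "J = {}")
    case False
    then obtain w where w: "w \<in> J" by blast
    have "match_count (proj N) (Bd ` nrm N ` J) {} = 0"
      by (rule match_count_isolated[of "Bd (nrm N w)"]) (use w in auto)
    moreover have "bd_count J {} = 0" by (rule bd_count_isolated[of w]) (use w in auto)
    ultimately show ?thesis by simp
  qed simp
next
  case (insert \<Delta> R)
  have V: "{v \<in> corners \<Delta>. proj N v \<in> Bd ` nrm N ` J} = Bd ` {v \<in> J. inc v \<Delta>}"
  proof (intro equalityI subsetI)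
    fix v assume v: "v \<in> {v \<in> corners \<Delta>. proj N v \<in> Bd ` nrm N ` J}"
    then obtain w where w: "v = Bd w" "w \<in> W" using insert.prems(4)[of \<Delta>] by auto
    then obtain z where "z \<in> J" "nrm N w = nrm N z" using v by auto
    then have "w \<in> J" using insert.prems(3)[of w z] w by simp
    then show "v \<in> Bd ` {v \<in> J. inc v \<Delta>}" using v w by (auto simp: inc_def)
  qed (auto simp: inc_def)
  have im: "Bd ` nrm N ` J - {Bd (nrm N v)} = Bd ` nrm N ` (J - {v})" if "v \<in> J" for v
    using that insert.prems(2,3) by auto
  have IH: "match_count (proj N) (Bd ` nrm N ` J') R = bd_count J' R" if "J' \<subseteq> J" for J'
    by (rule insert.IH) (use that insert.prems in \<open>auto intro: finite_subset\<close>)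
  have "match_count (proj N) (Bd ` nrm N ` J) (insert \<Delta> R) = bd_count J R
     + (\<Sum>v\<in>{v \<in> J. inc v \<Delta>}. match_count (proj N) (Bd ` nrm N ` J - {Bd (nrm N v)}) R)"
    unfolding match_count_insert[OF finite_imageI[OF finite_imageI[OF insert.prems(1)]] insert.hyps] V IH[OF order_refl]
    by (subst sum.reindex) (auto simp: inj_on_def)
  also have "(\<Sum>v\<in>{v \<in> J. inc v \<Delta>}. match_count (proj N) (Bd ` nrm N ` J - {Bd (nrm N v)}) R)
     = (\<Sum>v\<in>{v \<in> J. inc v \<Delta>}. bd_count (J - {v}) R)"
  proof (rule sum.cong[OF refl])
    fix v assume v: "v \<in> {v \<in> J. inc v \<Delta>}"
    then have "v \<in> J" by simp
    then show "match_count (proj N) (Bd ` nrm N ` J - {Bd (nrm N v)}) R = bd_count (J - {v}) R"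
      unfolding im[OF \<open>v \<in> J\<close>] by (intro IH) auto
  qed
  finally show ?case using bd_count_insert[OF insert.prems(1) insert.hyps] by simp
qed

text \<open>The two ends of a polygon closed by a loop become one point of the disc. A matching uses
  this point at one end or at the other, and these are different matchings because the corner is
  recorded.\<close>

lemma proj_count_glued:
  assumes "finite R" "finite J" "J \<subseteq> W" "\<And>v w. v \<in> W \<Longrightarrow> w \<in> J \<Longrightarrow> nrm N v = nrm N w \<Longrightarrow> v = w"
    "\<And>\<Delta>. \<Delta> \<in> R \<Longrightarrow> corners \<Delta> \<subseteq> Bd ` W"
    "nrm N \<alpha> = nrm N \<beta>" "\<alpha> \<noteq> \<beta>" "\<alpha> \<in> W" "\<beta> \<in> W" "\<alpha> \<notin> J" "\<beta> \<notin> J"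
    "\<And>v. v \<in> W \<Longrightarrow> nrm N v = nrm N \<alpha> \<Longrightarrow> v = \<alpha> \<or> v = \<beta>"
  shows "match_count (proj N) (Bd ` nrm N ` insert \<alpha> J) R = bd_count (insert \<alpha> J) R + bd_count (insert \<beta> J) R"
  using assms
proof (induction R arbitrary: J rule: finite_induct)
  case empty
  have "match_count (proj N) (Bd ` nrm N ` insert \<alpha> J) {} = 0"
    by (rule match_count_isolated[of "Bd (nrm N \<alpha>)"]) auto
  moreover have "bd_count (insert \<alpha> J) {} = 0" "bd_count (insert \<beta> J) {} = 0"
    by (rule bd_count_isolated[of \<alpha>], auto, rule bd_count_isolated[of \<beta>], auto)
  ultimately show ?case by simp
next
  case (insert \<Delta> R)
  let ?V = "{v \<in> J. inc v \<Delta>}" and ?E = "{v \<in> {\<alpha>, \<beta>}. inc v \<Delta>}"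
  have V: "{v \<in> corners \<Delta>. proj N v \<in> Bd ` nrm N ` insert \<alpha> J} = Bd ` (?V \<union> ?E)"
  proof (intro equalityI subsetI)
    fix v assume v: "v \<in> {v \<in> corners \<Delta>. proj N v \<in> Bd ` nrm N ` insert \<alpha> J}"
    then obtain w where w: "v = Bd w" "w \<in> W" using insert.prems(4)[of \<Delta>] by auto
    then obtain z where z: "z \<in> insert \<alpha> J" "nrm N w = nrm N z" using v by auto
    then have "w \<in> J \<or> w = \<alpha> \<or> w = \<beta>" using insert.prems(3)[of w z] insert.prems(11)[of w] w by auto
    then show "v \<in> Bd ` (?V \<union> ?E)" using v w by (auto simp: inc_def)
  next
    fix v assume "v \<in> Bd ` (?V \<union> ?E)"
    then show "v \<in> {v \<in> corners \<Delta>. proj N v \<in> Bd ` nrm N ` insert \<alpha> J}"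
      using insert.prems(5) by (auto simp: inc_def)
  qed
  have J\<alpha>: "nrm N z \<noteq> nrm N \<alpha>" if "z \<in> J" for z using that insert.prems(3)[of \<alpha> z] insert.prems(7,9) by auto
  have im: "Bd ` nrm N ` insert \<alpha> J - {Bd (nrm N v)} = Bd ` nrm N ` insert \<alpha> (J - {v})" if "v \<in> J" for v
    using that insert.prems(2,3) J\<alpha> by force
  have im2: "Bd ` nrm N ` insert \<alpha> J - {Bd (nrm N v)} = Bd ` nrm N ` J" if "v \<in> ?E" for v
    using that insert.prems(5) J\<alpha> by auto
  have IH: "match_count (proj N) (Bd ` nrm N ` insert \<alpha> J') R = bd_count (insert \<alpha> J') R + bd_count (insert \<beta> J') R" if "J' \<subseteq> J" for J'
  proof (rule insert.IH)
    show "finite J'" using that insert.prems(1) finite_subset by blast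
  qed (use that insert.prems in blast)+
  have P: "match_count (proj N) (Bd ` nrm N ` J) R = bd_count J R"
    by (rule proj_count[OF insert.hyps(1) insert.prems(1,2,3)]) (use insert.prems(4) in auto)
  have fE: "finite ?V" "finite ?E" "?V \<inter> ?E = {}" using insert.prems(1,9,10) by auto
  have "match_count (proj N) (Bd ` nrm N ` insert \<alpha> J) (insert \<Delta> R) = (bd_count (insert \<alpha> J) R + bd_count (insert \<beta> J) R)
     + (\<Sum>v\<in>?V \<union> ?E. match_count (proj N) (Bd ` nrm N ` insert \<alpha> J - {Bd (nrm N v)}) R)"
    unfolding match_count_insert[OF finite_imageI[OF finite_imageI[OF finite.insertI[OF insert.prems(1)]]] insert.hyps] V IH[OF order_refl]
    by (subst sum.reindex) (auto simp: inj_on_def)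
  also have "(\<Sum>v\<in>?V \<union> ?E. match_count (proj N) (Bd ` nrm N ` insert \<alpha> J - {Bd (nrm N v)}) R)
     = (\<Sum>v\<in>?V. match_count (proj N) (Bd ` nrm N ` insert \<alpha> J - {Bd (nrm N v)}) R)
     + (\<Sum>v\<in>?E. match_count (proj N) (Bd ` nrm N ` insert \<alpha> J - {Bd (nrm N v)}) R)"
    by (rule sum.union_disjoint[OF fE])
  also have "(\<Sum>v\<in>?V. match_count (proj N) (Bd ` nrm N ` insert \<alpha> J - {Bd (nrm N v)}) R)
     = (\<Sum>v\<in>?V. bd_count (insert \<alpha> (J - {v})) R + bd_count (insert \<beta> (J - {v})) R)"
  proof (rule sum.cong[OF refl])
    fix v assume "v \<in> ?V"
    then have v: "v \<in> J" by simp
    show "match_count (proj N) (Bd ` nrm N ` insert \<alpha> J - {Bd (nrm N v)}) R = bd_count (insert \<alpha> (J - {v})) R + bd_count (insert \<beta> (J - {v})) R"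
      unfolding im[OF v] by (rule IH) blast
  qed
  also have "(\<Sum>v\<in>?E. match_count (proj N) (Bd ` nrm N ` insert \<alpha> J - {Bd (nrm N v)}) R) = (\<Sum>v\<in>?E. bd_count J R)"
    by (rule sum.cong[OF refl]) (simp only: im2 P)
  also have "\<dots> = (if inc \<alpha> \<Delta> then bd_count J R else 0) + (if inc \<beta> \<Delta> then bd_count J R else 0)"
  proof -
    have "?E = {\<alpha>, \<beta>} \<inter> {v. inc v \<Delta>}" by blast
    then show ?thesis using insert.prems(6) sum.inter_restrict[of "{\<alpha>, \<beta>}" "\<lambda>_. bd_count J R" "{v. inc v \<Delta>}"] by simp
  qed
  finally have L: "match_count (proj N) (Bd ` nrm N ` insert \<alpha> J) (insert \<Delta> R) = bd_count (insert \<alpha> J) R + bd_count (insert \<beta> J) R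
     + ((\<Sum>v\<in>?V. bd_count (insert \<alpha> (J - {v})) R + bd_count (insert \<beta> (J - {v})) R)
     + ((if inc \<alpha> \<Delta> then bd_count J R else 0) + (if inc \<beta> \<Delta> then bd_count J R else 0)))" .
  have E: "bd_count (insert z J) (insert \<Delta> R) = bd_count (insert z J) R + (if inc z \<Delta> then bd_count J R else 0)
     + (\<Sum>v\<in>?V. bd_count (insert z (J - {v})) R)" if z: "z \<notin> J" for z
  proof -
    have f: "finite (insert z J)" using insert.prems(1) by simp
    have s: "{v \<in> insert z J. inc v \<Delta>} = (if inc z \<Delta> then {z} else {}) \<union> ?V" by auto
    have "(\<Sum>v\<in>?V. bd_count (insert z J - {v}) R) = (\<Sum>v\<in>?V. bd_count (insert z (J - {v})) R)"
    proof (rule sum.cong[OF refl])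
      fix v assume "v \<in> ?V"
      then have "insert z J - {v} = insert z (J - {v})" using z by auto
      then show "bd_count (insert z J - {v}) R = bd_count (insert z (J - {v})) R" by simp
    qed
    moreover have "insert z J - {z} = J" using z by auto
    ultimately show ?thesis unfolding bd_count_insert[OF f insert.hyps] s
      using z fE(1) by simp
  qed
  show ?case unfolding L E[OF insert.prems(9)] E[OF insert.prems(10)] by (simp add: sum.distrib)
qed

lemma match_count_CTri:
  assumes "finite I" "finite R" "CTri u v \<notin> R" "u \<noteq> v"
  shows "match_count (proj N) I (insert (CTri u v) R) = match_count (proj N) I R
    + (if Bd (nrm N u) \<in> I then match_count (proj N) (I - {Bd (nrm N u)}) R else 0)
    + (if Bd (nrm N v) \<in> I then match_count (proj N) (I - {Bd (nrm N v)}) R else 0)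
    + (if Puncture \<in> I then match_count (proj N) (I - {Puncture}) R else 0)"
proof -
  let ?f = "\<lambda>w. match_count (proj N) (I - {proj N w}) R"
  have "{w \<in> corners (CTri u v). proj N w \<in> I} = {Bd u, Bd v, Puncture} \<inter> {w. proj N w \<in> I}" by auto
  then have "(\<Sum>w\<in>{w \<in> corners (CTri u v). proj N w \<in> I}. ?f w) =
      (\<Sum>w\<in>{Bd u, Bd v, Puncture}. if w \<in> {w. proj N w \<in> I} then ?f w else 0)"
    using sum.inter_restrict[of "{Bd u, Bd v, Puncture}" ?f "{w. proj N w \<in> I}"] by simp
  also have "\<dots> = (if Bd (nrm N u) \<in> I then match_count (proj N) (I - {Bd (nrm N u)}) R else 0)
    + ((if Bd (nrm N v) \<in> I then match_count (proj N) (I - {Bd (nrm N v)}) R else 0)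
    + (if Puncture \<in> I then match_count (proj N) (I - {Puncture}) R else 0))"
    using assms(4) by simp
  finally show ?thesis unfolding match_count_insert[OF assms(1-3)] by simp
qed

context slice_tri begin

lemma inj_norm: "inj_on (norm_tri N) (R \<union> CT)"
proof (rule inj_onI)
  fix \<Delta> \<Delta>' assume R: "\<Delta> \<in> R \<union> CT" "\<Delta>' \<in> R \<union> CT" and eq: "norm_tri N \<Delta> = norm_tri N \<Delta>'"
  obtain k where k: "\<Delta>' = shift_tri (k * int N) \<Delta>" using norm_tri_eqE[OF eq] .
  have "k = 0"
  proof (cases "\<Delta> \<in> R")
    case True
    then obtain a b d where t: "\<Delta> = Tri a b d" "\<alpha> \<le> a" "a < b" "b < d" "d \<le> \<beta>" using fan_tri[OF fan] by blast
    then have "\<Delta>' \<in> R" using R(2) k unfolding CT_def by (auto split: if_splits)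
    then have "\<alpha> \<le> a + k * int N" "d + k * int N \<le> \<beta>" using fan_tri[OF fan, of \<Delta>'] t k by auto
    then show ?thesis using t len by (cases rule: shift_cases[of k N]) linarith+
  next
    case False
    then have c: "\<Delta> \<in> CT" using R(1) by simp
    then have c': "\<Delta>' \<in> CT" using R(2) k CTri_notin unfolding CT_def by (auto split: if_splits)
    show ?thesis
    proof (cases "\<beta> = \<alpha> + int N")
      case True
      then show ?thesis using c c' k N3 unfolding CT_def by auto
    next
      case F: False
      then have b: "\<beta> = \<alpha> + int N - 1" using len by simp
      from c c' F consider "first_corner \<Delta>' = first_corner \<Delta>" | "first_corner \<Delta> = \<alpha>" "first_corner \<Delta>' = \<beta>"
        | "first_corner \<Delta> = \<beta>" "first_corner \<Delta>' = \<alpha>"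
        unfolding CT_def by (auto split: if_splits)
      then show ?thesis
      proof cases
        case 1
        then show ?thesis using k N3 by simp
      next
        case 2
        then have "\<beta> = \<alpha> + k * int N" using k by simp
        then show ?thesis using b N3 by (cases rule: shift_cases[of k N]) linarith+
      next
        case 3
        then have "\<alpha> = \<beta> + k * int N" using k by simp
        then show ?thesis using b N3 by (cases rule: shift_cases[of k N]) linarith+
      qed
    qed
  qed
  then show "\<Delta> = \<Delta>'" using k by simp
qed

lemma triangles_eq: "triangles N T = norm_tri N ` (R \<union> CT)"
proof -
  have "norm_tri N ` lifted_triangles N T = norm_tri N ` (R \<union> CT)"
  proof (intro equalityI subsetI)
    fix \<Delta> assume "\<Delta> \<in> norm_tri N ` lifted_triangles N T"
    then obtain \<Delta>1 where \<Delta>1: "\<Delta>1 \<in> lifted_triangles N T" "\<Delta> = norm_tri N \<Delta>1" by blast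
    then obtain k \<Delta>0 where "\<Delta>0 \<in> R \<union> CT" "\<Delta> = norm_tri N (shift_tri (k * int N) \<Delta>0)"
      using lifted_iff[of \<Delta>1] by blast
    then show "\<Delta> \<in> norm_tri N ` (R \<union> CT)" by simp
  next
    fix \<Delta> assume "\<Delta> \<in> norm_tri N ` (R \<union> CT)"
    then obtain \<Delta>0 where d: "\<Delta>0 \<in> R \<union> CT" "\<Delta> = norm_tri N \<Delta>0" by blast
    then have "\<Delta>0 \<in> lifted_triangles N T" unfolding lifted_iff by (intro exI[of _ 0]) auto
    then show "\<Delta> \<in> norm_tri N ` lifted_triangles N T" using d by blast
  qed
  then show ?thesis using triangles_norm N3 by simp
qed

lemma nrm_window: assumes "\<alpha> \<le> x" "x < \<alpha> + int N"
  shows "{1..int N} - {nrm N x} = nrm N ` ({\<alpha>..<\<alpha> + int N} - {x})"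
proof (intro equalityI subsetI)
  fix z assume z: "z \<in> {1..int N} - {nrm N x}"
  obtain k where k: "\<alpha> + k * int N \<le> z" "z < \<alpha> + k * int N + int N" using window .
  define w where "w = z + (- k) * int N"
  have "nrm N w = nrm N z" unfolding w_def by (rule nrm_shift)
  then have w: "nrm N w = z" using z by (simp add: nrm_id)
  have "w \<in> {\<alpha>..<\<alpha> + int N}" using k by (simp add: w_def)
  then show "z \<in> nrm N ` ({\<alpha>..<\<alpha> + int N} - {x})" using w z by (intro image_eqI[of _ _ w]) auto
next
  fix z assume "z \<in> nrm N ` ({\<alpha>..<\<alpha> + int N} - {x})"
  then obtain w where "z = nrm N w" "w \<in> {\<alpha>..<\<alpha> + int N} - {x}" by blast
  then have w: "z = nrm N w" "\<alpha> \<le> w" "w < \<alpha> + int N" "w \<noteq> x" by auto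
  then have "z \<noteq> nrm N x" using nrm_eq_window[of \<alpha> w N x] assms by simp
  then show "z \<in> {1..int N} - {nrm N x}" using w nrm_range[of N w] N3 by auto
qed

lemma R_corners: "\<Delta> \<in> R \<Longrightarrow> corners \<Delta> \<subseteq> Bd ` {\<alpha>..\<beta>}"
  using fan_tri[OF fan, of \<Delta>] by auto

lemma R_puncture: "Puncture \<in> I \<Longrightarrow> match_count (proj N) I R = 0"
proof (rule match_count_isolated)
  fix \<Delta> v assume "\<Delta> \<in> R" "v \<in> corners \<Delta>"
  then show "proj N v \<noteq> Puncture" using R_corners by force
qed

text \<open>There are no more triangles than points, so all are used: one of the two triangles at
  the puncture is matched to the puncture and the other to \<open>\<alpha>\<close> or
  \<open>\<beta>\<close>. Exchanging the two triangles gives the factor \<open>S = 2\<close>, and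
  the choice of the end gives the two summands in \<open>c_split\<close>.\<close>

lemma m_loop_two:
  assumes \<beta>: "\<beta> \<noteq> \<alpha> + int N" and x: "\<alpha> \<le> x" "x < \<alpha> + int N"
  shows "match_count (proj N) (Bd ` ({1..int N} - {nrm N x}) \<union> {Puncture}) (R \<union> CT) = S * c x"
proof -
  have b: "\<beta> = \<alpha> + int N - 1" using len \<beta> by simp
  have l: "\<alpha> < \<beta>" using fan_less[OF fan] .
  define J where "J = {\<alpha>..\<beta>} - {x}"
  define X where "X = Bd ` nrm N ` J"
  define p q where "p = Bd (nrm N \<alpha>)" and "q = Bd (nrm N \<beta>)"
  let ?D = "CTri \<beta> (\<alpha> + int N)"
  define g where "g Y = match_count (proj N) Y R" for Y
  define h where "h Y = match_count (proj N) Y (insert ?D R)" for Y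
  have aN: "nrm N (\<alpha> + int N) = nrm N \<alpha>" using nrm_shift[of N \<alpha> 1] by simp
  have win: "{\<alpha>..<\<alpha> + int N} = {\<alpha>..\<beta>}" using b by auto
  have I: "Bd ` ({1..int N} - {nrm N x}) \<union> {Puncture} = insert Puncture X"
    unfolding nrm_window[OF x] win by (simp add: X_def J_def)
  have nw: "nrm N v = nrm N w \<longleftrightarrow> v = w" if "v \<in> {\<alpha>..\<beta>}" "w \<in> {\<alpha>..\<beta>}" for v w
    using that nrm_eq_window[of \<alpha> v N w] b by simp
  have finX: "finite X" and PX: "Puncture \<notin> X" "p \<noteq> Puncture" "q \<noteq> Puncture" by (auto simp: X_def J_def p_def q_def)
  have pX: "p \<in> X \<longleftrightarrow> x \<noteq> \<alpha>" and qX: "q \<in> X \<longleftrightarrow> x \<noteq> \<beta>"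
    using nw l by (auto simp: X_def J_def p_def q_def)
  have gP: "g Y = 0" if "Puncture \<in> Y" for Y using R_puncture that by (simp add: g_def)
  have CTn: "CTri \<alpha> \<beta> \<notin> insert ?D R" "?D \<notin> R" "finite (insert ?D R)" "\<alpha> \<noteq> \<beta>" "\<beta> \<noteq> \<alpha> + int N"
    using CTri_notin finR l \<beta> by auto
  have hE: "h Y = g Y + (if q \<in> Y then g (Y - {q}) else 0) + (if p \<in> Y then g (Y - {p}) else 0)
     + (if Puncture \<in> Y then g (Y - {Puncture}) else 0)" if "finite Y" for Y
    unfolding h_def match_count_CTri[OF that finR CTn(2) CTn(5)] aN g_def p_def q_def ..
  have hP: "h (insert Puncture Y) = g Y" if "finite Y" "Puncture \<notin> Y" for Y
    using hE[of "insert Puncture Y"] that gP PX by (simp add: insert_Diff_if)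
  have h0: "h Y = g Y + (if q \<in> Y then g (Y - {q}) else 0) + (if p \<in> Y then g (Y - {p}) else 0)"
    if "finite Y" "Puncture \<notin> Y" for Y using hE[OF that(1)] that by simp
  have CT: "R \<union> CT = insert (CTri \<alpha> \<beta>) (insert ?D R)" unfolding CT_def using \<beta> by auto
  have "match_count (proj N) (insert Puncture X) (insert (CTri \<alpha> \<beta>) (insert ?D R)) =
     h (insert Puncture X) + (if p \<in> insert Puncture X then h (insert Puncture X - {p}) else 0)
     + (if q \<in> insert Puncture X then h (insert Puncture X - {q}) else 0)
     + (if Puncture \<in> insert Puncture X then h (insert Puncture X - {Puncture}) else 0)"
    unfolding h_def p_def q_def by (rule match_count_CTri) (use CTn finX in simp_all)
  also have "\<dots> = g X + (if x \<noteq> \<alpha> then g (X - {p}) else 0) + (if x \<noteq> \<beta> then g (X - {q}) else 0)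
     + (g X + (if x \<noteq> \<beta> then g (X - {q}) else 0) + (if x \<noteq> \<alpha> then g (X - {p}) else 0))"
  proof -
    have "insert Puncture X - {p} = insert Puncture (X - {p})" "insert Puncture X - {q} = insert Puncture (X - {q})"
      "insert Puncture X - {Puncture} = X" using PX by auto
    then show ?thesis using hP[of X] hP[of "X - {p}"] hP[of "X - {q}"] h0[of X] finX PX pX qX by simp
  qed
  also have "g X = 0"
  proof -
    have "g X = bd_count J R" unfolding g_def X_def
      by (rule proj_count[OF finR, where W = "{\<alpha>..\<beta>}"]) (use nw R_corners in \<open>auto simp: J_def\<close>)
    also have "\<dots> = 0"
      using fan_card[OF fan] finR x l b by (intro bd_count_card) (simp_all add: J_def card_Diff_singleton)
    finally show ?thesis .
  qed
  also have "(if x \<noteq> \<alpha> then g (X - {p}) else 0) = lam \<alpha> x"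
  proof (cases "x = \<alpha>")
    case False
    have "X - {p} = Bd ` nrm N ` ({\<alpha>..\<beta>} - {\<alpha>, x})"
      using nw l unfolding X_def J_def p_def by auto
    then have "g (X - {p}) = bd_count ({\<alpha>..\<beta>} - {\<alpha>, x}) R" unfolding g_def
      by (simp only:) (rule proj_count[OF finR, where W = "{\<alpha>..\<beta>}"], use nw R_corners in auto)
    then show ?thesis using False count_two[of \<alpha> x] x b by simp
  qed simp
  also have "(if x \<noteq> \<beta> then g (X - {q}) else 0) = lam x \<beta>"
  proof (cases "x = \<beta>")
    case False
    have "X - {q} = Bd ` nrm N ` ({\<alpha>..\<beta>} - {x, \<beta>})"
      using nw l unfolding X_def J_def q_def by auto
    then have "g (X - {q}) = bd_count ({\<alpha>..\<beta>} - {x, \<beta>}) R" unfolding g_def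
      by (simp only:) (rule proj_count[OF finR, where W = "{\<alpha>..\<beta>}"], use nw R_corners in auto)
    then show ?thesis using False count_two[of x \<beta>] x b by simp
  qed simp
  finally show ?thesis unfolding I CT using c_split[of x] S_value \<beta> by simp
qed

text \<open>The self-folded triangle is the only one at the puncture and is used up by it. The other
  points are matched within the fan, whose ends are glued, and \<open>S = 1\<close>.\<close>

lemma m_loop_loop:
  assumes \<beta>: "\<beta> = \<alpha> + int N" and x: "\<alpha> \<le> x" "x < \<alpha> + int N"
  shows "match_count (proj N) (Bd ` ({1..int N} - {nrm N x}) \<union> {Puncture}) (R \<union> CT) = S * c x"
proof -
  define X where "X = Bd ` nrm N ` ({\<alpha>..<\<beta>} - {x})"
  have I: "Bd ` ({1..int N} - {nrm N x}) \<union> {Puncture} = insert Puncture X"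
    unfolding nrm_window[OF x] \<beta> X_def by simp
  have finX: "finite X" and PX: "Puncture \<notin> X" by (auto simp: X_def)
  have ab: "nrm N \<beta> = nrm N \<alpha>" "\<alpha> \<noteq> \<beta>" using \<beta> nrm_shift[of N \<alpha> 1] N3 by auto
  have nw: "v = w" if "v \<in> {\<alpha>..\<beta>}" "w \<in> {\<alpha><..<\<beta>}" "nrm N v = nrm N w" for v w
  proof (cases "v = \<beta>")
    case True
    then show ?thesis using that ab nrm_eq_window[of \<alpha> \<alpha> N w] \<beta> by simp
  next
    case False
    then show ?thesis using that nrm_eq_window[of \<alpha> v N w] \<beta> by simp
  qed
  have CT: "R \<union> CT = insert (CTri \<alpha> \<beta>) R" unfolding CT_def using \<beta> by auto
  have dP: "insert Puncture X - {Puncture} = X" using PX by auto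
  have "match_count (proj N) (insert Puncture X) (insert (CTri \<alpha> \<beta>) R) = match_count (proj N) X R"
    unfolding match_count_CTri[OF finite.insertI[OF finX] finR CTri_notin ab(2)]
    using R_puncture dP by simp
  also have "\<dots> = c x"
  proof (cases "x = \<alpha>")
    case True
    then have "{\<alpha>..<\<beta>} - {x} = {\<alpha><..<\<beta>}" by auto
    then have "match_count (proj N) X R = bd_count {\<alpha><..<\<beta>} R" unfolding X_def
      by (simp only:) (rule proj_count[OF finR, where W = "{\<alpha>..\<beta>}"], use nw R_corners in auto)
    then show ?thesis using count_open[of \<alpha> \<beta>] lam_outer c_ends True x \<beta> by simp
  next
    case False
    define J where "J = {\<alpha><..<\<beta>} - {x}"
    have e: "{\<alpha>..<\<beta>} - {x} = insert \<alpha> J" using False x \<beta> by (auto simp: J_def)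
    have W: "v = \<alpha> \<or> v = \<beta>" if "v \<in> {\<alpha>..\<beta>}" "nrm N v = nrm N \<alpha>" for v
      using that nrm_eq_window[of \<alpha> v N \<alpha>] \<beta> by force
    have "match_count (proj N) X R = bd_count (insert \<alpha> J) R + bd_count (insert \<beta> J) R"
      unfolding X_def e
    proof (rule proj_count_glued[OF finR, where W = "{\<alpha>..\<beta>}"])
      show "\<And>v w. v \<in> {\<alpha>..\<beta>} \<Longrightarrow> w \<in> J \<Longrightarrow> nrm N v = nrm N w \<Longrightarrow> v = w" using nw by (auto simp: J_def)
    qed (use W R_corners ab x \<beta> in \<open>auto simp: J_def\<close>)
    moreover have "insert \<alpha> J = {\<alpha>..\<beta>} - {x, \<beta>}" "insert \<beta> J = {\<alpha>..\<beta>} - {\<alpha>, x}"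
      using False x \<beta> ab(2) by (auto simp: J_def)
    ultimately show ?thesis using count_two[of x \<beta>] count_two[of \<alpha> x] c_split[of x] False x \<beta> by simp
  qed
  finally show ?thesis unfolding I CT using S_value \<beta> by simp
qed

lemma m_loop_value:
  assumes "1 \<le> i" "i \<le> int N"
  shows "of_nat (m_loop N T i) = S * c i"
proof -
  obtain k where k: "\<alpha> + k * int N \<le> i" "i < \<alpha> + k * int N + int N" using window .
  interpret s: slice_tri N c t S T "\<alpha> + k * int N" "\<beta> + k * int N" "shift_tri (k * int N) ` R"
    "(\<lambda>(a, b). (a + k * int N, b + k * int N)) ` Q" by (rule shifted)
  let ?I = "Bd ` ({1..int N} - {nrm N i}) \<union> {Puncture}"
  have "of_nat (m_loop N T i) = match_count (proj N) ?I (triangles N T)"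
    using assms by (simp add: m_loop_def match_count_def nrm_id)
  also have "\<dots> = match_count (proj N) ?I (shift_tri (k * int N) ` R \<union> s.CT)"
    unfolding s.triangles_eq using s.inj_norm s.finR
    by (intro match_count_norm) (auto simp: s.CT_def)
  also have "\<dots> = S * c i" using s.m_loop_two[of i] s.m_loop_loop[of i] k by blast
  finally show ?thesis .
qed

theorem F_plain_value:
  assumes "D \<in> plain_arcs N"
  shows "of_nat (F_plain N T D) = arc_val D"
proof (cases D)
  case (Periph i j)
  then have "1 \<le> i" "i \<le> int N" "1 \<le> j" "j \<le> int N" using assms by (auto simp: plain_arcs_def)
  then show ?thesis using Periph m_loop_value m_arc_value by simp
next
  case (Central i)
  then show ?thesis using m_central_value by simp
qed

lemma arc_val_T: assumes "D \<in> T" shows "arc_val D = 1"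
proof -
  consider a b where "(a, b) \<in> Q" "D = parc N a b" | "D = spoke N \<alpha>" | "D = spoke N \<beta>"
    using assms unfolding T_eq by auto
  then show ?thesis
  proof cases
    case 1
    have d: "\<alpha> \<le> a" "a + 2 \<le> b" "b \<le> \<beta>" using fan_diag[OF fan 1(1)] by auto
    show ?thesis
    proof (cases "b = a + int N")
      case True
      \<comment> \<open>This is the loop, valued as a notched arc by \<open>S * c a\<close>, which
        is 1 because \<open>S = 1\<close> in this case.\<close>
      then have "a = \<alpha>" "\<beta> = \<alpha> + int N" using d len by auto
      then show ?thesis using 1(2) True arc_val_loop[of a] S_value c_ends by simp
    next
      case False
      then have "b < a + int N" using d len by auto
      then show ?thesis using 1 arc_val_parc[of a b] d lamQ by simp
    qed
  qed (use c_ends in simp_all)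
qed

lemma card_T: "card T = N"
proof -
  have cQ: "fan p q R' Q' \<Longrightarrow> finite Q' \<and> int (card Q') = q - p - 1" for p q R' Q'
  proof (induction rule: fan.induct)
    case (right p q R Q)
    have "(p, q + 1) \<notin> Q" using fan_diag[OF right.hyps, of p "q + 1"] by auto
    then show ?case using right.IH by simp
  next
    case (left p q R Q)
    have "(p - 1, q) \<notin> Q" using fan_diag[OF left.hyps, of "p - 1" q] by auto
    then show ?case using left.IH by simp
  qed simp
  have fQ: "finite Q" "int (card Q) = \<beta> - \<alpha> - 1" using cQ[OF fan] by auto
  have "inj_on (\<lambda>(a, b). parc N a b) Q"
  proof (rule inj_onI)
    fix z z' assume z: "z \<in> Q" "z' \<in> Q" "(case z of (a, b) \<Rightarrow> parc N a b) = (case z' of (a, b) \<Rightarrow> parc N a b)"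
    obtain a b a' b' where zz: "z = (a, b)" "z' = (a', b')" by (metis surj_pair)
    have "parc N a b = parc N a' b'" using z(3) zz by simp
    moreover have "\<alpha> \<le> a" "a + 2 \<le> b" "b \<le> \<beta>" "\<alpha> \<le> a'" "a' + 2 \<le> b'" "b' \<le> \<beta>"
      using fan_diag[OF fan] z(1,2) zz by blast+
    ultimately have "a = a' \<and> b = b'"
      using len by (subst (asm) parc_eq_window[of \<alpha> a N a' b b']) auto
    then show "z = z'" using zz by simp
  qed
  then have cP: "card ((\<lambda>(a, b). parc N a b) ` Q) = card Q" by (rule card_image)
  have disj: "(\<lambda>(a, b). parc N a b) ` Q \<inter> {spoke N \<alpha>, spoke N \<beta>} = {}" by auto
  have cs: "card {spoke N \<alpha>, spoke N \<beta>} = (if \<beta> = \<alpha> + int N then 1 else 2)"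
  proof (cases "\<beta> = \<alpha> + int N")
    case True
    then have "nrm N \<beta> = nrm N \<alpha>" using nrm_shift[of N \<alpha> 1] by simp
    then show ?thesis using True by simp
  next
    case False
    then have "\<beta> = \<alpha> + int N - 1" using len by simp
    then have "nrm N \<alpha> \<noteq> nrm N \<beta>" using nrm_neq[of \<alpha> \<beta>] N3 by simp
    then show ?thesis using False by simp
  qed
  have "card T = card Q + (if \<beta> = \<alpha> + int N then 1 else 2)"
    unfolding T_eq using fQ(1) disj cP cs by (subst card_Un_disjoint) auto
  then show ?thesis using fQ(2) len by (auto split: if_splits)
qed

end

subsection \<open>Slices\<close>

text \<open>The weights of the fan, with 1 at both ends, are extended periodically, and
  \<open>t\<close> is then obtained by summing its prescribed increments.\<close>

lemma slice_tri_exists: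
  assumes N: "N \<ge> 3" and fan: "fan \<alpha> \<beta> R Q" and len: "\<beta> = \<alpha> + int N - 1 \<or> \<beta> = \<alpha> + int N"
    and T: "T = (\<lambda>(a, b). parc N a b) ` Q \<union> {spoke N \<alpha>, spoke N \<beta>}"
  obtains c t S where "slice_tri N c t S T \<alpha> \<beta> R Q"
proof -
  obtain c0 :: "int \<Rightarrow> rat" where c0: "c0 \<alpha> = 1" "c0 \<beta> = 1" "\<And>x. c0 x > 0"
    and w: "\<And>t a b. (\<forall>x. \<alpha> \<le> x \<longrightarrow> x < \<beta> \<longrightarrow> t (x + 1) = t x + 1 / (c0 x * c0 (x + 1))) \<Longrightarrow>
       (a, b) \<in> Q \<Longrightarrow> c0 a * c0 b * (t b - t a) = 1"
  proof -
    from fan_weights[OF fan zero_less_one zero_less_one]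
    obtain c1 :: "int \<Rightarrow> rat" where c1: "c1 \<alpha> = 1 \<and> c1 \<beta> = 1 \<and> (\<forall>x. c1 x > 0) \<and>
      (\<forall>t. (\<forall>x. \<alpha> \<le> x \<longrightarrow> x < \<beta> \<longrightarrow> t (x + 1) = t x + 1 / (c1 x * c1 (x + 1))) \<longrightarrow>
       (\<forall>(a, b)\<in>insert (\<alpha>, \<beta>) Q. c1 a * c1 b * (t b - t a) = 1))" by (rule exE)
    show thesis
    proof (rule that[of c1])
      fix t a b assume A: "\<forall>x. \<alpha> \<le> x \<longrightarrow> x < \<beta> \<longrightarrow> t (x + 1) = t x + 1 / (c1 x * c1 (x + 1))" and ab: "(a, b) \<in> Q"
      have "\<forall>(a, b)\<in>insert (\<alpha>, \<beta>) Q. c1 a * c1 b * (t b - t a) = 1"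
        by (rule c1[THEN conjunct2, THEN conjunct2, THEN conjunct2, THEN spec, THEN mp, OF A])
      then show "c1 a * c1 b * (t b - t a) = 1" using ab by auto
    qed (simp_all only: c1)
  qed
  define c where "c x = c0 (\<alpha> + (x - \<alpha>) mod int N)" for x
  \<comment> \<open>If \<open>\<beta> = \<alpha> + int N\<close>, the periodic extension is
    consistent at \<open>\<beta>\<close> because both ends have weight 1.\<close>
  have cc: "c x = c0 x" if "\<alpha> \<le> x" "x \<le> \<beta>" for x
  proof (cases "x = \<alpha> + int N")
    case True
    then have "x = \<beta>" using that len by auto
    moreover have "(x - \<alpha>) mod int N = 0" using True by simp
    ultimately show ?thesis using c0 by (simp add: c_def)
  next
    case False
    then have "(x - \<alpha>) mod int N = x - \<alpha>" using that len by auto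
    then show ?thesis by (simp add: c_def)
  qed
  have c_pos: "c x > 0" for x using c0 by (simp add: c_def)
  have c_per: "c (x + int N) = c x" for x
  proof -
    have "(x + int N - \<alpha>) mod int N = (x - \<alpha>) mod int N"
      using mod_add_self2[of "x - \<alpha>" "int N"] by (simp add: algebra_simps)
    then show ?thesis by (simp add: c_def)
  qed
  define g where "g x = 1 / (c x * c (x + 1))" for x
  have g_per: "g (x + int N) = g x" for x
    using c_per[of x] c_per[of "x + 1"] by (simp add: g_def algebra_simps)
  define t where "t x = (if x \<ge> 0 then \<Sum>y\<in>{0..<x}. g y else - (\<Sum>y\<in>{x..<0}. g y))" for x :: int
  have t_step: "t (x + 1) = t x + g x" for x
  proof (cases "x \<ge> 0")
    case True
    then have "{0..<x + 1} = insert x {0..<x}" by auto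
    then show ?thesis using True by (simp add: t_def)
  next
    case False
    then have "{x..<0} = insert x {x + 1..<0}" by auto
    then have s: "(\<Sum>y\<in>{x..<0}. g y) = g x + (\<Sum>y\<in>{x + 1..<0}. g y)" by simp
    show ?thesis
    proof (cases "x = -1")
      case True
      then show ?thesis using s by (simp add: t_def)
    next
      case F: False
      then show ?thesis using s False by (simp add: t_def)
    qed
  qed
  have d_step: "t (x + 1 + int N) - t (x + 1) = t (x + int N) - t x" for x
    using t_step[of x] t_step[of "x + int N"] g_per[of x] by (simp add: algebra_simps)
  have t_per: "t (x + int N) = t x + t (int N)" for x
  proof -
    have "t (x + int N) - t x = t (int N)"
    proof (induction x rule: int_induct[of _ 0])
      case base
      show ?case by (simp add: t_def)
    next
      case (step1 i)
      then show ?case using d_step[of i] by simp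
    next
      case (step2 i)
      then show ?case using d_step[of "i - 1"] by simp
    qed
    then show ?thesis by simp
  qed
  interpret l: lambda_data N c t "t (int N)"
    using N c_pos c_per t_step t_per by unfold_locales (auto simp: g_def)
  have "\<forall>x. \<alpha> \<le> x \<longrightarrow> x < \<beta> \<longrightarrow> t (x + 1) = t x + 1 / (c0 x * c0 (x + 1))"
    using t_step cc by (simp add: g_def)
  then have "l.lam a b = 1" if "(a, b) \<in> Q" for a b
    using w[of t a b] that cc fan_diag[OF fan that] by (simp add: l.lam_def)
  then have "slice_tri N c t (t (int N)) T \<alpha> \<beta> R Q"
    using fan len T c0 cc fan_less[OF fan] by unfold_locales auto
  then show thesis by (rule that)
qed

lemma nrm_plus: "nrm N (nrm N x + y) = nrm N (x + y)"
proof -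
  obtain k where k: "nrm N x = x + k * int N" using nrm_obtain .
  have "nrm N x + y = (x + y) + k * int N" using k by simp
  then show ?thesis by (simp only: nrm_shift)
qed

lemma nrm_minus1: "nrm N (nrm N x - 1) = nrm N (x - 1)"
  using nrm_plus[of N x "-1"] by simp

text \<open>With compatible lifts, each step of the slice adds the boundary vertex next to the outer
  side, which is a step of \<open>fan\<close>.\<close>

lemma slice_chain:
  assumes N: "N \<ge> 3"
    and E1: "\<exists>a\<in>{1..int N}. E 1 = Periph a (nrm N (a + 2))"
    and Ek: "\<forall>k\<in>{2..N - 2}. \<exists>p q. E (k - 1) = Periph p q \<and> E k \<in> {Periph p (nrm N (q + 1)), Periph (nrm N (p - 1)) q}"
    and k: "1 \<le> k" "k \<le> N - 2"
  shows "\<exists>p q R Q. fan p q R Q \<and> q = p + int k + 1 \<and> E k = parc N p q \<and> E ` {1..k} = (\<lambda>(a, b). parc N a b) ` Q"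
  using k
proof (induction k rule: nat_induct_at_least)
  case base
  obtain a where a: "1 \<le> a" "a \<le> int N" "E 1 = Periph a (nrm N (a + 2))" using E1 by auto
  have "fan a (a + 1 + 1) {Tri a (a + 1) (a + 1 + 1)} {(a, a + 1 + 1)}" by (rule fan.right[OF fan.base])
  moreover have "E 1 = parc N a (a + 1 + 1)" using a by (simp add: nrm_id add.commute)
  moreover have "E ` {1..1} = (\<lambda>(a, b). parc N a b) ` {(a, a + 1 + 1)}" using calculation(2) by simp
  ultimately show ?case by (intro exI conjI) (auto simp del: image_insert)
next
  case (Suc k)
  then obtain p q R Q where IH: "fan p q R Q" "q = p + int k + 1" "E k = parc N p q" "E ` {1..k} = (\<lambda>(a, b). parc N a b) ` Q"
    by auto
  have "Suc k \<in> {2..N - 2}" using Suc by auto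
  then obtain p' q' where pq: "E k = Periph p' q'" "E (Suc k) \<in> {Periph p' (nrm N (q' + 1)), Periph (nrm N (p' - 1)) q'}"
    using Ek by fastforce
  then have p': "p' = nrm N p" "q' = nrm N q" using IH(3) by auto
  have im: "E ` {1..Suc k} = insert (E (Suc k)) (E ` {1..k})" using Suc.hyps by (simp add: atLeastAtMostSuc_conv)
  from pq(2) p' consider "E (Suc k) = parc N p (q + 1)" | "E (Suc k) = parc N (p - 1) q"
    using nrm_plus[of N q 1] nrm_minus1[of N p] by auto
  then show ?case
  proof cases
    case 1
    then have "E ` {1..Suc k} = (\<lambda>(a, b). parc N a b) ` insert (p, q + 1) Q" using im IH(4) by simp
    moreover have "q + 1 = p + int (Suc k) + 1" using IH(2) by simp
    ultimately show ?thesis using fan.right[OF IH(1)] 1 by blast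
  next
    case 2
    then have "E ` {1..Suc k} = (\<lambda>(a, b). parc N a b) ` insert (p - 1, q) Q" using im IH(4) by simp
    moreover have "q = (p - 1) + int (Suc k) + 1" using IH(2) by simp
    ultimately show ?thesis using fan.left[OF IH(1)] 2 by blast
  qed
qed

text \<open>\<open>tag\<close> fails to invert \<open>plain_of\<close> only at
  \<open>TPeriph i i\<close>, and this never arises from \<open>tag\<close>, swapped or not.\<close>

lemma tag_plain_of:
  assumes "N \<ge> 3" "tagged_triangulation N TT" shows "TT = tag ` plain_of ` TT"
proof -
  obtain T where T: "TT = tag ` T \<or> TT = swap_tag ` tag ` T"
    using assms tagged_triangulation_iff by blast
  have "tag (plain_of \<gamma>) = \<gamma>" if g: "\<gamma> \<in> TT" for \<gamma>
  proof -
    obtain D where "\<gamma> = tag D \<or> \<gamma> = swap_tag (tag D)" using T g by blast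
    then show ?thesis by (cases D) auto
  qed
  then show ?thesis by (simp add: image_image)
qed

text \<open>A central arc together with the loop at the same point makes one more step of the fan,
  to the right or to the left. Two central arcs leave the fan as it is. Two loops stand for two
  notched arcs and are not part of a plain triangulation, hence the separate second case.\<close>

lemma slice_cases:
  assumes N: "N \<ge> 3" and S: "slice N S"
  obtains \<alpha> \<beta> R Q where "fan \<alpha> \<beta> R Q" "\<beta> = \<alpha> + int N - 1 \<or> \<beta> = \<alpha> + int N"
      "S = (\<lambda>(a, b). parc N a b) ` Q \<union> {spoke N \<alpha>, spoke N \<beta>}"
  | \<alpha> \<beta> R Q where "fan \<alpha> \<beta> R Q" "\<beta> = \<alpha> + int N - 1"
      "S = (\<lambda>(a, b). parc N a b) ` Q \<union> {parc N \<alpha> \<alpha>, parc N \<beta> \<beta>}"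
proof -
  from S obtain E i h where SE: "S = E ` {1..N}"
    and E1: "\<exists>a\<in>{1..int N}. E 1 = Periph a (nrm N (a + 2))"
    and Ek: "\<forall>k\<in>{2..N - 2}. \<exists>p q. E (k - 1) = Periph p q \<and> E k \<in> {Periph p (nrm N (q + 1)), Periph (nrm N (p - 1)) q}"
    and En: "E (N - 2) = Periph i h" "h = nrm N (i - 1)"
    and last: "{E (N - 1), E N} \<in> {{Central i, Periph i i}, {Central h, Periph h h}, {Central i, Central h}, {Periph i i, Periph h h}}"
    unfolding slice_def by blast
  obtain p q R Q where f: "fan p q R Q" and q: "q = p + int (N - 2) + 1" and e: "E (N - 2) = parc N p q"
    and im: "E ` {1..N - 2} = (\<lambda>(a, b). parc N a b) ` Q"
  proof -
    have "1 \<le> N - 2" using N by simp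
    then show thesis using slice_chain[OF N E1 Ek, of "N - 2"] that by blast
  qed
  have q': "q = p + int N - 1" using q N by simp
  have ih: "i = nrm N p" "h = nrm N q" using e En(1) by auto
  have "{1..N} = {1..N - 2} \<union> {N - 1, N}" using N by auto
  then have S': "S = (\<lambda>(a, b). parc N a b) ` Q \<union> {E (N - 1), E N}" using SE im by (simp add: image_Un)
  have p1: "nrm N (q + 1) = nrm N p" using q' nrm_shift[of N p 1] by simp
  have p2: "nrm N (p - 1) = nrm N q"
  proof -
    have "q = (p - 1) + 1 * int N" using q' by simp
    then show ?thesis by (simp only: nrm_shift)
  qed
  from last consider "{E (N - 1), E N} = {Central i, Periph i i}" | "{E (N - 1), E N} = {Central h, Periph h h}"
    | "{E (N - 1), E N} = {Central i, Central h}" | "{E (N - 1), E N} = {Periph i i, Periph h h}" by blast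
  then show thesis
  proof cases
    case 1
    have "S = (\<lambda>(a, b). parc N a b) ` insert (p, q + 1) Q \<union> {spoke N p, spoke N (q + 1)}"
      unfolding S' 1 using ih p1 by auto
    then show thesis using that(1)[OF fan.right[OF f]] q' by simp
  next
    case 2
    have "S = (\<lambda>(a, b). parc N a b) ` insert (p - 1, q) Q \<union> {spoke N (p - 1), spoke N q}"
      unfolding S' 2 using ih p2 by auto
    then show thesis using that(1)[OF fan.left[OF f]] q' by simp
  next
    case 3
    then show thesis using that(1)[OF f] q' S' ih by simp
  next
    case 4
    then show thesis using that(2)[OF f] q' S' ih by simp
  qed
qed

section \<open>Comparison of both sides for plain and for notched slices\<close>

context slice_tri begin

lemma loop_T: "Periph i i \<in> T \<Longrightarrow> i = nrm N \<alpha> \<and> \<beta> = \<alpha> + int N"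
proof -
  assume "Periph i i \<in> T"
  then obtain a b where q: "(a, b) \<in> Q" "nrm N a = i" "nrm N b = i" unfolding T_eq by auto
  have d: "\<alpha> \<le> a" "a + 2 \<le> b" "b \<le> \<beta>" using fan_diag[OF fan q(1)] by auto
  have "\<not> b < a + int N" using nrm_neq[of a b] q d by auto
  then have "a = \<alpha>" "\<beta> = \<alpha> + int N" using d len by auto
  then show ?thesis using q by auto
qed

lemma plain_case:
  assumes "tagged_triangulation N (tag ` T)" "D \<in> plain_arcs N"
  shows "of_nat (F_tagged N (tag ` T) D) = F_cluster N (tag ` T) D"
proof -
  have "TNotched i = tag D \<longleftrightarrow> D = Periph i i" for i D by (cases D) auto
  then have "{i. TNotched i \<in> tag ` T} \<subseteq> {nrm N \<alpha>}" using loop_T by (auto simp: image_iff)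
  then have "card {i. TNotched i \<in> tag ` T} \<le> card {nrm N \<alpha>}" by (intro card_mono) auto
  then have "\<not> many_notched (tag ` T)" by (simp add: many_notched_def)
  then have "F_tagged N (tag ` T) D = F_plain N T D" by (simp add: F_tagged_def image_image)
  moreover have "card (tag ` T) = N" using card_T inj_tag by (metis card_image inj_on_subset subset_UNIV)
  moreover have "tval \<gamma> = 1" if "\<gamma> \<in> tag ` T" for \<gamma> using that arc_val_T by (auto simp: tval_tag)
  ultimately show ?thesis using F_cluster_tval[OF assms(1) _ _ assms(2)] F_plain_value[OF assms(2)] by simp
qed

text \<open>The seed is governed by the swapped lambda lengths, for which the notched arcs of the
  slice have length 1; this exchanges the values \<open>c i\<close> and \<open>S * c i\<close>. The
  interchange of loops and central arcs in \<open>F_tagged\<close> does the same to the matching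
  numbers.\<close>

lemma notched_case:
  assumes \<beta>: "\<beta> \<noteq> \<alpha> + int N" and tt: "tagged_triangulation N (swap_tag ` tag ` T)" and D: "D \<in> plain_arcs N"
  shows "of_nat (F_tagged N (swap_tag ` tag ` T) D) = F_cluster N (swap_tag ` tag ` T) D"
proof -
  let ?TT = "swap_tag ` tag ` T"
  interpret sw: lambda_data N "\<lambda>x. S * c x" "\<lambda>x. t x / S\<^sup>2" "1 / S" by (rule swapped)
  have st: "sw.tval \<gamma> = tval (swap_tag \<gamma>)" for \<gamma>
    using S_pos swapped_lam by (cases \<gamma>) auto
  have noloop: "Periph i i \<notin> T" for i using loop_T \<beta> by blast
  have n: "TNotched i = swap_tag (tag D) \<longleftrightarrow> D = Central i" for i D by (cases D) auto
  have "{i. TNotched i \<in> ?TT} = {k. Central k \<in> T}" by (auto simp: image_iff n)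
  then have mn: "many_notched ?TT" using card_spokes \<beta> by (simp add: many_notched_def)
  have "forget_tag (swap_tag (tag D)) = D" if "D \<in> T" for D using that noloop by (cases D) auto
  then have fT: "forget_tag ` ?TT = T" by (simp add: image_image)
  have "card ?TT = N"
  proof -
    have "inj (swap_tag \<circ> tag)" using inj_tag by (intro inj_compose) (metis injI swap_swap)
    then have "card ((swap_tag \<circ> tag) ` T) = card T" by (metis card_image inj_on_subset subset_UNIV)
    then show ?thesis using card_T by (simp add: image_comp)
  qed
  moreover have "sw.tval \<gamma> = 1" if "\<gamma> \<in> ?TT" for \<gamma>
    using that arc_val_T by (auto simp: st tval_tag)
  ultimately have "F_cluster N ?TT D = tval (swap_tag (tag D))"
    using sw.F_cluster_tval[OF tt _ _ D] st sw.tval_tag[of D] by simp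
  moreover have "of_nat (F_tagged N ?TT D) = tval (swap_tag (tag D))"
  proof (cases D)
    case (Periph i j)
    then have "1 \<le> i" "i \<le> int N" "1 \<le> j" "j \<le> int N" using D by (auto simp: plain_arcs_def)
    then show ?thesis unfolding F_tagged_def fT Let_def using mn Periph m_central_value m_arc_value by simp
  next
    case (Central i)
    then have "1 \<le> i" "i \<le> int N" using D by (auto simp: plain_arcs_def)
    then show ?thesis unfolding F_tagged_def fT Let_def using mn Central m_loop_value by simp
  qed
  ultimately show ?thesis by simp
qed

end

theorem theorem6p6:
  fixes N :: nat and TT :: "tarc set"
  assumes "N \<ge> 3"
    and "tagged_triangulation N TT"
    and "slice N (plain_of ` TT)"
  shows "\<forall>D \<in> plain_arcs N. of_nat (F_tagged N TT D) = F_cluster N TT D"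
proof
  fix D assume D: "D \<in> plain_arcs N"
  have TT: "TT = tag ` plain_of ` TT" by (rule tag_plain_of[OF assms(1,2)])
  show "of_nat (F_tagged N TT D) = F_cluster N TT D"
  proof (rule slice_cases[OF assms(1,3)])
    fix \<alpha> \<beta> R Q assume f: "fan \<alpha> \<beta> R Q" "\<beta> = \<alpha> + int N - 1 \<or> \<beta> = \<alpha> + int N"
      and T: "plain_of ` TT = (\<lambda>(a, b). parc N a b) ` Q \<union> {spoke N \<alpha>, spoke N \<beta>}"
    obtain c t S where s: "slice_tri N c t S (plain_of ` TT) \<alpha> \<beta> R Q"
      using slice_tri_exists[OF assms(1) f T] .
    have "tagged_triangulation N (tag ` plain_of ` TT)" using assms(2) TT by simp
    then have "of_nat (F_tagged N (tag ` plain_of ` TT) D) = F_cluster N (tag ` plain_of ` TT) D"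
      by (rule slice_tri.plain_case[OF s _ D])
    then show ?thesis using TT by simp
  next
    fix \<alpha> \<beta> R Q assume f: "fan \<alpha> \<beta> R Q" and \<beta>: "\<beta> = \<alpha> + int N - 1"
      and P: "plain_of ` TT = (\<lambda>(a, b). parc N a b) ` Q \<union> {parc N \<alpha> \<alpha>, parc N \<beta> \<beta>}"
    \<comment> \<open>Replacing the two loops by the central arcs at the same points gives the arcs
      from which \<open>TT\<close> arises by swapping all tags.\<close>
    define T where "T = (\<lambda>(a, b). parc N a b) ` Q \<union> {spoke N \<alpha>, spoke N \<beta>}"
    obtain c t S where s: "slice_tri N c t S T \<alpha> \<beta> R Q"
      using slice_tri_exists[OF assms(1) f disjI1[OF \<beta>] T_def] .
    interpret slice_tri N c t S T \<alpha> \<beta> R Q by (rule s)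
    have "swap_tag (tag E) = tag E" if E: "E \<in> (\<lambda>(a, b). parc N a b) ` Q" for E
    proof -
      obtain i j where ij: "E = Periph i j" using E by auto
      have "E \<in> T" using E by (simp add: T_def)
      then have "i \<noteq> j" using loop_T[of i] ij \<beta> by auto
      then show ?thesis using ij by simp
    qed
    then have "swap_tag ` tag ` T = tag ` plain_of ` TT"
      unfolding P T_def by (simp add: image_Un image_image)
    then have st: "swap_tag ` tag ` T = TT" using TT by simp
    have "tagged_triangulation N (swap_tag ` tag ` T)" using assms(2) st by simp
    then have "of_nat (F_tagged N (swap_tag ` tag ` T) D) = F_cluster N (swap_tag ` tag ` T) D"
      using notched_case[OF _ _ D] \<beta> by simp
    then show ?thesis unfolding st .
  qed
qed

end
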